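(* Let $(M,\phi,\xi,\eta,g)$ be a 3-dimensional trans-Sasakian manifold of type $(\alpha,\beta)$, where the structure functions $\alpha$ and $\beta$ are constant with $\alpha\neq 0$. Suppose that the metric $g$ represents a $*$-conformal Ricci soliton, i.e. there exist a vector field $V$ on $M$, a constant $\lambda\in\mathbb{R}$ and a scalar field $p$ such that $$\mathcal{L}_Vg+2S^*+\left[2\lambda-\left(p+\frac{2}{3}\right)\right]g=0,$$ where $S^*$ is the $*$-Ricci tensor of $M$. Then the scalar curvature $r$ of $M$ is given by $$r=\left(1-\frac{\beta^2}{\alpha^2}\right)\left(\frac{p}{2}+\frac{1}{3}-\lambda+4\alpha^2\right).$$
   Context: An almost contact metric manifold $(M,\phi,\xi,\eta,g)$ is a smooth manifold $M$ of odd dimension $2n+1$ with a $(1,1)$-tensor field $\phi$, a vector field $\xi$, a 1-form $\eta$ and a Riemannian metric $g$ such that $\phi^2=-I+\eta\otimes\xi$, $\eta(\xi)=1$, and $g(\phi X,\phi Y)=g(X,Y)-\eta(X)\eta(Y)$ for all vector fields $X,Y$ on $M$. It then follows that $\phi\xi=0$, $\eta\circ\phi=0$, $g(X,\xi)=\eta(X)$ and $g(\phi X,Y)=-g(X,\phi Y)$. Let $\nabla$ be the Levi-Civita connection of $g$. The almost contact metric manifold is called a trans-Sasakian manifold of type $(\alpha,\beta)$ if there are smooth functions $\alpha,\beta$ on $M$ (the structure functions) such that for all vector fields $X,Y$, $$(\nabla_X\phi)Y=\alpha[g(X,Y)\xi-\eta(Y)X]+\beta[g(\phi X,Y)\xi-\eta(Y)\phi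 X],$$ $$(\nabla_X\eta)(Y)=-\alpha g(\phi X,Y)+\beta g(\phi X,\phi Y).$$ The Riemann curvature tensor is $R(X,Y)Z=\nabla_X\nabla_YZ-\nabla_Y\nabla_XZ-\nabla_{[X,Y]}Z$, and $r$ is the scalar curvature of $g$ (the trace of the Ricci tensor). The $*$-Ricci tensor is defined by $$S^*(X,Y)=\frac{1}{2}\,\mathrm{trace}\{\phi\circ R(X,\phi Y)\}$$ for all vector fields $X,Y$. In general, on an $m$-dimensional manifold the $*$-conformal Ricci soliton equation is $\mathcal{L}_Vg+2S^*+[2\lambda-(p+\frac{2}{m})]g=0$; here $m=3$. $\mathcal{L}_V$ denotes the Lie derivative along $V$, and $p$ is the scalar non-dynamical field of the conformal Ricci flow equation $\frac{\partial g}{\partial t}+2(S+\frac{g}{m})=-pg$, $r(g)=-1$ ($S$ being the Ricci tensor). *)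

theory Defs
  imports "HOL-Analysis.Analysis" "HOL-Library.Function_Algebras"
begin

section \<open>Functions into a vector space\<close>

text \<open>
  With the pointwise scalar multiplication below (addition comes from
  \<^theory>\<open>HOL-Library.Function_Algebras\<close>), tangent vectors, which are
  real-valued functionals on functions, and vector fields live in types of class
  \<^class>\<open>real_vector\<close>.
\<close>

instantiation "fun" :: (type, real_vector) real_vector
begin

definition scaleR_fun :: "real \<Rightarrow> ('a \<Rightarrow> 'b) \<Rightarrow> 'a \<Rightarrow> 'b" where
  "scaleR_fun a f = (\<lambda>x. a *\<^sub>R f x)"

instance
  by standard
    (simp_all add: scaleR_fun_def plus_fun_def fun_eq_iff scaleR_add_right scaleR_add_left)

end

lemma scaleR_fun_apply [simp]: "(a *\<^sub>R f) x = a *\<^sub>R f x"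
  by (simp add: scaleR_fun_def)

definition linear_within :: "'a::real_vector set \<Rightarrow> ('a \<Rightarrow> 'b::real_vector) \<Rightarrow> bool" where
  "linear_within T L \<longleftrightarrow>
     (\<forall>v\<in>T. \<forall>w\<in>T. L (v + w) = L v + L w) \<and> (\<forall>a. \<forall>v\<in>T. L (a *\<^sub>R v) = a *\<^sub>R L v)"

definition basis_of :: "'a::real_vector set \<Rightarrow> 'a set \<Rightarrow> bool" where
  "basis_of T B \<longleftrightarrow> independent B \<and> span B = T"

text \<open>
  The trace of an endomorphism of a finite-dimensional subspace \<open>T\<close>: the sum of the
  diagonal entries of its matrix in a basis of \<open>T\<close> (any basis gives the same value).
\<close>
definition trace_on :: "'a::real_vector set \<Rightarrow> ('a \<Rightarrow> 'a) \<Rightarrow> real" where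
  "trace_on T L = (let B = (SOME B. basis_of T B) in \<Sum>b\<in>B. representation B (L b) b)"


section \<open>Smooth manifolds\<close>

text \<open>
  \<open>Ck_on k S f\<close> says that \<open>f\<close> is \<open>k\<close> times continuously differentiable on the open set \<open>S\<close>
  of a finite-dimensional space.
\<close>
primrec Ck_on :: "nat \<Rightarrow> 'a::real_normed_vector set \<Rightarrow> ('a \<Rightarrow> 'b::real_normed_vector) \<Rightarrow> bool" where
  "Ck_on 0 S f = continuous_on S f"
| "Ck_on (Suc k) S f =
     ((\<forall>x\<in>S. f differentiable (at x)) \<and> (\<forall>v. Ck_on k S (\<lambda>x. frechet_derivative f (at x) v)))"

definition smooth_on :: "'a::real_normed_vector set \<Rightarrow> ('a \<Rightarrow> 'b::real_normed_vector) \<Rightarrow> bool" where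
  "smooth_on S f \<longleftrightarrow> (\<forall>k. Ck_on k S f)"

type_synonym ('m, 'e) chart = "'m set \<times> ('m \<Rightarrow> 'e)"

text \<open>
  The manifold is the whole type \<open>'m\<close>, modelled on \<open>'e\<close>, so its dimension is \<open>DIM('e)\<close>.
  The smooth structure is given by an atlas, which need not be maximal; a chart is a
  coordinate map together with its domain.
\<close>
definition smooth_manifold ::
  "('m::{t2_space,second_countable_topology}, 'e::euclidean_space) chart set \<Rightarrow> bool" where
  "smooth_manifold A \<longleftrightarrow>
     (\<forall>(U, c)\<in>A. open U \<and> open (c ` U) \<and> homeomorphism U (c ` U) c (inv_into U c)) \<and>
     (\<Union>(U, c)\<in>A. U) = UNIV \<and>
     (\<forall>(U, c)\<in>A. \<forall>(W, d)\<in>A. smooth_on (c ` (U \<inter> W)) (d \<circ> inv_into U c))"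

definition smooth_fun ::
  "('m, 'e::euclidean_space) chart set \<Rightarrow> ('m \<Rightarrow> real) \<Rightarrow> bool" where
  "smooth_fun A f \<longleftrightarrow> (\<forall>(U, c)\<in>A. smooth_on (c ` U) (f \<circ> inv_into U c))"

type_synonym 'm tvec = "('m \<Rightarrow> real) \<Rightarrow> real"
type_synonym 'm vfield = "'m \<Rightarrow> 'm tvec"

text \<open>
  Tangent vectors at \<open>x\<close> are the point derivations of the algebra of smooth functions.  As HOL
  functions are total, they are required to vanish on functions that are not smooth, so that
  equality of tangent vectors is equality of functionals.
\<close>
definition tangent_space ::
  "('m, 'e::euclidean_space) chart set \<Rightarrow> 'm \<Rightarrow> 'm tvec set" where
  "tangent_space A x = {v.
     (\<forall>f h. smooth_fun A f \<longrightarrow> smooth_fun A h \<longrightarrow>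
        v (f + h) = v f + v h \<and> v (f * h) = f x * v h + h x * v f) \<and>
     (\<forall>a f. smooth_fun A f \<longrightarrow> v (a *\<^sub>R f) = a * v f) \<and>
     (\<forall>f. \<not> smooth_fun A f \<longrightarrow> v f = 0)}"


section \<open>Tensor fields\<close>

definition vector_field ::
  "('m, 'e::euclidean_space) chart set \<Rightarrow> 'm vfield \<Rightarrow> bool" where
  "vector_field A X \<longleftrightarrow>
     (\<forall>x. X x \<in> tangent_space A x) \<and>
     (\<forall>f. smooth_fun A f \<longrightarrow> smooth_fun A (\<lambda>x. X x f))"

definition lie_bracket :: "'m vfield \<Rightarrow> 'm vfield \<Rightarrow> 'm vfield" where
  "lie_bracket X Y = (\<lambda>x f. X x (\<lambda>y. Y y f) - Y x (\<lambda>y. X y f))"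

definition one_form ::
  "('m, 'e::euclidean_space) chart set \<Rightarrow> ('m \<Rightarrow> 'm tvec \<Rightarrow> real) \<Rightarrow> bool" where
  "one_form A \<eta> \<longleftrightarrow>
     (\<forall>x. linear_within (tangent_space A x) (\<eta> x)) \<and>
     (\<forall>X. vector_field A X \<longrightarrow> smooth_fun A (\<lambda>x. \<eta> x (X x)))"

definition tensor_field_11 ::
  "('m, 'e::euclidean_space) chart set \<Rightarrow> ('m \<Rightarrow> 'm tvec \<Rightarrow> 'm tvec) \<Rightarrow> bool" where
  "tensor_field_11 A \<phi> \<longleftrightarrow>
     (\<forall>x. \<phi> x ` tangent_space A x \<subseteq> tangent_space A x \<and>
          linear_within (tangent_space A x) (\<phi> x)) \<and>
     (\<forall>X. vector_field A X \<longrightarrow> vector_field A (\<lambda>x. \<phi> x (X x)))"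

definition riemannian_metric ::
  "('m, 'e::euclidean_space) chart set \<Rightarrow> ('m \<Rightarrow> 'm tvec \<Rightarrow> 'm tvec \<Rightarrow> real) \<Rightarrow> bool" where
  "riemannian_metric A g \<longleftrightarrow>
     (\<forall>x. \<forall>v\<in>tangent_space A x.
        linear_within (tangent_space A x) (g x v) \<and>
        (\<forall>w\<in>tangent_space A x. g x v w = g x w v) \<and>
        (v \<noteq> 0 \<longrightarrow> g x v v > 0)) \<and>
     (\<forall>X Y. vector_field A X \<longrightarrow> vector_field A Y \<longrightarrow> smooth_fun A (\<lambda>x. g x (X x) (Y x)))"

text \<open>\<open>lie_metric V g X Y\<close> is the function \<open>(L\<^sub>V g)(X, Y)\<close>.\<close>
definition lie_metric ::
  "'m vfield \<Rightarrow> ('m \<Rightarrow> 'm tvec \<Rightarrow> 'm tvec \<Rightarrow> real) \<Rightarrow> 'm vfield \<Rightarrow> 'm vfield \<Rightarrow> 'm \<Rightarrow> real" where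
  "lie_metric V g X Y = (\<lambda>x. V x (\<lambda>y. g y (X y) (Y y))
     - g x (lie_bracket V X x) (Y x) - g x (X x) (lie_bracket V Y x))"


section \<open>Levi-Civita connection and curvature\<close>

definition affine_connection ::
  "('m, 'e::euclidean_space) chart set \<Rightarrow> ('m vfield \<Rightarrow> 'm vfield \<Rightarrow> 'm vfield) \<Rightarrow> bool" where
  "affine_connection A N \<longleftrightarrow>
     (\<forall>X Y. vector_field A X \<longrightarrow> vector_field A Y \<longrightarrow> vector_field A (N X Y)) \<and>
     (\<forall>X X' Y. vector_field A X \<longrightarrow> vector_field A X' \<longrightarrow> vector_field A Y \<longrightarrow>
        N (X + X') Y = N X Y + N X' Y) \<and>
     (\<forall>f X Y. smooth_fun A f \<longrightarrow> vector_field A X \<longrightarrow> vector_field A Y \<longrightarrow>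
        N (\<lambda>x. f x *\<^sub>R X x) Y = (\<lambda>x. f x *\<^sub>R N X Y x)) \<and>
     (\<forall>X Y Y'. vector_field A X \<longrightarrow> vector_field A Y \<longrightarrow> vector_field A Y' \<longrightarrow>
        N X (Y + Y') = N X Y + N X Y') \<and>
     (\<forall>f X Y. smooth_fun A f \<longrightarrow> vector_field A X \<longrightarrow> vector_field A Y \<longrightarrow>
        N X (\<lambda>x. f x *\<^sub>R Y x) = (\<lambda>x. X x f *\<^sub>R Y x + f x *\<^sub>R N X Y x))"

definition levi_civita ::
  "('m, 'e::euclidean_space) chart set \<Rightarrow> ('m \<Rightarrow> 'm tvec \<Rightarrow> 'm tvec \<Rightarrow> real) \<Rightarrow>
    ('m vfield \<Rightarrow> 'm vfield \<Rightarrow> 'm vfield) \<Rightarrow> bool" where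
  "levi_civita A g N \<longleftrightarrow>
     affine_connection A N \<and>
     (\<forall>X Y. vector_field A X \<longrightarrow> vector_field A Y \<longrightarrow> N X Y - N Y X = lie_bracket X Y) \<and>
     (\<forall>X Y Z. vector_field A X \<longrightarrow> vector_field A Y \<longrightarrow> vector_field A Z \<longrightarrow>
        (\<forall>x. X x (\<lambda>y. g y (Y y) (Z y)) = g x (N X Y x) (Z x) + g x (Y x) (N X Z x)))"

definition curvature ::
  "('m vfield \<Rightarrow> 'm vfield \<Rightarrow> 'm vfield) \<Rightarrow> 'm vfield \<Rightarrow> 'm vfield \<Rightarrow> 'm vfield \<Rightarrow> 'm vfield" where
  "curvature N X Y Z = N X (N Y Z) - N Y (N X Z) - N (lie_bracket X Y) Z"

definition extension ::
  "('m, 'e::euclidean_space) chart set \<Rightarrow> 'm \<Rightarrow> 'm tvec \<Rightarrow> 'm vfield" where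
  "extension A x v = (SOME X. vector_field A X \<and> X x = v)"

text \<open>
  The value at \<open>x\<close> of the curvature tensor: since \<open>R(X,Y)Z\<close> is linear over the smooth functions
  in all arguments, the choice of the extending vector fields is irrelevant.
\<close>
definition curvature_at ::
  "('m, 'e::euclidean_space) chart set \<Rightarrow> ('m vfield \<Rightarrow> 'm vfield \<Rightarrow> 'm vfield) \<Rightarrow>
    'm \<Rightarrow> 'm tvec \<Rightarrow> 'm tvec \<Rightarrow> 'm tvec \<Rightarrow> 'm tvec" where
  "curvature_at A N x u v w = curvature N (extension A x u) (extension A x v) (extension A x w) x"

text \<open>\<open>S(Y, Z) = trace {X \<mapsto> R(X, Y)Z}\<close>, which is positive on round spheres.\<close>
definition ricci ::
  "('m, 'e::euclidean_space) chart set \<Rightarrow> ('m vfield \<Rightarrow> 'm vfield \<Rightarrow> 'm vfield) \<Rightarrow>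
    'm \<Rightarrow> 'm tvec \<Rightarrow> 'm tvec \<Rightarrow> real" where
  "ricci A N x v w = trace_on (tangent_space A x) (\<lambda>u. curvature_at A N x u v w)"

definition orthonormal_basis_at ::
  "('m, 'e::euclidean_space) chart set \<Rightarrow> ('m \<Rightarrow> 'm tvec \<Rightarrow> 'm tvec \<Rightarrow> real) \<Rightarrow>
    'm \<Rightarrow> 'm tvec set \<Rightarrow> bool" where
  "orthonormal_basis_at A g x B \<longleftrightarrow>
     basis_of (tangent_space A x) B \<and> (\<forall>u\<in>B. \<forall>v\<in>B. g x u v = (if u = v then 1 else 0))"

text \<open>The trace of the Ricci tensor with respect to \<open>g\<close>.\<close>
definition scalar_curvature ::
  "('m, 'e::euclidean_space) chart set \<Rightarrow> ('m \<Rightarrow> 'm tvec \<Rightarrow> 'm tvec \<Rightarrow> real) \<Rightarrow>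
    ('m vfield \<Rightarrow> 'm vfield \<Rightarrow> 'm vfield) \<Rightarrow> 'm \<Rightarrow> real" where
  "scalar_curvature A g N x =
     (let B = (SOME B. orthonormal_basis_at A g x B) in \<Sum>e\<in>B. ricci A N x e e)"


section \<open>Trans-Sasakian manifolds and $*$-conformal Ricci solitons\<close>

definition almost_contact_metric ::
  "('m::{t2_space,second_countable_topology}, 'e::euclidean_space) chart set \<Rightarrow>
    ('m \<Rightarrow> 'm tvec \<Rightarrow> 'm tvec) \<Rightarrow> 'm vfield \<Rightarrow> ('m \<Rightarrow> 'm tvec \<Rightarrow> real) \<Rightarrow>
    ('m \<Rightarrow> 'm tvec \<Rightarrow> 'm tvec \<Rightarrow> real) \<Rightarrow> bool" where
  "almost_contact_metric A \<phi> \<xi> \<eta> g \<longleftrightarrow>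
     smooth_manifold A \<and> odd DIM('e) \<and>
     tensor_field_11 A \<phi> \<and> vector_field A \<xi> \<and> one_form A \<eta> \<and> riemannian_metric A g \<and>
     (\<forall>x. \<forall>v\<in>tangent_space A x. \<phi> x (\<phi> x v) = - v + \<eta> x v *\<^sub>R \<xi> x) \<and>
     (\<forall>x. \<eta> x (\<xi> x) = 1) \<and>
     (\<forall>X Y. vector_field A X \<longrightarrow> vector_field A Y \<longrightarrow>
        (\<forall>x. g x (\<phi> x (X x)) (\<phi> x (Y x)) = g x (X x) (Y x) - \<eta> x (X x) * \<eta> x (Y x)))"

text \<open>
  \<open>(\<nabla>\<^sub>X \<phi>)Y = \<nabla>\<^sub>X (\<phi>Y) - \<phi>(\<nabla>\<^sub>X Y)\<close> and \<open>(\<nabla>\<^sub>X \<eta>)(Y) = X(\<eta>(Y)) - \<eta>(\<nabla>\<^sub>X Y)\<close>.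
\<close>
definition cov_deriv_11 ::
  "('m vfield \<Rightarrow> 'm vfield \<Rightarrow> 'm vfield) \<Rightarrow> ('m \<Rightarrow> 'm tvec \<Rightarrow> 'm tvec) \<Rightarrow>
    'm vfield \<Rightarrow> 'm vfield \<Rightarrow> 'm vfield" where
  "cov_deriv_11 N \<phi> X Y = (\<lambda>x. N X (\<lambda>y. \<phi> y (Y y)) x - \<phi> x (N X Y x))"

definition cov_deriv_form ::
  "('m vfield \<Rightarrow> 'm vfield \<Rightarrow> 'm vfield) \<Rightarrow> ('m \<Rightarrow> 'm tvec \<Rightarrow> real) \<Rightarrow>
    'm vfield \<Rightarrow> 'm vfield \<Rightarrow> 'm \<Rightarrow> real" where
  "cov_deriv_form N \<eta> X Y = (\<lambda>x. X x (\<lambda>y. \<eta> y (Y y)) - \<eta> x (N X Y x))"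

text \<open>
  The argument \<open>N\<close> is the Levi-Civita connection of \<open>g\<close>; it is determined by \<open>g\<close> on vector fields.
\<close>
definition trans_sasakian ::
  "('m::{t2_space,second_countable_topology}, 'e::euclidean_space) chart set \<Rightarrow>
    ('m \<Rightarrow> 'm tvec \<Rightarrow> 'm tvec) \<Rightarrow> 'm vfield \<Rightarrow> ('m \<Rightarrow> 'm tvec \<Rightarrow> real) \<Rightarrow>
    ('m \<Rightarrow> 'm tvec \<Rightarrow> 'm tvec \<Rightarrow> real) \<Rightarrow> ('m vfield \<Rightarrow> 'm vfield \<Rightarrow> 'm vfield) \<Rightarrow>
    ('m \<Rightarrow> real) \<Rightarrow> ('m \<Rightarrow> real) \<Rightarrow> bool" where
  "trans_sasakian A \<phi> \<xi> \<eta> g N \<alpha> \<beta> \<longleftrightarrow>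
     almost_contact_metric A \<phi> \<xi> \<eta> g \<and> levi_civita A g N \<and>
     smooth_fun A \<alpha> \<and> smooth_fun A \<beta> \<and>
     (\<forall>X Y. vector_field A X \<longrightarrow> vector_field A Y \<longrightarrow> (\<forall>x.
        cov_deriv_11 N \<phi> X Y x =
          \<alpha> x *\<^sub>R (g x (X x) (Y x) *\<^sub>R \<xi> x - \<eta> x (Y x) *\<^sub>R X x) +
          \<beta> x *\<^sub>R (g x (\<phi> x (X x)) (Y x) *\<^sub>R \<xi> x - \<eta> x (Y x) *\<^sub>R \<phi> x (X x)) \<and>
        cov_deriv_form N \<eta> X Y x =
          - \<alpha> x * g x (\<phi> x (X x)) (Y x) + \<beta> x * g x (\<phi> x (X x)) (\<phi> x (Y x))))"

definition star_ricci ::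
  "('m, 'e::euclidean_space) chart set \<Rightarrow> ('m \<Rightarrow> 'm tvec \<Rightarrow> 'm tvec) \<Rightarrow>
    ('m vfield \<Rightarrow> 'm vfield \<Rightarrow> 'm vfield) \<Rightarrow> 'm \<Rightarrow> 'm tvec \<Rightarrow> 'm tvec \<Rightarrow> real" where
  "star_ricci A \<phi> N x v w =
     1 / 2 * trace_on (tangent_space A x) (\<lambda>u. \<phi> x (curvature_at A N x v (\<phi> x w) u))"

text \<open>\<open>L\<^sub>V g + 2S* + [2\<lambda> - (p + 2/m)]g = 0\<close>, where \<open>m\<close> is the dimension of the manifold.\<close>
definition star_conformal_ricci_soliton ::
  "('m, 'e::euclidean_space) chart set \<Rightarrow> ('m \<Rightarrow> 'm tvec \<Rightarrow> 'm tvec) \<Rightarrow>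
    ('m \<Rightarrow> 'm tvec \<Rightarrow> 'm tvec \<Rightarrow> real) \<Rightarrow> ('m vfield \<Rightarrow> 'm vfield \<Rightarrow> 'm vfield) \<Rightarrow>
    'm vfield \<Rightarrow> real \<Rightarrow> ('m \<Rightarrow> real) \<Rightarrow> bool" where
  "star_conformal_ricci_soliton A \<phi> g N V lam p \<longleftrightarrow>
     vector_field A V \<and> smooth_fun A p \<and>
     (\<forall>X Y. vector_field A X \<longrightarrow> vector_field A Y \<longrightarrow> (\<forall>x.
        lie_metric V g X Y x + 2 * star_ricci A \<phi> N x (X x) (Y x) +
          (2 * lam - (p x + 2 / real DIM('e))) * g x (X x) (Y x) = 0))"

end

theory Submission
  imports Defs "HOL-Computational_Algebra.Polynomial"
begin

text \<open>
  Write \<open>K\<close> for the sectional curvature of the contact planes (the kernel of \<open>\<eta>\<close>) and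
  \<open>c = 2\<lambda> - (p + 2/3)\<close>.

  First, \<open>\<beta> = 0\<close>.  The curvature tensor of a Levi-Civita connection satisfies pair symmetry, so the
  endomorphism \<open>Y \<mapsto> R(Y, \<xi>)\<xi>\<close> is self-adjoint; the structure equations give it the skew part
  \<open>2\<alpha>\<beta>\<phi>\<close>, and \<open>\<alpha> \<noteq> 0\<close> (\<open>beta_zero\<close>).  What remains is an \<open>\<alpha>\<close>-Sasakian threefold: \<open>\<nabla>\<^sub>Y \<xi> = - \<alpha> \<phi> Y\<close>,
  the field \<open>\<xi>\<close> preserves the whole structure, and the curvature is determined by \<open>\<alpha>\<close> and \<open>K\<close>.  In
  particular \<open>S\<^sup>* = K (g - \<eta> \<otimes> \<eta>)\<close> and \<open>r = 2K + 4\<alpha>\<^sup>2\<close> (\<open>star_ricci_eq\<close>, \<open>scalar_curvature_eq\<close>), so the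
  claim is \<open>K = - c/4\<close>.

  Split \<open>V = X + \<eta>(V)\<xi>\<close> with \<open>X\<close> horizontal and put \<open>f = - K - c/2\<close>; the claim reads \<open>f = K\<close>.  The soliton
  equation says that along the contact planes the covariant derivative of \<open>X\<close> is \<open>f + \<rho>\<phi>\<close> for some
  function \<open>\<rho>\<close> (\<open>X\<close> satisfies the transverse Cauchy-Riemann equations, \<open>cr_X\<close>) and that the
  gradient of \<open>\<eta>(V)\<close> is \<open>2\<alpha>\<phi>X - [\<xi>, X] + (f + K)\<xi>\<close>.  Its integrability conditions are obtained by taking divergence
  and rotation of horizontal gradients: the contact planes are not integrable, so the rotation of a
  horizontal gradient is a multiple of the derivative along \<open>\<xi>\<close> (\<open>hrot_hgrad\<close>), and one curvature
  component expresses the gradient of \<open>\<rho>\<close> by that of \<open>f\<close> (\<open>cr_rotation_gradient\<close>).  The outcome is a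
  third order equation for \<open>X\<close> along \<open>\<xi>\<close> (\<open>ph_X3\<close>) and two scalar equations for the second derivative
  of \<open>f\<close> along \<open>\<xi>\<close> (\<open>laplace_relations\<close>).

  If \<open>K\<close> has vanishing gradient, the two scalar equations make \<open>f\<close> a function of \<open>K\<close>, hence of vanishing
  gradient; then \<open>[\<xi>, X] = 0\<close> and \<open>f = K\<close> (\<open>f_eq_sec_if_constant\<close>).

  The gradient of \<open>K\<close> does vanish (\<open>GK_zero\<close>).  Where it does not, the third order equation forces
  \<open>[\<xi>, [\<xi>, X]] = 0\<close>, which reduces all data to functions of one variable: with \<open>\<kappa> = K + \<alpha>\<^sup>2\<close> one finds
  \<open>w = f - K\<close> equal to \<open>- 2\<kappa> - 4\<alpha>\<^sup>2 ln \<bar>\<kappa>\<bar>\<close> up to a constant, while the remaining equations yield a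
  polynomial relation between \<open>\<kappa>\<close> and \<open>w\<close>.  As the logarithm is transcendental, there is none
  (\<open>log_transcendental\<close>).

  Tangent vectors are derivations of the algebra of globally defined smooth functions, so the argument
  rests on two facts about manifolds: tangent spaces have the dimension of the model space
  (\<open>tangent_space_basis\<close>), and tangent vectors extend to global vector fields (\<open>tangent_extension\<close>).
  Everything local is phrased with global fields, at the price of horizontal frames that are
  normalised at one point only and may vanish elsewhere.
\<close>

section \<open>Smooth functions on Euclidean spaces\<close>

lemma Ck_on_Suc_imp: "Ck_on (Suc k) S f \<Longrightarrow> Ck_on k S f"
proof (induction k arbitrary: f)
  case 0
  then show ?case
    by (auto simp: continuous_on_eq_continuous_within intro!: differentiable_imp_continuous_within
        dest: differentiable_at_withinI)
qed auto

lemma Ck_on_cong: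
  assumes "open S" "\<And>x. x \<in> S \<Longrightarrow> f x = h x" "Ck_on k S f"
  shows "Ck_on k S h"
  using assms(2,3)
proof (induction k arbitrary: f h)
  case 0
  then show ?case by (simp cong: continuous_on_cong)
next
  case (Suc k)
  have D: "frechet_derivative f (at x) = frechet_derivative h (at x)" if "x \<in> S" for x
  proof -
    have "(f has_derivative F) (at x) \<longleftrightarrow> (h has_derivative F) (at x)" for F
      using has_derivative_transform_within_open[OF _ assms(1) that, of f F UNIV h]
        has_derivative_transform_within_open[OF _ assms(1) that, of h F UNIV f] Suc.prems(1) by auto
    then show ?thesis unfolding frechet_derivative_def by simp
  qed
  have "h differentiable at x" if "x \<in> S" for x
  proof -
    have "f differentiable at x" using Suc.prems(2) that by simp
    then obtain F where "(f has_derivative F) (at x)" unfolding differentiable_def ..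
    then have "(h has_derivative F) (at x)"
      using has_derivative_transform_within_open[OF _ assms(1) that, of f F UNIV h] Suc.prems(1) by auto
    then show ?thesis by (auto simp: differentiable_def)
  qed
  moreover have "Ck_on k S (\<lambda>x. frechet_derivative h (at x) v)" for v
    by (rule Suc.IH[of "\<lambda>x. frechet_derivative f (at x) v"]) (use D Suc.prems in auto)
  ultimately show ?case by simp
qed

lemma Ck_on_subset: "Ck_on k S f \<Longrightarrow> T \<subseteq> S \<Longrightarrow> Ck_on k T f"
  by (induction k arbitrary: f) (auto intro: continuous_on_subset)

lemma Ck_on_local:
  assumes "\<And>x. x \<in> S \<Longrightarrow> \<exists>T. open T \<and> x \<in> T \<and> Ck_on k T f"
  shows "Ck_on k S f"
  using assms
proof (induction k arbitrary: f)
  case 0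
  then have "\<exists>T. open T \<and> x \<in> T \<and> continuous_on T f" if "x \<in> S" for x using that by simp
  then show ?case
    unfolding Ck_on.simps
    by (metis continuous_at_imp_continuous_on continuous_on_eq_continuous_at)
next
  case (Suc k)
  show ?case
    unfolding Ck_on.simps
  proof (intro conjI ballI allI)
    show "f differentiable at x" if "x \<in> S" for x
      using Suc.prems[OF that] by auto
    show "Ck_on k S (\<lambda>x. frechet_derivative f (at x) v)" for v
    proof (rule Suc.IH)
      fix x assume "x \<in> S"
      then show "\<exists>T. open T \<and> x \<in> T \<and> Ck_on k T (\<lambda>x. frechet_derivative f (at x) v)"
        using Suc.prems by force
    qed
  qed
qed

lemma Ck_on_const: "Ck_on k S (\<lambda>_. c)"
  by (induction k arbitrary: c) (auto simp: frechet_derivative_const)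

lemma Ck_on_linear: "bounded_linear f \<Longrightarrow> Ck_on k S f"
proof (cases k)
  case 0
  then show "bounded_linear f \<Longrightarrow> Ck_on k S f" by (simp add: linear_continuous_on)
next
  case (Suc n)
  assume l: "bounded_linear f"
  have "frechet_derivative f (at x) = f" for x
    using frechet_derivative_at bounded_linear_imp_has_derivative[OF l] by metis
  then show ?thesis using Suc l
    by (auto simp: Ck_on_const bounded_linear_imp_differentiable)
qed

lemma Ck_on_add:
  "open S \<Longrightarrow> Ck_on k S f \<Longrightarrow> Ck_on k S h \<Longrightarrow> Ck_on k S (\<lambda>x. f x + h x)"
proof (induction k arbitrary: f h)
  case 0
  then show ?case by (auto intro: continuous_intros)
next
  case (Suc k)
  have D: "frechet_derivative (\<lambda>x. f x + h x) (at x) v =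
      frechet_derivative f (at x) v + frechet_derivative h (at x) v" if "x \<in> S" for x v
  proof -
    have "((\<lambda>x. f x + h x) has_derivative
      (\<lambda>v. frechet_derivative f (at x) v + frechet_derivative h (at x) v)) (at x)"
      using Suc.prems that
      by (intro has_derivative_add) (auto simp: frechet_derivative_works[symmetric])
    then show ?thesis using frechet_derivative_at by metis
  qed
  have "Ck_on k S (\<lambda>x. frechet_derivative (\<lambda>x. f x + h x) (at x) v)" for v
    by (rule Ck_on_cong[OF \<open>open S\<close> _ Suc.IH[of "\<lambda>x. frechet_derivative f (at x) v" "\<lambda>x. frechet_derivative h (at x) v"]])
      (use D Suc.prems in auto)
  then show ?case using Suc.prems by auto
qed

lemma Ck_on_mult:
  fixes f h :: "'a::real_normed_vector \<Rightarrow> real"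
  shows "open S \<Longrightarrow> Ck_on k S f \<Longrightarrow> Ck_on k S h \<Longrightarrow> Ck_on k S (\<lambda>x. f x * h x)"
proof (induction k arbitrary: f h)
  case 0
  then show ?case by (auto intro: continuous_intros)
next
  case (Suc k)
  have D: "frechet_derivative (\<lambda>x. f x * h x) (at x) v =
      f x * frechet_derivative h (at x) v + frechet_derivative f (at x) v * h x" if "x \<in> S" for x v
  proof -
    have "((\<lambda>x. f x * h x) has_derivative
      (\<lambda>v. f x * frechet_derivative h (at x) v + frechet_derivative f (at x) v * h x)) (at x)"
      using Suc.prems that
      by (intro has_derivative_mult) (auto simp: frechet_derivative_works[symmetric])
    then show ?thesis using frechet_derivative_at by metis
  qed
  have "Ck_on k S (\<lambda>x. frechet_derivative (\<lambda>x. f x * h x) (at x) v)" for v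
  proof (rule Ck_on_cong[OF \<open>open S\<close>])
    show "Ck_on k S (\<lambda>x. f x * frechet_derivative h (at x) v + frechet_derivative f (at x) v * h x)"
      using Suc.prems Ck_on_Suc_imp
      by (intro Ck_on_add Suc.IH) auto
  qed (use D in auto)
  then show ?case using Suc.prems by auto
qed

lemma Ck_on_inverse:
  fixes f :: "'a::real_normed_vector \<Rightarrow> real"
  shows "open S \<Longrightarrow> (\<And>x. x \<in> S \<Longrightarrow> f x \<noteq> 0) \<Longrightarrow> Ck_on k S f \<Longrightarrow> Ck_on k S (\<lambda>x. inverse (f x))"
proof (induction k)
  case 0
  then show ?case by (auto intro: continuous_intros)
next
  case (Suc k)
  have H: "((\<lambda>x. inverse (f x)) has_derivative
      (\<lambda>v. (-1) * ((inverse (f x) * frechet_derivative f (at x) v) * inverse (f x)))) (at x)" if "x \<in> S" for x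
    using Suc.prems that
    by (auto intro!: derivative_eq_intros simp: frechet_derivative_works[symmetric])
  then have D: "frechet_derivative (\<lambda>x. inverse (f x)) (at x) v =
      (-1) * ((inverse (f x) * frechet_derivative f (at x) v) * inverse (f x))" if "x \<in> S" for x v
    using that frechet_derivative_at by metis
  have "Ck_on k S (\<lambda>x. frechet_derivative (\<lambda>x. inverse (f x)) (at x) v)" for v
  proof (rule Ck_on_cong[OF \<open>open S\<close>])
    show "Ck_on k S (\<lambda>x. (-1) * ((inverse (f x) * frechet_derivative f (at x) v) * inverse (f x)))"
      using Suc.prems Ck_on_Suc_imp Suc.IH
      by (intro Ck_on_mult Ck_on_const) auto
  qed (use D in auto)
  then show ?case using H by (auto simp: differentiable_def)
qed

lemma Ck_on_sum:
  assumes "finite I" "open S" "\<And>i. i \<in> I \<Longrightarrow> Ck_on k S (f i)"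
  shows "Ck_on k S (\<lambda>x. \<Sum>i\<in>I. f i x)"
  using assms(1,3)
proof (induction I rule: finite_induct)
  case empty
  then show ?case by (simp add: Ck_on_const)
next
  case (insert i I)
  then show ?case using Ck_on_add[OF assms(2), of k "f i" "\<lambda>x. \<Sum>i\<in>I. f i x"] by simp
qed

lemma Ck_on_inner: "open S \<Longrightarrow> Ck_on k S f \<Longrightarrow> Ck_on k S (\<lambda>x. f x \<bullet> b)"
proof (induction k arbitrary: f)
  case 0
  then show ?case by (auto intro: continuous_intros)
next
  case (Suc k)
  have H: "((\<lambda>x. f x \<bullet> b) has_derivative (\<lambda>v. frechet_derivative f (at x) v \<bullet> b)) (at x)"
    if "x \<in> S" for x
    using Suc.prems(2) that
    by (intro bounded_linear.has_derivative[OF bounded_linear_inner_left])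
      (simp add: frechet_derivative_works[symmetric])
  then have D: "frechet_derivative (\<lambda>x. f x \<bullet> b) (at x) v = frechet_derivative f (at x) v \<bullet> b"
    if "x \<in> S" for x v
    using frechet_derivative_at that by metis
  have "Ck_on k S (\<lambda>x. frechet_derivative (\<lambda>x. f x \<bullet> b) (at x) v)" for v
    by (rule Ck_on_cong[OF \<open>open S\<close> _ Suc.IH[of "\<lambda>x. frechet_derivative f (at x) v"]])
      (use D Suc.prems in auto)
  then show ?case using H by (auto simp: differentiable_def)
qed

lemma frechet_derivative_chain:
  fixes f :: "'a::real_normed_vector \<Rightarrow> 'b::euclidean_space" and h :: "'b \<Rightarrow> real"
  assumes "f differentiable at x" "h differentiable at (f x)"
  shows "((\<lambda>x. h (f x)) has_derivative
      (\<lambda>v. \<Sum>b\<in>Basis. (frechet_derivative f (at x) v \<bullet> b) * frechet_derivative h (at (f x)) b)) (at x)"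
proof -
  have h: "(h has_derivative frechet_derivative h (at (f x))) (at (f x))"
    using assms(2) by (simp add: frechet_derivative_works[symmetric])
  have "((\<lambda>x. h (f x)) has_derivative
      (\<lambda>v. frechet_derivative h (at (f x)) (frechet_derivative f (at x) v))) (at x)"
    using assms(1) has_derivative_compose[of f "frechet_derivative f (at x)" x UNIV h, OF _ h]
    by (simp add: frechet_derivative_works[symmetric])
  then show ?thesis
  proof (rule has_derivative_eq_rhs, intro ext)
    fix v
    define w where "w = frechet_derivative f (at x) v"
  have "frechet_derivative h (at (f x)) w = (\<Sum>b\<in>Basis. (w \<bullet> b) * frechet_derivative h (at (f x)) b)"
  proof -
    have l: "linear (frechet_derivative h (at (f x)))" using h has_derivative_linear by blast
    have "frechet_derivative h (at (f x)) w =
      frechet_derivative h (at (f x)) (\<Sum>b\<in>Basis. (w \<bullet> b) *\<^sub>R b)"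
      by (simp add: euclidean_representation)
    also have "\<dots> = (\<Sum>b\<in>Basis. (w \<bullet> b) * frechet_derivative h (at (f x)) b)"
      by (simp add: linear_sum[OF l] linear_cmul[OF l])
    finally show ?thesis .
  qed
    then show "frechet_derivative h (at (f x)) (frechet_derivative f (at x) v) =
        (\<Sum>b\<in>Basis. (frechet_derivative f (at x) v \<bullet> b) * frechet_derivative h (at (f x)) b)"
      by (simp only: w_def)
  qed
qed

lemma Ck_on_compose:
  fixes f :: "'a::real_normed_vector \<Rightarrow> 'b::euclidean_space" and h :: "'b \<Rightarrow> real"
  shows "open S \<Longrightarrow> f ` S \<subseteq> T \<Longrightarrow> Ck_on k S f \<Longrightarrow> Ck_on k T h \<Longrightarrow> Ck_on k S (\<lambda>x. h (f x))"
\<comment> \<open>The outer function varies in the induction: the chain rule brings in its partial derivatives.\<close>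
proof (induction k arbitrary: h)
  case 0
  then show ?case by (auto intro: continuous_on_compose2)
next
  case (Suc k)
  have H: "((\<lambda>x. h (f x)) has_derivative
      (\<lambda>v. \<Sum>b\<in>Basis. (frechet_derivative f (at x) v \<bullet> b) * frechet_derivative h (at (f x)) b)) (at x)"
    if "x \<in> S" for x
    using Suc.prems that by (intro frechet_derivative_chain) auto
  have "Ck_on k S (\<lambda>x. frechet_derivative (\<lambda>x. h (f x)) (at x) v)" for v
  proof (rule Ck_on_cong[OF \<open>open S\<close>])
    show "Ck_on k S (\<lambda>x. \<Sum>b\<in>Basis. (frechet_derivative f (at x) v \<bullet> b) * frechet_derivative h (at (f x)) b)"
      using Suc.prems Ck_on_Suc_imp[of k S f]
      by (intro Ck_on_sum Ck_on_mult Ck_on_inner Suc.IH) auto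
    show "(\<Sum>b\<in>Basis. (frechet_derivative f (at x) v \<bullet> b) * frechet_derivative h (at (f x)) b) =
      frechet_derivative (\<lambda>x. h (f x)) (at x) v" if "x \<in> S" for x
      using frechet_derivative_at[OF H[OF that]] by metis
  qed
  then show ?case using H by (auto simp: differentiable_def)
qed

lemma smooth_on_imp_Ck: "smooth_on S f \<Longrightarrow> Ck_on k S f"
  by (simp add: smooth_on_def)

lemma smooth_on_cong:
  "smooth_on S f \<Longrightarrow> open S \<Longrightarrow> (\<And>x. x \<in> S \<Longrightarrow> f x = h x) \<Longrightarrow> smooth_on S h"
  unfolding smooth_on_def using Ck_on_cong by blast

lemma smooth_on_subset: "smooth_on S f \<Longrightarrow> T \<subseteq> S \<Longrightarrow> smooth_on T f"
  unfolding smooth_on_def using Ck_on_subset by blast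

lemma smooth_on_local:
  "(\<And>x. x \<in> S \<Longrightarrow> \<exists>T. open T \<and> x \<in> T \<and> smooth_on T f) \<Longrightarrow> smooth_on S f"
  unfolding smooth_on_def by (meson Ck_on_local)

lemma smooth_on_const: "smooth_on S (\<lambda>_. c)"
  by (simp add: smooth_on_def Ck_on_const)

lemma smooth_on_linear: "bounded_linear f \<Longrightarrow> smooth_on S f"
  by (simp add: smooth_on_def Ck_on_linear)

lemma smooth_on_add:
  "open S \<Longrightarrow> smooth_on S f \<Longrightarrow> smooth_on S h \<Longrightarrow> smooth_on S (\<lambda>x. f x + h x)"
  by (simp add: smooth_on_def Ck_on_add)

lemma smooth_on_mult:
  fixes f h :: "'a::real_normed_vector \<Rightarrow> real"
  shows "open S \<Longrightarrow> smooth_on S f \<Longrightarrow> smooth_on S h \<Longrightarrow> smooth_on S (\<lambda>x. f x * h x)"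
  by (simp add: smooth_on_def Ck_on_mult)

lemma smooth_on_inverse:
  fixes f :: "'a::real_normed_vector \<Rightarrow> real"
  shows "open S \<Longrightarrow> smooth_on S f \<Longrightarrow> (\<And>x. x \<in> S \<Longrightarrow> f x \<noteq> 0) \<Longrightarrow> smooth_on S (\<lambda>x. inverse (f x))"
  by (simp add: smooth_on_def Ck_on_inverse)

lemma smooth_on_compose:
  fixes f :: "'a::real_normed_vector \<Rightarrow> 'b::euclidean_space" and h :: "'b \<Rightarrow> real"
  shows "open S \<Longrightarrow> f ` S \<subseteq> T \<Longrightarrow> smooth_on S f \<Longrightarrow> smooth_on T h \<Longrightarrow> smooth_on S (\<lambda>x. h (f x))"
  unfolding smooth_on_def using Ck_on_compose by blast

lemma smooth_on_imp_differentiable: "smooth_on S f \<Longrightarrow> x \<in> S \<Longrightarrow> f differentiable at x"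
  using smooth_on_imp_Ck[of S f 1] by simp

lemma smooth_on_imp_continuous_on: "smooth_on S f \<Longrightarrow> continuous_on S f"
  using smooth_on_imp_Ck[of S f 0] by simp

lemma smooth_on_derivative: "smooth_on S f \<Longrightarrow> smooth_on S (\<lambda>x. frechet_derivative f (at x) v)"
  unfolding smooth_on_def by (metis Ck_on.simps(2))

section \<open>A bump function\<close>

text \<open>
  This family is closed under differentiation, which turns the smoothness of \<open>exp (- 1 / t)\<close>, extended
  by zero, into an induction on the order of differentiability.
\<close>
definition flat :: "real poly \<Rightarrow> real \<Rightarrow> real" where
  "flat p t = (if t \<le> 0 then 0 else poly p (1 / t) * exp (- (1 / t)))"

lemma poly_times_exp_minus_tendsto_0: "((\<lambda>x::real. poly p x * exp (- x)) \<longlongrightarrow> 0) at_top"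
proof -
  \<comment> \<open>Monomials suffice; each of them is beaten by the exponential.\<close>
  have "((\<lambda>x::real. \<Sum>i\<le>degree p. coeff p i * (x ^ i / exp x)) \<longlongrightarrow> (\<Sum>i\<le>degree p. coeff p i * 0)) at_top"
    by (intro tendsto_intros tendsto_power_div_exp_0)
  moreover have "(\<Sum>i\<le>degree p. coeff p i * (x ^ i / exp x)) = poly p x * exp (- x)" for x
    by (simp add: poly_altdef sum_distrib_right exp_minus divide_inverse mult.assoc)
  ultimately show ?thesis by simp
qed

lemma flat_tendsto_0: "((\<lambda>t. poly p (1 / t) * exp (- (1 / t))) \<longlongrightarrow> 0) (at_right (0::real))"
  by (rule filterlim_compose[OF poly_times_exp_minus_tendsto_0])
     (simp add: filterlim_inverse_at_top_right flip: inverse_eq_divide)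

lemma flat_has_derivative:
  "(flat p has_real_derivative flat ([:0, 0, 1:] * (p - pderiv p)) t) (at t)"
proof -
  consider "t < 0" | "t > 0" | "t = 0" by linarith
  then show ?thesis
  proof cases
    case 1
    have "((\<lambda>_. 0) has_real_derivative 0) (at t)" by simp
    then have "(flat p has_real_derivative 0) (at t)"
      by (rule has_field_derivative_transform_within_open[of _ _ _ "{..<0}"]) (use 1 in \<open>auto simp: flat_def\<close>)
    then show ?thesis using 1 by (simp add: flat_def)
  next
    case 2
    have "((\<lambda>t. poly p (1 / t) * exp (- (1 / t))) has_real_derivative
        flat ([:0, 0, 1:] * (p - pderiv p)) t) (at t)"
    proof -
      have i: "((\<lambda>t. 1 / t) has_real_derivative - (1 / t)\<^sup>2) (at t)"
        using 2 by (auto intro!: derivative_eq_intros simp: power2_eq_square)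
      have "((\<lambda>t. poly p (1 / t) * exp (- (1 / t))) has_real_derivative
          poly (pderiv p) (1 / t) * - (1 / t)\<^sup>2 * exp (- (1 / t)) +
          exp (- (1 / t)) * - (- (1 / t)\<^sup>2) * poly p (1 / t)) (at t)"
        by (rule DERIV_mult[OF DERIV_chain2[OF poly_DERIV i] DERIV_chain2[OF DERIV_exp DERIV_minus[OF i]]])
      then show ?thesis
        using 2 by (simp add: flat_def power2_eq_square algebra_simps)
    qed
    then show ?thesis
      by (rule has_field_derivative_transform_within_open[of _ _ _ "{0<..}"]) (use 2 in \<open>auto simp: flat_def\<close>)
  next
    case 3
    have R: "((\<lambda>h. flat p h / h) \<longlongrightarrow> 0) (at_right 0)"
    proof (rule Lim_transform_eventually[OF flat_tendsto_0[of "[:0, 1:] * p"]])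
      show "\<forall>\<^sub>F h in at_right 0. poly ([:0, 1:] * p) (1 / h) * exp (- (1 / h)) = flat p h / h"
        by (rule eventually_at_rightI[of 0 1]) (auto simp: flat_def)
    qed
    have L: "((\<lambda>h. flat p h / h) \<longlongrightarrow> 0) (at_left 0)"
    proof (rule Lim_transform_eventually[OF tendsto_const])
      show "\<forall>\<^sub>F h in at_left 0. 0 = flat p h / h"
        by (rule eventually_at_leftI[of "-1" 0]) (auto simp: flat_def)
    qed
    have "((\<lambda>h. flat p h / h) \<longlongrightarrow> 0) (at 0)"
      using L R by (simp add: filterlim_at_split)
    then show ?thesis using 3 by (simp add: DERIV_def flat_def)
  qed
qed

lemma smooth_flat: "smooth_on UNIV (flat p)"
proof -
  have "Ck_on k UNIV (flat p)" for k
  proof (induction k arbitrary: p)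
    case 0
    then show ?case using flat_has_derivative
      by (metis Ck_on.simps(1) DERIV_continuous_on has_field_derivative_at_within)
  next
    case (Suc k)
    have H: "(flat p has_derivative (\<lambda>v. flat ([:0, 0, 1:] * (p - pderiv p)) t * v)) (at t)" for t
      using flat_has_derivative[of p t] by (simp add: has_field_derivative_def)
    have "frechet_derivative (flat p) (at t) v = flat ([:0, 0, 1:] * (p - pderiv p)) t * v" for t v
      using frechet_derivative_at[OF H] by metis
    then show ?case
      using H Suc by (auto simp: differentiable_def intro!: Ck_on_mult Ck_on_const)
  qed
  then show ?thesis by (simp add: smooth_on_def)
qed

definition bump :: "'e::euclidean_space \<Rightarrow> real \<Rightarrow> 'e \<Rightarrow> real" where
  "bump a r u = flat 1 (r\<^sup>2 + (- 1) * ((u - a) \<bullet> (u - a)))"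

lemma bump_center: "r > 0 \<Longrightarrow> bump a r a \<noteq> 0"
  by (simp add: bump_def flat_def)

lemma bump_outside: "r > 0 \<Longrightarrow> u \<notin> ball a r \<Longrightarrow> bump a r u = 0"
proof -
  assume "r > 0" "u \<notin> ball a r"
  then have "r\<^sup>2 \<le> (norm (u - a))\<^sup>2" by (intro power_mono) (auto simp: dist_norm norm_minus_commute)
  then show ?thesis by (simp add: bump_def flat_def power2_norm_eq_inner)
qed

lemma smooth_bump: "smooth_on S (bump a r)"
proof -
  have c: "smooth_on UNIV (\<lambda>u. (u - a) \<bullet> b)" for b
    using smooth_on_add[OF open_UNIV smooth_on_linear[OF bounded_linear_inner_left[of b]] smooth_on_const[of _ "- (a \<bullet> b)"]]
    by (simp add: inner_diff_left)
  have "smooth_on UNIV (\<lambda>u. r\<^sup>2 + (- 1) * (\<Sum>b\<in>Basis. ((u - a) \<bullet> b) * ((u - a) \<bullet> b)))"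
    unfolding smooth_on_def
    using c by (intro allI Ck_on_add Ck_on_mult Ck_on_sum Ck_on_const smooth_on_imp_Ck) auto
  then have "smooth_on UNIV (\<lambda>u. r\<^sup>2 + (- 1) * ((u - a) \<bullet> (u - a)))"
    by (subst euclidean_inner) simp
  from smooth_on_compose[OF open_UNIV subset_UNIV this smooth_flat[of 1]]
  have "smooth_on UNIV (bump a r)" by (simp add: bump_def[abs_def])
  then show ?thesis using smooth_on_subset by blast
qed

section \<open>First order Taylor expansion with smooth remainder\<close>

text \<open>
  Differentiation under the integral produces another factor \<open>s\<close>.  With the weight \<open>s ^ k\<close> the
  derivative is an integral of the same form, and smoothness follows by induction.
\<close>
lemma has_derivative_scaled_integral:
  fixes F :: "'e::euclidean_space \<Rightarrow> real"
  assumes S: "smooth_on (ball 0 R) F" and u: "u \<in> ball 0 R"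
  shows "((\<lambda>u. integral {0..1} (\<lambda>s. s ^ k * F (s *\<^sub>R u))) has_derivative
     (\<lambda>v. integral {0..1} (\<lambda>s. s ^ Suc k * frechet_derivative F (at (s *\<^sub>R u)) v))) (at u)"
proof -
  define G where "G u s = Blinfun (\<lambda>v. s ^ Suc k * frechet_derivative F (at (s *\<^sub>R u)) v)" for u and s :: real
  have in_ball: "s *\<^sub>R u \<in> ball 0 R" if "u \<in> ball 0 R" "s \<in> cbox 0 1" for u :: 'e and s :: real
  proof -
    have "\<bar>s\<bar> * norm u \<le> 1 * norm u" using that by (intro mult_right_mono) auto
    then show ?thesis using that by simp
  qed
  have D: "(F has_derivative frechet_derivative F (at x)) (at x)" if "x \<in> ball 0 R" for x
    using smooth_on_imp_differentiable[OF S that] by (simp add: frechet_derivative_works)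
  have G_apply: "blinfun_apply (G u s) = (\<lambda>v. s ^ Suc k * frechet_derivative F (at (s *\<^sub>R u)) v)"
    if "u \<in> ball 0 R" "s \<in> cbox 0 1" for u s
    unfolding G_def
    by (intro bounded_linear_Blinfun_apply bounded_linear_mult_const bounded_linear_const_mult
        has_derivative_bounded_linear[OF D] in_ball that)
  have cont_scale: "continuous_on (ball 0 R \<times> cbox 0 1) (\<lambda>(u::'e, s::real). s *\<^sub>R u)"
    by (auto simp: case_prod_beta intro!: continuous_intros)
  have scale_img: "(\<lambda>(u::'e, s::real). s *\<^sub>R u) ` (ball 0 R \<times> cbox 0 1) \<subseteq> ball 0 R"
    using in_ball by auto
  have cont_G: "continuous_on (ball 0 R \<times> cbox 0 1) (\<lambda>(u, s). G u s)"
  proof (rule continuous_on_blinfun_componentwise)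
    fix i :: 'e assume "i \<in> Basis"
    have "continuous_on (ball 0 R \<times> cbox 0 1) (\<lambda>us. frechet_derivative F (at ((\<lambda>(u, s). s *\<^sub>R u) us)) i)"
      by (rule continuous_on_compose2[OF smooth_on_imp_continuous_on[OF smooth_on_derivative[OF S]]
            cont_scale scale_img])
    then have "continuous_on (ball 0 R \<times> cbox 0 1)
        (\<lambda>us. snd us ^ Suc k * frechet_derivative F (at ((\<lambda>(u, s). s *\<^sub>R u) us)) i)"
      by (intro continuous_intros)
    then show "continuous_on (ball 0 R \<times> cbox 0 1) (\<lambda>us. blinfun_apply (case us of (u, s) \<Rightarrow> G u s) i)"
      by (rule continuous_on_eq) (auto simp: G_apply)
  qed
  have cont_Gu: "continuous_on (cbox 0 1) (G u)"
  proof -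
    have "continuous_on (cbox 0 1) (\<lambda>s::real. case (u, s) of (u, s) \<Rightarrow> G u s)"
      by (rule continuous_on_compose2[OF cont_G]) (use u in \<open>auto intro!: continuous_intros\<close>)
    then show ?thesis by simp
  qed
  have "((\<lambda>u. integral (cbox 0 1) (\<lambda>s. s ^ k * F (s *\<^sub>R u))) has_derivative integral (cbox 0 1) (G u))
      (at u within ball 0 R)"
  proof (rule leibniz_rule[OF _ _ cont_G u convex_ball])
    fix x :: 'e and t :: real assume x: "x \<in> ball 0 R" and t: "t \<in> cbox 0 1"
    have "((\<lambda>x. F (t *\<^sub>R x)) has_derivative (\<lambda>v. frechet_derivative F (at (t *\<^sub>R x)) (t *\<^sub>R v))) (at x within ball 0 R)"
      by (rule has_derivative_compose[where f = "\<lambda>x. t *\<^sub>R x" and f' = "\<lambda>v. t *\<^sub>R v" and g = F, OF _ D[OF in_ball[OF x t]]])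
         (auto intro!: derivative_eq_intros)
    then have "((\<lambda>x. t ^ k * F (t *\<^sub>R x)) has_derivative
        (\<lambda>v. t ^ k * frechet_derivative F (at (t *\<^sub>R x)) (t *\<^sub>R v))) (at x within ball 0 R)"
      by (rule has_derivative_mult_right)
    moreover have "frechet_derivative F (at (t *\<^sub>R x)) (t *\<^sub>R v) = t * frechet_derivative F (at (t *\<^sub>R x)) v" for v
      using linear_cmul[OF has_derivative_linear[OF D[OF in_ball[OF x t]]]] by simp
    ultimately show "((\<lambda>x. t ^ k * F (t *\<^sub>R x)) has_derivative blinfun_apply (G x t)) (at x within ball 0 R)"
      using x t by (simp add: G_apply mult_ac)
  next
    fix x :: 'e assume x: "x \<in> ball 0 R"
    have "continuous_on (cbox 0 1) (\<lambda>s. F (s *\<^sub>R x))"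
      by (rule continuous_on_compose2[OF smooth_on_imp_continuous_on[OF S]])
         (use in_ball x in \<open>auto intro!: continuous_intros\<close>)
    then show "(\<lambda>s. s ^ k * F (s *\<^sub>R x)) integrable_on cbox 0 1"
      by (intro integrable_continuous continuous_intros)
  qed
  moreover have "blinfun_apply (integral (cbox 0 1) (G u)) =
      (\<lambda>v. integral {0..1} (\<lambda>s. s ^ Suc k * frechet_derivative F (at (s *\<^sub>R u)) v))"
  proof
    fix v
    have "blinfun_apply (integral (cbox 0 1) (G u)) v = integral (cbox 0 1) (\<lambda>s. blinfun_apply (G u s) v)"
      by (rule blinfun_apply_integral) (rule integrable_continuous[OF cont_Gu])
    also have "\<dots> = integral {0..1} (\<lambda>s. s ^ Suc k * frechet_derivative F (at (s *\<^sub>R u)) v)"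
      using u by (auto intro!: integral_cong simp: G_apply)
    finally show "blinfun_apply (integral (cbox 0 1) (G u)) v = \<dots>" .
  qed
  ultimately show ?thesis
    using u at_within_open[OF u open_ball] by simp
qed

lemma smooth_scaled_integral:
  fixes F :: "'e::euclidean_space \<Rightarrow> real"
  assumes "smooth_on (ball 0 R) F"
  shows "smooth_on (ball 0 R) (\<lambda>u. integral {0..1} (\<lambda>s. s ^ k * F (s *\<^sub>R u)))"
proof -
  have "Ck_on m (ball 0 R) (\<lambda>u. integral {0..1} (\<lambda>s. s ^ k * F (s *\<^sub>R u)))" for m
    using assms
  proof (induction m arbitrary: F k)
    case 0
    have "(\<lambda>u. integral {0..1} (\<lambda>s. s ^ k * F (s *\<^sub>R u))) differentiable (at u)" if "u \<in> ball 0 R" for u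
      using has_derivative_scaled_integral[OF 0 that] by (auto simp: differentiable_def)
    then have "continuous (at u) (\<lambda>u. integral {0..1} (\<lambda>s. s ^ k * F (s *\<^sub>R u)))" if "u \<in> ball 0 R" for u
      using that differentiable_imp_continuous_within by blast
    then have "continuous_on (ball 0 R) (\<lambda>u. integral {0..1} (\<lambda>s. s ^ k * F (s *\<^sub>R u)))"
      by (rule continuous_at_imp_continuous_on[OF ballI])
    then show ?case by (simp only: Ck_on.simps)
  next
    case (Suc m)
    note H = has_derivative_scaled_integral[OF Suc.prems]
    have "Ck_on m (ball 0 R) (\<lambda>x. frechet_derivative (\<lambda>u. integral {0..1} (\<lambda>s. s ^ k * F (s *\<^sub>R u))) (at x) v)" for v
      by (rule Ck_on_cong[OF open_ball _ Suc.IH[OF smooth_on_derivative[OF Suc.prems, of v], of "Suc k"]])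
        (rule fun_cong[OF frechet_derivative_at[OF H]])
    moreover have "(\<lambda>u. integral {0..1} (\<lambda>s. s ^ k * F (s *\<^sub>R u))) differentiable (at u)"
      if "u \<in> ball 0 R" for u
      using H[OF that] unfolding differentiable_def by blast
    ultimately show ?case unfolding Ck_on.simps by blast
  qed
  then show ?thesis by (simp add: smooth_on_def)
qed


text \<open>
  The coefficients are averages of partial derivatives along the segment from the centre; the
  formula is the fundamental theorem of calculus, and the integral form makes them smooth.
\<close>
lemma Hadamard_lemma:
  fixes F :: "'e::euclidean_space \<Rightarrow> real"
  assumes S: "smooth_on (ball a R) F" and "R > 0"
  obtains G where "\<And>b. smooth_on (ball a R) (G b)"
    and "\<And>u. u \<in> ball a R \<Longrightarrow> F u = F a + (\<Sum>b\<in>Basis. ((u - a) \<bullet> b) * G b u)"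
    and "\<And>b. G b a = frechet_derivative F (at a) b"
proof -
  have tr: "smooth_on T (\<lambda>u. u + c)" if "open T" for T and c :: 'e
    by (rule smooth_on_add[OF that smooth_on_linear[OF bounded_linear_ident] smooth_on_const])
  define F0 where "F0 u = F (u + a)" for u
  have S0: "smooth_on (ball 0 R) F0"
    unfolding F0_def
    by (rule smooth_on_compose[OF open_ball _ tr S]) (auto simp: dist_norm norm_minus_commute)
  define G0 where "G0 b u = integral {0..1} (\<lambda>s. s ^ 0 * frechet_derivative F0 (at (s *\<^sub>R u)) b)" for b u
  have SG0: "smooth_on (ball 0 R) (G0 b)" for b
    unfolding G0_def[abs_def] by (rule smooth_scaled_integral[OF smooth_on_derivative[OF S0]])
  have D0: "(F0 has_derivative frechet_derivative F0 (at u)) (at u)" if "u \<in> ball 0 R" for u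
    using smooth_on_imp_differentiable[OF S0 that] by (simp add: frechet_derivative_works)
  have exp0: "F0 u = F0 0 + (\<Sum>b\<in>Basis. (u \<bullet> b) * G0 b u)" if u: "u \<in> ball 0 R" for u
  proof -
    have in_ball: "s *\<^sub>R u \<in> ball 0 R" if "s \<in> {0..1}" for s :: real
    proof -
      have "\<bar>s\<bar> * norm u \<le> 1 * norm u" using that by (intro mult_right_mono) auto
      then show ?thesis using u by simp
    qed
    have cont: "continuous_on {0..1} (\<lambda>s. frechet_derivative F0 (at (s *\<^sub>R u)) b)" for b
      by (rule continuous_on_compose2[OF smooth_on_imp_continuous_on[OF smooth_on_derivative[OF S0]]])
         (use in_ball in \<open>auto intro!: continuous_intros\<close>)
    have "((\<lambda>s. F0 (s *\<^sub>R u)) has_vector_derivative frechet_derivative F0 (at (s *\<^sub>R u)) u) (at s within {0..1})"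
      if "s \<in> {0..1}" for s
    proof -
      have "((\<lambda>s. F0 (s *\<^sub>R u)) has_derivative (\<lambda>h. frechet_derivative F0 (at (s *\<^sub>R u)) (h *\<^sub>R u))) (at s within {0..1})"
        by (rule has_derivative_compose[where f = "\<lambda>s. s *\<^sub>R u" and f' = "\<lambda>h. h *\<^sub>R u" and g = F0, OF _ D0[OF in_ball[OF that]]])
           (auto intro!: derivative_eq_intros)
      then show ?thesis
        using linear_cmul[OF has_derivative_linear[OF D0[OF in_ball[OF that]]]]
        by (simp add: has_vector_derivative_def)
    qed
    then have "((\<lambda>s. frechet_derivative F0 (at (s *\<^sub>R u)) u) has_integral F0 (1 *\<^sub>R u) - F0 (0 *\<^sub>R u)) {0..1}"
      by (intro fundamental_theorem_of_calculus) auto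
    then have "F0 u - F0 0 = integral {0..1} (\<lambda>s. frechet_derivative F0 (at (s *\<^sub>R u)) u)"
      by (simp add: integral_unique)
    also have "\<dots> = integral {0..1} (\<lambda>s. \<Sum>b\<in>Basis. (u \<bullet> b) * frechet_derivative F0 (at (s *\<^sub>R u)) b)"
    proof (rule integral_cong)
      fix s :: real assume s: "s \<in> {0..1}"
      have l: "linear (frechet_derivative F0 (at (s *\<^sub>R u)))"
        using D0[OF in_ball[OF s]] has_derivative_linear by blast
      have "frechet_derivative F0 (at (s *\<^sub>R u)) u = frechet_derivative F0 (at (s *\<^sub>R u)) (\<Sum>b\<in>Basis. (u \<bullet> b) *\<^sub>R b)"
        by (simp add: euclidean_representation)
      then show "frechet_derivative F0 (at (s *\<^sub>R u)) u = (\<Sum>b\<in>Basis. (u \<bullet> b) * frechet_derivative F0 (at (s *\<^sub>R u)) b)"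
        by (simp add: linear_sum[OF l] linear_cmul[OF l])
    qed
    also have "\<dots> = (\<Sum>b\<in>Basis. integral {0..1} (\<lambda>s. (u \<bullet> b) * frechet_derivative F0 (at (s *\<^sub>R u)) b))"
      by (intro integral_sum integrable_continuous_real continuous_intros cont) auto
    also have "\<dots> = (\<Sum>b\<in>Basis. (u \<bullet> b) * G0 b u)"
      by (simp add: G0_def)
    finally show ?thesis by simp
  qed
  show ?thesis
  proof (rule that[of "\<lambda>b u. G0 b (u - a)"])
    show "smooth_on (ball a R) (\<lambda>u. G0 b (u - a))" for b
    proof -
      have "smooth_on (ball a R) (\<lambda>u. G0 b (u + - a))"
        by (rule smooth_on_compose[OF open_ball _ tr[OF open_ball] SG0])
           (auto simp: dist_norm norm_minus_commute)
      then show ?thesis by simp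
    qed
    show "F u = F a + (\<Sum>b\<in>Basis. ((u - a) \<bullet> b) * G0 b (u - a))" if "u \<in> ball a R" for u
      using exp0[of "u - a"] that by (simp add: F0_def dist_norm norm_minus_commute)
    show "G0 b (a - a) = frechet_derivative F (at a) b" for b
    proof -
      have "a \<in> ball a R" using \<open>R > 0\<close> by simp
      then have "(F has_derivative frechet_derivative F (at a)) (at (0 + a))"
        using smooth_on_imp_differentiable[OF S] by (simp add: frechet_derivative_works[symmetric])
      then have "(F0 has_derivative frechet_derivative F (at a)) (at 0)"
        unfolding F0_def
        by (rule has_derivative_compose[where g = F and f = "\<lambda>u. u + a" and f' = "\<lambda>v. v", rotated])
           (auto intro!: derivative_eq_intros)
      then have "frechet_derivative F0 (at 0) = frechet_derivative F (at a)"
        using frechet_derivative_at by metis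
      then show ?thesis by (simp add: G0_def)
    qed
  qed
qed

section \<open>Tangent spaces of a manifold\<close>

lemma smooth_manifold_chart:
  assumes "smooth_manifold A" "(U, c) \<in> A"
  shows "open U" "open (c ` U)" "homeomorphism U (c ` U) c (inv_into U c)" "inj_on c U"
proof -
  show "open U" "open (c ` U)" and h: "homeomorphism U (c ` U) c (inv_into U c)"
    using assms unfolding smooth_manifold_def by blast+
  show "inj_on c U" using homeomorphism_apply1[OF h] by (metis inj_onI)
qed

lemma smooth_manifold_cover:
  assumes "smooth_manifold A" obtains U c where "(U, c) \<in> A" "x \<in> U"
  using assms unfolding smooth_manifold_def by blast

lemma smooth_manifold_transition:
  "smooth_manifold A \<Longrightarrow> (U, c) \<in> A \<Longrightarrow> (W, d) \<in> A \<Longrightarrow> smooth_on (c ` (U \<inter> W)) (d \<circ> inv_into U c)"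
  unfolding smooth_manifold_def by blast

lemma open_chart_image:
  assumes "smooth_manifold A" "(U, c) \<in> A" "open T"
  shows "open (c ` (U \<inter> T))"
proof -
  have "openin (top_of_set (c ` U)) (c ` (U \<inter> T))"
    by (rule homeomorphism_imp_open_map[OF smooth_manifold_chart(3)[OF assms(1,2)]])
       (simp add: openin_open_Int assms(3))
  then show ?thesis using openin_open_eq[OF smooth_manifold_chart(2)[OF assms(1,2)]] by blast
qed

lemma smooth_fun_chart: "smooth_fun A f \<Longrightarrow> (U, c) \<in> A \<Longrightarrow> smooth_on (c ` U) (f \<circ> inv_into U c)"
  unfolding smooth_fun_def by blast

lemma smooth_funI_local:
  assumes "\<And>W d y. (W, d) \<in> A \<Longrightarrow> y \<in> W \<Longrightarrow>
      \<exists>T. open T \<and> d y \<in> T \<and> smooth_on T (f \<circ> inv_into W d)"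
  shows "smooth_fun A f"
  unfolding smooth_fun_def
proof clarify
  fix W d assume "(W, d) \<in> A"
  then show "smooth_on (d ` W) (f \<circ> inv_into W d)"
    using assms by (intro smooth_on_local) blast
qed

lemma smooth_fun_const: "smooth_fun A (\<lambda>_. a)"
  unfolding smooth_fun_def by (auto simp: comp_def smooth_on_const)

lemma smooth_fun_add:
  "smooth_manifold A \<Longrightarrow> smooth_fun A f \<Longrightarrow> smooth_fun A h \<Longrightarrow> smooth_fun A (\<lambda>x. f x + h x)"
  unfolding smooth_fun_def comp_def
proof clarify
  fix U c assume A: "smooth_manifold A" "(U, c) \<in> A"
    and "\<forall>(U, c)\<in>A. smooth_on (c ` U) (\<lambda>x. f (inv_into U c x))"
      "\<forall>(U, c)\<in>A. smooth_on (c ` U) (\<lambda>x. h (inv_into U c x))"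
  then have "smooth_on (c ` U) (\<lambda>x. f (inv_into U c x))" "smooth_on (c ` U) (\<lambda>x. h (inv_into U c x))"
    by auto
  then show "smooth_on (c ` U) (\<lambda>x. f (inv_into U c x) + h (inv_into U c x))"
    by (rule smooth_on_add[OF smooth_manifold_chart(2)[OF A]])
qed

lemma smooth_fun_mult:
  "smooth_manifold A \<Longrightarrow> smooth_fun A f \<Longrightarrow> smooth_fun A h \<Longrightarrow> smooth_fun A (\<lambda>x. f x * h x)"
  unfolding smooth_fun_def comp_def
proof clarify
  fix U c assume A: "smooth_manifold A" "(U, c) \<in> A"
    and "\<forall>(U, c)\<in>A. smooth_on (c ` U) (\<lambda>x. f (inv_into U c x))"
      "\<forall>(U, c)\<in>A. smooth_on (c ` U) (\<lambda>x. h (inv_into U c x))"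
  then have "smooth_on (c ` U) (\<lambda>x. f (inv_into U c x))" "smooth_on (c ` U) (\<lambda>x. h (inv_into U c x))"
    by auto
  then show "smooth_on (c ` U) (\<lambda>x. f (inv_into U c x) * h (inv_into U c x))"
    by (rule smooth_on_mult[OF smooth_manifold_chart(2)[OF A]])
qed

lemma smooth_fun_sum:
  "finite I \<Longrightarrow> smooth_manifold A \<Longrightarrow> (\<And>i. i \<in> I \<Longrightarrow> smooth_fun A (f i)) \<Longrightarrow> smooth_fun A (\<lambda>x. \<Sum>i\<in>I. f i x)"
  by (induction I rule: finite_induct) (simp_all add: smooth_fun_const smooth_fun_add)

text \<open>
  Functions that are defined by a choice at every point, such as the curvature of the contact planes,
  are recognised as smooth by this criterion.
\<close>
lemma smooth_fun_quotient:
  assumes A: "smooth_manifold A"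
    and Q: "\<And>x. \<exists>N P. smooth_fun A N \<and> smooth_fun A P \<and> N x \<noteq> 0 \<and> (\<forall>y. q y * N y = P y)"
  shows "smooth_fun A q"
proof (rule smooth_funI_local)
  fix W d y assume W: "(W, d) \<in> A" "y \<in> W"
  obtain N P where N: "smooth_fun A N" and P: "smooth_fun A P" and Ny: "N y \<noteq> 0"
    and q: "\<And>z. q z * N z = P z" using Q by blast
  let ?N = "N \<circ> inv_into W d" and ?P = "P \<circ> inv_into W d"
  let ?T = "(?N -` (- {0})) \<inter> d ` W"
  have o: "open ?T"
    using continuous_open_preimage[OF smooth_on_imp_continuous_on[OF smooth_fun_chart[OF N W(1)]]
        smooth_manifold_chart(2)[OF A W(1)], of "- {0}"]
    by (simp add: Int_commute open_Compl)
  have i: "inv_into W d (d y) = y" using smooth_manifold_chart(4)[OF A W(1)] W(2) by simp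
  have "smooth_on ?T (\<lambda>u. ?P u * inverse (?N u))"
    by (intro smooth_on_mult[OF o] smooth_on_inverse[OF o]
        smooth_on_subset[OF smooth_fun_chart[OF N W(1)]] smooth_on_subset[OF smooth_fun_chart[OF P W(1)]]) auto
  then have "smooth_on ?T (q \<circ> inv_into W d)"
  proof (rule smooth_on_cong[OF _ o])
    fix u assume "u \<in> ?T"
    then show "?P u * inverse (?N u) = (q \<circ> inv_into W d) u"
      using q[of "inv_into W d u"] by (simp add: field_simps)
  qed
  moreover have "d y \<in> ?T" using W(2) i Ny by simp
  ultimately show "\<exists>T. open T \<and> d y \<in> T \<and> smooth_on T (q \<circ> inv_into W d)" using o by blast
qed

definition bump_extend :: "'m set \<Rightarrow> ('m \<Rightarrow> 'e::euclidean_space) \<Rightarrow> 'e \<Rightarrow> real \<Rightarrow> real \<Rightarrow> ('e \<Rightarrow> real) \<Rightarrow> 'm \<Rightarrow> real" where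
  "bump_extend U c a r R h y = (if y \<in> U \<and> c y \<in> ball a R then bump a r (c y) * h (c y) else 0)"

text \<open>
  Outside of the coordinate ball the extension vanishes on a neighbourhood of every point: the preimage
  of the smaller closed ball is compact, hence closed in the Hausdorff space.
\<close>
lemma smooth_fun_bump_extend:
  fixes A :: "('m::{t2_space,second_countable_topology}, 'e::euclidean_space) chart set"
  assumes A: "smooth_manifold A" and U: "(U, c) \<in> A" and r: "0 < r" "r < R" and R: "ball a R \<subseteq> c ` U"
    and h: "smooth_on (ball a R) h"
  shows "smooth_fun A (bump_extend U c a r R h)"
proof (rule smooth_funI_local)
  fix W d y assume W: "(W, d) \<in> A" "y \<in> W"
  note chU = smooth_manifold_chart[OF A U] and chW = smooth_manifold_chart[OF A W(1)]
  let ?f = "bump_extend U c a r R h"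
  have inv: "inv_into W d u \<in> W" "d (inv_into W d u) = u" if "u \<in> d ` W" for u
    using that by (auto intro: inv_into_into f_inv_into_f)
  show "\<exists>T. open T \<and> d y \<in> T \<and> smooth_on T (?f \<circ> inv_into W d)"
  proof (cases "y \<in> U \<and> c y \<in> ball a R")
    case True
    define Q where "Q = U \<inter> c -` ball a R"
    have oQ: "open Q" unfolding Q_def
      using continuous_open_preimage[OF homeomorphism_cont1[OF chU(3)] chU(1) open_ball] by simp
    have oT: "open (d ` (W \<inter> Q))" by (rule open_chart_image[OF A W(1) oQ])
    have mem: "inv_into W d u \<in> Q" if "u \<in> d ` (W \<inter> Q)" for u
      using that chW(4) by auto
    have "smooth_on (d ` (W \<inter> Q)) (\<lambda>u. bump a r ((c \<circ> inv_into W d) u) * h ((c \<circ> inv_into W d) u))"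
    proof (rule smooth_on_compose[OF oT, where T = "ball a R" and h = "\<lambda>v. bump a r v * h v"])
      show "(c \<circ> inv_into W d) ` (d ` (W \<inter> Q)) \<subseteq> ball a R" using mem by (auto simp: Q_def)
      show "smooth_on (d ` (W \<inter> Q)) (c \<circ> inv_into W d)"
        by (rule smooth_on_subset[OF smooth_manifold_transition[OF A W(1) U]]) (auto simp: Q_def)
      show "smooth_on (ball a R) (\<lambda>v. bump a r v * h v)"
        by (intro smooth_on_mult open_ball smooth_bump h)
    qed
    then have "smooth_on (d ` (W \<inter> Q)) (?f \<circ> inv_into W d)"
      by (rule smooth_on_cong[OF _ oT]) (use mem in \<open>auto simp: bump_extend_def Q_def\<close>)
    moreover have "d y \<in> d ` (W \<inter> Q)" using True W(2) by (auto simp: Q_def)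
    ultimately show ?thesis using oT by blast
  next
    case False
    define C where "C = inv_into U c ` cball a r"
    have sub: "cball a r \<subseteq> c ` U" using R r by force
    have "compact C" unfolding C_def
      by (rule compact_continuous_image[OF continuous_on_subset[OF homeomorphism_cont2[OF chU(3)] sub] compact_cball])
    then have oC: "open (- C)" using compact_imp_closed open_Compl by blast
    have zero: "?f z = 0" if "z \<notin> C" for z
    proof (cases "z \<in> U \<and> c z \<in> ball a R")
      case True
      then have "c z \<notin> cball a r" using that chU(4) unfolding C_def by (metis imageI inv_into_f_f)
      then have "c z \<notin> ball a r" by auto
      from bump_outside[OF r(1) this] show ?thesis by (simp add: bump_extend_def)
    qed (auto simp: bump_extend_def)
    have yC: "y \<notin> C"
    proof
      assume "y \<in> C"
      then obtain u where u: "u \<in> cball a r" "y = inv_into U c u" unfolding C_def by blast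
      then have "u \<in> c ` U" using sub by blast
      then have "y \<in> U" "c y = u" using u by (auto intro: inv_into_into f_inv_into_f)
      then show False using False u r by auto
    qed
    have oT: "open (d ` (W \<inter> - C))" by (rule open_chart_image[OF A W(1) oC])
    have "smooth_on (d ` (W \<inter> - C)) (?f \<circ> inv_into W d)"
      by (rule smooth_on_cong[OF smooth_on_const[of _ 0] oT]) (use zero chW(4) in auto)
    moreover have "d y \<in> d ` (W \<inter> - C)" using yC W(2) by auto
    ultimately show ?thesis using oT by blast
  qed
qed

lemma tangent_add:
  "v \<in> tangent_space A x \<Longrightarrow> smooth_fun A f \<Longrightarrow> smooth_fun A h \<Longrightarrow> v (\<lambda>y. f y + h y) = v f + v h"
  unfolding tangent_space_def plus_fun_def by blast

lemma tangent_mult: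
  "v \<in> tangent_space A x \<Longrightarrow> smooth_fun A f \<Longrightarrow> smooth_fun A h \<Longrightarrow>
    v (\<lambda>y. f y * h y) = f x * v h + h x * v f"
  unfolding tangent_space_def times_fun_def by blast

lemma tangent_nonsmooth: "v \<in> tangent_space A x \<Longrightarrow> \<not> smooth_fun A f \<Longrightarrow> v f = 0"
  unfolding tangent_space_def by simp

lemma tangent_const: "v \<in> tangent_space A x \<Longrightarrow> v (\<lambda>_. a) = 0"
proof -
  assume v: "v \<in> tangent_space A x"
  have "v (\<lambda>_. 1) = 0" using tangent_mult[OF v smooth_fun_const smooth_fun_const, of 1 1] by simp
  moreover have "v (\<lambda>_. a * 1) = a * v (\<lambda>_. 1) + 1 * v (\<lambda>_. a)" for a
    using tangent_mult[OF v smooth_fun_const smooth_fun_const, of a 1] by simp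
  moreover have "v (a *\<^sub>R (\<lambda>_. 1)) = a * v (\<lambda>_. 1)"
    using v smooth_fun_const unfolding tangent_space_def by blast
  ultimately show ?thesis by (simp add: scaleR_fun_def)
qed

lemma tangent_sum:
  assumes "finite I" "smooth_manifold A" "v \<in> tangent_space A x" "\<And>i. i \<in> I \<Longrightarrow> smooth_fun A (f i)"
  shows "v (\<lambda>y. \<Sum>i\<in>I. f i y) = (\<Sum>i\<in>I. v (f i))"
  using assms(1,4)
proof (induction I rule: finite_induct)
  case empty
  then show ?case using tangent_const[OF assms(3)] by simp
next
  case (insert i I)
  then show ?case
    using tangent_add[OF assms(3), of "f i" "\<lambda>y. \<Sum>i\<in>I. f i y"] smooth_fun_sum[OF _ assms(2), of I f] by simp
qed

lemma subspace_tangent_space: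
  fixes x :: "'m::{t2_space,second_countable_topology}"
  assumes A: "smooth_manifold A"
  shows "subspace (tangent_space A x)"
  unfolding subspace_def tangent_space_def
  by (auto simp: algebra_simps zero_fun_def)

definition chart_derivation :: "('m, 'e::euclidean_space) chart set \<Rightarrow> 'm set \<Rightarrow> ('m \<Rightarrow> 'e) \<Rightarrow> 'm \<Rightarrow> 'e \<Rightarrow> 'm tvec" where
  "chart_derivation A U c y e f =
     (if smooth_fun A f then frechet_derivative (f \<circ> inv_into U c) (at (c y)) e else 0)"

lemma chart_derivation_tangent:
  assumes A: "smooth_manifold A" and U: "(U, c) \<in> A" "y \<in> U"
  shows "chart_derivation A U c y e \<in> tangent_space A y"
proof -
  have D: "(f \<circ> inv_into U c has_derivative frechet_derivative (f \<circ> inv_into U c) (at (c y))) (at (c y))"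
    if "smooth_fun A f" for f
    using smooth_on_imp_differentiable[OF smooth_fun_chart[OF that U(1)], of "c y"] U(2)
    by (simp add: frechet_derivative_works)
  have i: "inv_into U c (c y) = y" using smooth_manifold_chart(4)[OF A U(1)] U(2) by simp
  have "frechet_derivative ((\<lambda>x. f x + h x) \<circ> inv_into U c) (at (c y)) =
     (\<lambda>e. frechet_derivative (f \<circ> inv_into U c) (at (c y)) e + frechet_derivative (h \<circ> inv_into U c) (at (c y)) e)"
    if "smooth_fun A f" "smooth_fun A h" for f h
    using frechet_derivative_at[OF has_derivative_add[OF D[OF that(1)] D[OF that(2)]]] by (simp add: comp_def)
  moreover have "frechet_derivative ((\<lambda>x. f x * h x) \<circ> inv_into U c) (at (c y)) =
     (\<lambda>e. f y * frechet_derivative (h \<circ> inv_into U c) (at (c y)) e + frechet_derivative (f \<circ> inv_into U c) (at (c y)) e * h y)"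
    if "smooth_fun A f" "smooth_fun A h" for f h
    using frechet_derivative_at[OF has_derivative_mult[OF D[OF that(1)] D[OF that(2)]]] by (simp add: comp_def i)
  moreover have "frechet_derivative ((\<lambda>x. a * f x) \<circ> inv_into U c) (at (c y)) =
     (\<lambda>e. a * frechet_derivative (f \<circ> inv_into U c) (at (c y)) e)"
    if "smooth_fun A f" for f a
    using frechet_derivative_at[OF has_derivative_mult_right[OF D[OF that], of a]] by (simp add: comp_def)
  moreover have "smooth_fun A (\<lambda>x. a * f x)" if "smooth_fun A f" for f a
    using smooth_fun_mult[OF A smooth_fun_const that] .
  ultimately show ?thesis
    unfolding tangent_space_def chart_derivation_def
    by (auto simp: plus_fun_def times_fun_def scaleR_fun_def smooth_fun_add[OF A] smooth_fun_mult[OF A])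
qed

lemma chart_ball:
  assumes A: "smooth_manifold A" and U: "(U, c) \<in> A" "x \<in> U"
  obtains R where "R > 0" "ball (c x) R \<subseteq> c ` U"
  using smooth_manifold_chart(2)[OF A U(1)] U(2) open_contains_ball by blast

text \<open>
  By Hadamard's lemma \<open>f\<close> minus its value at \<open>x\<close> is a sum of products of functions, one factor of each
  vanishing at \<open>x\<close>.  Multiplication by the square of a bump function makes all factors global, and the
  product rule evaluates \<open>v\<close>.
\<close>
lemma tangent_as_chart_derivation:
  fixes A :: "('m::{t2_space,second_countable_topology}, 'e::euclidean_space) chart set"
  assumes A: "smooth_manifold A" and U: "(U, c) \<in> A" "x \<in> U" and v: "v \<in> tangent_space A x"
  obtains k where "v = (\<Sum>b\<in>Basis. k b *\<^sub>R chart_derivation A U c x b)"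
proof -
  obtain R where R: "R > 0" "ball (c x) R \<subseteq> c ` U" using chart_ball[OF A U] .
  let ?a = "c x" and ?r = "R / 2"
  let ?ext = "bump_extend U c ?a ?r R"
  have sm: "smooth_fun A (?ext h)" if "smooth_on (ball ?a R) h" for h
    using smooth_fun_bump_extend[OF A U(1) _ _ R(2) that, of ?r] R(1) by simp
  have sub: "smooth_on (ball ?a R) (\<lambda>u. (u - ?a) \<bullet> b)" for b
    using smooth_on_add[OF open_ball smooth_on_linear[OF bounded_linear_inner_left[of b]] smooth_on_const[of _ "- (?a \<bullet> b)"]]
    by (simp add: inner_diff_left)
  define X where "X b = ?ext (\<lambda>u. (u - ?a) \<bullet> b)" for b
  define \<beta> where "\<beta> = ?ext (\<lambda>_. 1)"
  have sX: "smooth_fun A (X b)" for b unfolding X_def by (rule sm[OF sub])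
  have s\<beta>: "smooth_fun A \<beta>" unfolding \<beta>_def by (rule sm[OF smooth_on_const])
  have \<beta>x: "\<beta> x \<noteq> 0" using U R(1) bump_center[of ?r] by (simp add: \<beta>_def bump_extend_def)
  have Xx: "X b x = 0" for b by (simp add: X_def bump_extend_def)
  have i: "inv_into U c (c y) = y" if "y \<in> U" for y
    using smooth_manifold_chart(4)[OF A U(1)] that by simp
  have vf: "v f = (\<Sum>b\<in>Basis. (v (X b) / \<beta> x) * chart_derivation A U c x b f)" for f
  proof (cases "smooth_fun A f")
    case True
    have "smooth_on (ball ?a R) (f \<circ> inv_into U c)"
      by (rule smooth_on_subset[OF smooth_fun_chart[OF True U(1)] R(2)])
    then obtain G where G: "\<And>b. smooth_on (ball ?a R) (G b)"
      "\<And>u. u \<in> ball ?a R \<Longrightarrow> (f \<circ> inv_into U c) u = (f \<circ> inv_into U c) ?a + (\<Sum>b\<in>Basis. ((u - ?a) \<bullet> b) * G b u)"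
      "\<And>b. G b ?a = frechet_derivative (f \<circ> inv_into U c) (at ?a) b"
      using Hadamard_lemma[OF _ R(1)] by blast
    define Y where "Y b = ?ext (G b)" for b
    have sY: "smooth_fun A (Y b)" for b unfolding Y_def by (rule sm[OF G(1)])
    have Yx: "Y b x = \<beta> x * chart_derivation A U c x b f" for b
      using True by (simp add: Y_def \<beta>_def bump_extend_def chart_derivation_def G(3))
    \<comment> \<open>One bump function for each of the two factors in the remainder.\<close>
    have eq: "\<beta> y * (\<beta> y * f y) = f x * (\<beta> y * \<beta> y) + (\<Sum>b\<in>Basis. X b y * Y b y)" for y
    proof (cases "y \<in> U \<and> c y \<in> ball ?a R")
      case True
      then have "f y = f x + (\<Sum>b\<in>Basis. ((c y - ?a) \<bullet> b) * G b (c y))"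
        using G(2)[of "c y"] i[of y] i[OF U(2)] by simp
      then show ?thesis using True
        by (simp add: X_def Y_def \<beta>_def bump_extend_def algebra_simps sum_distrib_left)
    qed (auto simp: X_def Y_def \<beta>_def bump_extend_def)
    note ms = smooth_fun_mult[OF A] smooth_fun_const[of A] s\<beta> sX sY True
    have "v (\<lambda>y. \<beta> y * (\<beta> y * f y)) = \<beta> x * (\<beta> x * v f + f x * v \<beta>) + \<beta> x * f x * v \<beta>"
      using tangent_mult[OF v, of \<beta> "\<lambda>y. \<beta> y * f y"] tangent_mult[OF v, of \<beta> f] ms by simp
    moreover have "v (\<lambda>y. f x * (\<beta> y * \<beta> y) + (\<Sum>b\<in>Basis. X b y * Y b y)) =
       f x * (\<beta> x * v \<beta> + \<beta> x * v \<beta>) + (\<Sum>b\<in>Basis. \<beta> x * chart_derivation A U c x b f * v (X b))"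
    proof -
      have "v (\<lambda>y. X b y * Y b y) = \<beta> x * chart_derivation A U c x b f * v (X b)" for b
        using tangent_mult[OF v, of "X b" "Y b"] sX sY Xx Yx by simp
      moreover have "v (\<lambda>y. f x * (\<beta> y * \<beta> y)) = f x * (\<beta> x * v \<beta> + \<beta> x * v \<beta>)"
        using tangent_mult[OF v, of "\<lambda>_. f x" "\<lambda>y. \<beta> y * \<beta> y"] tangent_mult[OF v, of \<beta> \<beta>] tangent_const[OF v] ms by simp
      moreover have "v (\<lambda>y. \<Sum>b\<in>Basis. X b y * Y b y) = (\<Sum>b\<in>Basis. v (\<lambda>y. X b y * Y b y))"
        by (rule tangent_sum[OF finite_Basis A v]) (intro ms)
      ultimately show ?thesis
        using tangent_add[OF v, of "\<lambda>y. f x * (\<beta> y * \<beta> y)" "\<lambda>y. \<Sum>b\<in>Basis. X b y * Y b y"]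
        by (simp add: ms smooth_fun_sum[OF finite_Basis A])
    qed
    ultimately have "\<beta> x * (\<beta> x * v f) = (\<Sum>b\<in>Basis. \<beta> x * chart_derivation A U c x b f * v (X b))"
      unfolding eq by (simp add: algebra_simps)
    then have "\<beta> x * (\<beta> x * v f) = \<beta> x * (\<Sum>b\<in>Basis. chart_derivation A U c x b f * v (X b))"
      by (simp add: sum_distrib_left mult.assoc)
    then have "\<beta> x * v f = (\<Sum>b\<in>Basis. chart_derivation A U c x b f * v (X b))"
      using \<beta>x by simp
    then have "v f = (\<Sum>b\<in>Basis. chart_derivation A U c x b f * v (X b)) / \<beta> x"
      using \<beta>x by (simp add: field_simps)
    then show ?thesis by (simp add: sum_divide_distrib mult.commute)
  next
    case False
    then show ?thesis using tangent_nonsmooth[OF v] by (simp add: chart_derivation_def)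
  qed
  have ap: "(\<Sum>b\<in>I. k b *\<^sub>R chart_derivation A U c x b) f = (\<Sum>b\<in>I. k b * chart_derivation A U c x b f)"
    if "finite I" for I k f
    using that by (induction I rule: finite_induct) auto
  have "v = (\<Sum>b\<in>Basis. (v (X b) / \<beta> x) *\<^sub>R chart_derivation A U c x b)"
    by (rule ext) (rule trans[OF vf ap[symmetric, OF finite_Basis]])
  then show ?thesis by (rule that)
qed

text \<open>
  The coordinate derivations are independent because they are separated by the cut-off coordinate
  functions.
\<close>
lemma tangent_space_basis:
  fixes A :: "('m::{t2_space,second_countable_topology}, 'e::euclidean_space) chart set"
  assumes A: "smooth_manifold A"
  obtains B where "finite B" "card B = DIM('e)" "basis_of (tangent_space A x) B"
proof -
  obtain U c where U: "(U, c) \<in> A" "x \<in> U" using smooth_manifold_cover[OF A] .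
  obtain R where R: "R > 0" "ball (c x) R \<subseteq> c ` U" using chart_ball[OF A U] .
  let ?D = "chart_derivation A U c x"
  let ?a = "c x" and ?r = "R / 2"
  have sub: "smooth_on (ball ?a R) (\<lambda>u. (u - ?a) \<bullet> b)" for b
    using smooth_on_add[OF open_ball smooth_on_linear[OF bounded_linear_inner_left[of b]] smooth_on_const[of _ "- (?a \<bullet> b)"]]
    by (simp add: inner_diff_left)
  define X where "X b = bump_extend U c ?a ?r R (\<lambda>u. (u - ?a) \<bullet> b)" for b
  have sX: "smooth_fun A (X b)" for b unfolding X_def
    using smooth_fun_bump_extend[OF A U(1) _ _ R(2) sub, of ?r] R(1) by simp
  have DX: "?D e (X b) = bump ?a ?r ?a * (e \<bullet> b)" for e b
  proof -
    have "(bump ?a ?r has_derivative frechet_derivative (bump ?a ?r) (at ?a)) (at ?a)"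
      using smooth_on_imp_differentiable[OF smooth_bump, of ?a UNIV] by (simp add: frechet_derivative_works[symmetric])
    then have "((\<lambda>u. bump ?a ?r u * ((u - ?a) \<bullet> b)) has_derivative (\<lambda>e. bump ?a ?r ?a * (e \<bullet> b))) (at ?a)"
      by (auto intro!: derivative_eq_intros)
    then have "((X b \<circ> inv_into U c) has_derivative (\<lambda>e. bump ?a ?r ?a * (e \<bullet> b))) (at ?a)"
    proof (rule has_derivative_transform_within_open[OF _ open_ball])
      show "?a \<in> ball ?a R" using R(1) by simp
      fix u assume u: "u \<in> ball ?a R"
      then have "u \<in> c ` U" using R(2) by blast
      then have "inv_into U c u \<in> U" "c (inv_into U c u) = u" by (auto intro: inv_into_into f_inv_into_f)
      then show "bump ?a ?r u * ((u - ?a) \<bullet> b) = (X b \<circ> inv_into U c) u"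
        using u by (simp add: X_def bump_extend_def)
    qed
    then have "frechet_derivative (X b \<circ> inv_into U c) (at ?a) = (\<lambda>e. bump ?a ?r ?a * (e \<bullet> b))"
      using frechet_derivative_at by metis
    then show ?thesis using sX by (simp add: chart_derivation_def)
  qed
  have b0: "bump ?a ?r ?a \<noteq> 0" using bump_center[of ?r ?a] R(1) by simp
  have inj: "inj_on ?D Basis"
  proof (rule inj_onI)
    fix e b :: 'e assume "e \<in> Basis" "b \<in> Basis" "?D e = ?D b"
    then have "?D e (X b) = ?D b (X b)" by simp
    then have "e \<bullet> b = b \<bullet> b" using DX b0 by simp
    then show "e = b" using \<open>e \<in> Basis\<close> \<open>b \<in> Basis\<close> by (metis inner_Basis zero_neq_one)
  qed
  have ap: "(\<Sum>b\<in>I. k b *\<^sub>R ?D b) f = (\<Sum>b\<in>I. k b * ?D b f)" if "finite I" for I k f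
    using that by (induction I rule: finite_induct) auto
  have "independent (?D ` Basis)"
  proof
    assume "dependent (?D ` Basis)"
    then obtain u e where e: "e \<in> Basis" "u (?D e) \<noteq> 0" and "(\<Sum>v\<in>?D ` Basis. u v *\<^sub>R v) = 0"
      using dependent_finite[of "?D ` Basis"] by auto
    then have "(\<Sum>b\<in>Basis. u (?D b) *\<^sub>R ?D b) = 0" by (simp add: sum.reindex[OF inj])
    then have "(\<Sum>b\<in>Basis. u (?D b) * ?D b (X e)) = 0"
      using ap[OF finite_Basis, of "\<lambda>b. u (?D b)" "X e"] by simp
    then have "(\<Sum>b\<in>Basis. u (?D b) * (bump ?a ?r ?a * (if b = e then 1 else 0))) = 0"
      using DX e(1) by (simp add: inner_Basis cong: sum.cong)
    then show False using e b0 by (simp add: if_distrib cong: if_cong)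
  qed
  moreover have "span (?D ` Basis) = tangent_space A x"
  proof
    show "span (?D ` Basis) \<subseteq> tangent_space A x"
      by (rule span_minimal) (auto simp: chart_derivation_tangent[OF A U] subspace_tangent_space[OF A])
    show "tangent_space A x \<subseteq> span (?D ` Basis)"
    proof
      fix v assume "v \<in> tangent_space A x"
      then obtain k where "v = (\<Sum>b\<in>Basis. k b *\<^sub>R ?D b)" using tangent_as_chart_derivation[OF A U] by blast
      then show "v \<in> span (?D ` Basis)" by (auto intro: span_sum span_scale span_base)
    qed
  qed
  ultimately have "basis_of (tangent_space A x) (?D ` Basis)" by (simp add: basis_of_def)
  then show ?thesis using that[of "?D ` Basis"] card_image[OF inj] by simp
qed

text \<open>
  Constant coefficients in a chart, cut off by a bump function that is normalised at the point.
\<close>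
lemma tangent_extension:
  fixes A :: "('m::{t2_space,second_countable_topology}, 'e::euclidean_space) chart set"
  assumes A: "smooth_manifold A" and v: "v \<in> tangent_space A x"
  obtains X where "vector_field A X" "X x = v"
proof -
  obtain U c where U: "(U, c) \<in> A" "x \<in> U" using smooth_manifold_cover[OF A] .
  obtain R where R: "R > 0" "ball (c x) R \<subseteq> c ` U" using chart_ball[OF A U] .
  let ?a = "c x" and ?r = "R / 2"
  obtain k where k: "v = (\<Sum>b\<in>Basis. k b *\<^sub>R chart_derivation A U c x b)"
    using tangent_as_chart_derivation[OF A U v] .
  define e where "e = (\<Sum>b\<in>Basis. k b *\<^sub>R b)"
  have b0: "bump ?a ?r ?a \<noteq> 0" using bump_center[of ?r ?a] R(1) by simp
  define X where "X y = (if y \<in> U \<and> c y \<in> ball ?a R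
      then (bump ?a ?r (c y) / bump ?a ?r ?a) *\<^sub>R chart_derivation A U c y e else 0)" for y
  have ap: "(\<Sum>b\<in>I. k b *\<^sub>R chart_derivation A U c x b) f = (\<Sum>b\<in>I. k b * chart_derivation A U c x b f)"
    if "finite I" for I f
    using that by (induction I rule: finite_induct) auto
  have "X x = v"
  proof
    fix f
    show "X x f = v f"
    proof (cases "smooth_fun A f")
      case True
      have l: "linear (frechet_derivative (f \<circ> inv_into U c) (at (c x)))"
        using smooth_on_imp_differentiable[OF smooth_fun_chart[OF True U(1)], of "c x"] U(2)
        by (auto simp: linear_frechet_derivative)
      show ?thesis using True U R(1) b0
        unfolding k ap[OF finite_Basis] by (simp add: X_def chart_derivation_def e_def linear_sum[OF l] linear_cmul[OF l])
    next
      case False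
      then show ?thesis by (simp add: k ap X_def chart_derivation_def)
    qed
  qed
  moreover have "vector_field A X"
    unfolding vector_field_def
  proof (intro conjI allI impI)
    fix y
    have s: "subspace (tangent_space A y)" by (rule subspace_tangent_space[OF A])
    show "X y \<in> tangent_space A y"
      unfolding X_def using chart_derivation_tangent[OF A U(1)] subspace_scale[OF s] subspace_0[OF s] by auto
  next
    fix f assume f: "smooth_fun A f"
    have "(\<lambda>y. X y f) = bump_extend U c ?a ?r R (\<lambda>u. inverse (bump ?a ?r ?a) * frechet_derivative (f \<circ> inv_into U c) (at u) e)"
      using f by (auto simp: X_def bump_extend_def chart_derivation_def field_simps)
    moreover have "smooth_fun A \<dots>"
      by (intro smooth_fun_bump_extend[OF A U(1) _ _ R(2)] smooth_on_mult open_ball smooth_on_const smooth_on_derivative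
          smooth_on_subset[OF smooth_fun_chart[OF f U(1)] R(2)]) (use R(1) in auto)
    ultimately show "smooth_fun A (\<lambda>y. X y f)" by simp
  qed
  ultimately show ?thesis using that by blast
qed

section \<open>Calculus of vector fields on a Riemannian manifold\<close>

text \<open>
  Pointwise operations under names of their own, so that rewrite rules about vector fields have a
  constant head symbol.
\<close>
definition vadd :: "'m vfield \<Rightarrow> 'm vfield \<Rightarrow> 'm vfield" where
  "vadd X Y = (\<lambda>x. X x + Y x)"

definition smul :: "('m \<Rightarrow> real) \<Rightarrow> 'm vfield \<Rightarrow> 'm vfield" where
  "smul f X = (\<lambda>x. f x *\<^sub>R X x)"

definition deriv_along :: "'m vfield \<Rightarrow> ('m \<Rightarrow> real) \<Rightarrow> 'm \<Rightarrow> real" where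
  "deriv_along X f = (\<lambda>x. X x f)"

locale riemannian_manifold =
  fixes A :: "('m::{t2_space,second_countable_topology}, 'e::euclidean_space) chart set"
    and g :: "'m \<Rightarrow> 'm tvec \<Rightarrow> 'm tvec \<Rightarrow> real"
    and N :: "'m vfield \<Rightarrow> 'm vfield \<Rightarrow> 'm vfield"
  assumes manifold: "smooth_manifold A"
    and metric: "riemannian_metric A g"
    and levi_civita: "levi_civita A g N"
begin

abbreviation vf :: "'m vfield \<Rightarrow> bool" where "vf \<equiv> vector_field A"
abbreviation sm :: "('m \<Rightarrow> real) \<Rightarrow> bool" where "sm \<equiv> smooth_fun A"
abbreviation T :: "'m \<Rightarrow> 'm tvec set" where "T \<equiv> tangent_space A"
abbreviation D :: "'m vfield \<Rightarrow> ('m \<Rightarrow> real) \<Rightarrow> 'm \<Rightarrow> real" where "D \<equiv> deriv_along"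

definition ip :: "'m vfield \<Rightarrow> 'm vfield \<Rightarrow> 'm \<Rightarrow> real" where
  "ip X Y = (\<lambda>x. g x (X x) (Y x))"

lemma vf_tangent [simp, intro]: "vf X \<Longrightarrow> X x \<in> T x"
  by (simp add: vector_field_def)

lemma T_closed [simp, intro]:
  "0 \<in> T x" "v \<in> T x \<Longrightarrow> w \<in> T x \<Longrightarrow> v + w \<in> T x" "v \<in> T x \<Longrightarrow> a *\<^sub>R v \<in> T x"
  "v \<in> T x \<Longrightarrow> - v \<in> T x" "v \<in> T x \<Longrightarrow> w \<in> T x \<Longrightarrow> v - w \<in> T x"
  using subspace_tangent_space[OF manifold, of x]
  by (auto simp: subspace_0 subspace_add subspace_scale subspace_neg subspace_diff)

lemma sm_closed [simp, intro]:
  "sm (\<lambda>_. a)"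
  "sm f \<Longrightarrow> sm h \<Longrightarrow> sm (\<lambda>x. f x + h x)"
  "sm f \<Longrightarrow> sm h \<Longrightarrow> sm (\<lambda>x. f x * h x)"
  by (simp_all add: smooth_fun_const smooth_fun_add[OF manifold] smooth_fun_mult[OF manifold])

lemma sm_uminus [simp, intro]: "sm f \<Longrightarrow> sm (\<lambda>x. - f x)"
  using sm_closed(3)[OF sm_closed(1)[of "-1"], of f] by simp

lemma sm_diff [simp, intro]: "sm f \<Longrightarrow> sm h \<Longrightarrow> sm (\<lambda>x. f x - h x)"
  using sm_closed(2)[OF _ sm_uminus, of f h] by simp

lemma sm_power [simp, intro]: "sm f \<Longrightarrow> sm (\<lambda>x. f x ^ k)"
  by (induction k) auto

lemma sm_deriv [simp, intro]: "vf X \<Longrightarrow> sm f \<Longrightarrow> sm (D X f)"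
  by (simp add: vector_field_def deriv_along_def)

lemma sm_ip [simp, intro]: "vf X \<Longrightarrow> vf Y \<Longrightarrow> sm (ip X Y)"
  using metric unfolding riemannian_metric_def ip_def by blast

lemma D_add [simp]: "vf X \<Longrightarrow> sm f \<Longrightarrow> sm h \<Longrightarrow> D X (\<lambda>x. f x + h x) x = D X f x + D X h x"
  unfolding deriv_along_def using tangent_add by (metis vf_tangent)

lemma D_mult [simp]: "vf X \<Longrightarrow> sm f \<Longrightarrow> sm h \<Longrightarrow> D X (\<lambda>x. f x * h x) x = f x * D X h x + h x * D X f x"
  unfolding deriv_along_def using tangent_mult by (metis vf_tangent)

lemma D_const [simp]: "vf X \<Longrightarrow> D X (\<lambda>_. a) x = 0"
  unfolding deriv_along_def using tangent_const by (metis vf_tangent)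

lemma D_cmult: "vf X \<Longrightarrow> sm f \<Longrightarrow> D X (\<lambda>x. a * f x) x = a * D X f x"
  by simp

lemma D_uminus [simp]: "vf X \<Longrightarrow> sm f \<Longrightarrow> D X (\<lambda>x. - f x) x = - D X f x"
  using D_cmult[of X f "-1" x] by simp

lemma D_diff [simp]: "vf X \<Longrightarrow> sm f \<Longrightarrow> sm h \<Longrightarrow> D X (\<lambda>x. f x - h x) x = D X f x - D X h x"
  using D_add[OF _ _ sm_uminus, of X f h x] by simp

lemma D_vadd [simp]: "D (vadd X Y) f x = D X f x + D Y f x"
  by (simp add: deriv_along_def vadd_def)

lemma D_smul [simp]: "D (smul h X) f x = h x * D X f x"
  by (simp add: deriv_along_def smul_def)

lemma vf_vadd [simp, intro]: "vf X \<Longrightarrow> vf Y \<Longrightarrow> vf (vadd X Y)"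
  by (simp add: vector_field_def vadd_def smooth_fun_add[OF manifold])

lemma vf_smul [simp, intro]: "sm f \<Longrightarrow> vf X \<Longrightarrow> vf (smul f X)"
  by (simp add: vector_field_def smul_def smooth_fun_mult[OF manifold])

lemma affine: "affine_connection A N"
  using levi_civita by (simp add: levi_civita_def)

lemma vf_N [simp, intro]: "vf X \<Longrightarrow> vf Y \<Longrightarrow> vf (N X Y)"
  using affine by (simp add: affine_connection_def)

lemma N_vadd_left: "vf X \<Longrightarrow> vf Y \<Longrightarrow> vf Z \<Longrightarrow> N (vadd X Y) Z = vadd (N X Z) (N Y Z)"
  using affine by (simp add: affine_connection_def vadd_def plus_fun_def)

lemma N_vadd_right: "vf X \<Longrightarrow> vf Y \<Longrightarrow> vf Z \<Longrightarrow> N X (vadd Y Z) = vadd (N X Y) (N X Z)"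
  using affine by (simp add: affine_connection_def vadd_def plus_fun_def)

lemma N_smul_left: "sm f \<Longrightarrow> vf X \<Longrightarrow> vf Y \<Longrightarrow> N (smul f X) Y = smul f (N X Y)"
  using affine by (simp add: affine_connection_def smul_def)

lemma N_smul_right:
  "sm f \<Longrightarrow> vf X \<Longrightarrow> vf Y \<Longrightarrow> N X (smul f Y) = vadd (smul (D X f) Y) (smul f (N X Y))"
  using affine by (simp add: affine_connection_def smul_def vadd_def deriv_along_def)

lemmas N_linear [simp] = N_vadd_left N_vadd_right N_smul_left N_smul_right

lemma torsion_free: "vf X \<Longrightarrow> vf Y \<Longrightarrow> lie_bracket X Y = vadd (N X Y) (smul (\<lambda>_. -1) (N Y X))"
proof -
  assume "vf X" "vf Y"
  then have "lie_bracket X Y = N X Y - N Y X" using levi_civita unfolding levi_civita_def by metis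
  then show ?thesis by (auto simp: vadd_def smul_def)
qed

lemma vf_bracket [simp, intro]: "vf X \<Longrightarrow> vf Y \<Longrightarrow> vf (lie_bracket X Y)"
  by (simp add: torsion_free)

lemma D_bracket: "D (lie_bracket X Y) f x = D X (D Y f) x - D Y (D X f) x"
  by (simp add: deriv_along_def lie_bracket_def)

lemma D_ip: "vf X \<Longrightarrow> vf Y \<Longrightarrow> vf Z \<Longrightarrow> D X (ip Y Z) x = ip (N X Y) Z x + ip Y (N X Z) x"
  using levi_civita by (simp add: levi_civita_def deriv_along_def ip_def)

lemma g_linear:
  assumes "u \<in> T x" "v \<in> T x" "w \<in> T x"
  shows "g x u (v + w) = g x u v + g x u w" "g x u (a *\<^sub>R v) = a * g x u v"
    "g x (v + w) u = g x v u + g x w u" "g x (a *\<^sub>R v) u = a * g x v u"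
    "g x u v = g x v u"
proof -
  have l: "linear_within (T x) (g x u)" and s: "\<And>v w. v \<in> T x \<Longrightarrow> w \<in> T x \<Longrightarrow> g x v w = g x w v"
    using metric assms unfolding riemannian_metric_def by blast+
  show r: "g x u (v + w) = g x u v + g x u w" "g x u (a *\<^sub>R v) = a * g x u v"
    using l assms unfolding linear_within_def by auto
  show "g x (v + w) u = g x v u + g x w u" "g x (a *\<^sub>R v) u = a * g x v u" "g x u v = g x v u"
    using r s assms T_closed by metis+
qed

lemma g_zero [simp]: "v \<in> T x \<Longrightarrow> g x v 0 = 0" "v \<in> T x \<Longrightarrow> g x 0 v = 0"
  using g_linear(2)[of v x 0 v 0] g_linear(4)[of v x 0 v 0] by auto

lemma g_pos: "v \<in> T x \<Longrightarrow> v \<noteq> 0 \<Longrightarrow> g x v v > 0"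
  using metric unfolding riemannian_metric_def by blast

lemma ip_linear [simp]:
  "vf X \<Longrightarrow> vf Y \<Longrightarrow> vf Z \<Longrightarrow> ip X (vadd Y Z) x = ip X Y x + ip X Z x"
  "vf X \<Longrightarrow> vf Y \<Longrightarrow> ip X (smul f Y) x = f x * ip X Y x"
  "vf X \<Longrightarrow> vf Y \<Longrightarrow> vf Z \<Longrightarrow> ip (vadd Y Z) X x = ip Y X x + ip Z X x"
  "vf X \<Longrightarrow> vf Y \<Longrightarrow> ip (smul f Y) X x = f x * ip Y X x"
  using g_linear[of "X x" x "Y x" "Z x"] g_linear(2)[of "X x" x "Y x" "Y x"] g_linear(4)[of "X x" x "Y x" "Y x"]
  by (auto simp: ip_def vadd_def smul_def)

lemma ip_commute: "vf X \<Longrightarrow> vf Y \<Longrightarrow> ip X Y x = ip Y X x"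
  unfolding ip_def using g_linear(5)[of "X x" x "Y x" "X x"] by auto

lemma ip_bracket:
  assumes "vf X" "vf Y" "vf Z"
  shows "ip (lie_bracket X Y) Z x = ip (N X Y) Z x - ip (N Y X) Z x"
    "ip Z (lie_bracket X Y) x = ip Z (N X Y) x - ip Z (N Y X) x"
  using assms by (simp_all add: torsion_free)

lemma extension:
  assumes "v \<in> T x" obtains X where "vf X" "X x = v"
  using tangent_extension[OF manifold assms] .

lemma vector_eqI:
  assumes "u \<in> T x" "v \<in> T x" "\<And>Z. vf Z \<Longrightarrow> g x u (Z x) = g x v (Z x)"
  shows "u = v"
proof (rule ccontr)
  assume ne: "u \<noteq> v"
  have t: "u - v \<in> T x" using assms by simp
  obtain Z where Z: "vf Z" "Z x = u - v" using extension[OF t] .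
  have "g x (u - v) (u - v) = g x u (u - v) + g x ((-1) *\<^sub>R v) (u - v)"
    using g_linear(3)[of "u - v" x u "(-1) *\<^sub>R v"] assms(1,2) t by simp
  also have "\<dots> = 0" using assms(3)[OF Z(1)] Z(2) g_linear(4)[of "u - v" x v v "-1"] assms(1,2) t by simp
  finally show False using g_pos[OF t] ne by simp
qed

lemma ip_eqI:
  assumes "vf X" "vf Y" "\<And>Z. vf Z \<Longrightarrow> ip X Z x = ip Y Z x"
  shows "X x = Y x"
  using assms by (intro vector_eqI) (auto simp: ip_def)

lemma ip_nonneg: "vf X \<Longrightarrow> ip X X x \<ge> 0" and ip_zero_iff: "vf X \<Longrightarrow> ip X X x = 0 \<longleftrightarrow> X x = 0"
  using g_pos[of "X x" x] by (cases "X x = 0"; force simp: ip_def)+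

text \<open>
  The fully covariant curvature of vector fields; its values are scalars, which are easier to compute
  with than fields.
\<close>
definition Rm :: "'m vfield \<Rightarrow> 'm vfield \<Rightarrow> 'm vfield \<Rightarrow> 'm vfield \<Rightarrow> 'm \<Rightarrow> real" where
  "Rm X Y Z W x = ip (N X (N Y Z)) W x - ip (N Y (N X Z)) W x - ip (N (lie_bracket X Y) Z) W x"

lemma curvature_vf [simp, intro]: "vf X \<Longrightarrow> vf Y \<Longrightarrow> vf Z \<Longrightarrow> vf (curvature N X Y Z)"
  and ip_curvature: "vf X \<Longrightarrow> vf Y \<Longrightarrow> vf Z \<Longrightarrow> vf W \<Longrightarrow> ip (curvature N X Y Z) W x = Rm X Y Z W x"
proof -
  assume v: "vf X" "vf Y" "vf Z"
  have e: "curvature N X Y Z = vadd (N X (N Y Z)) (vadd (smul (\<lambda>_. -1) (N Y (N X Z)))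
     (smul (\<lambda>_. -1) (N (lie_bracket X Y) Z)))"
    by (auto simp: curvature_def vadd_def smul_def)
  show "vf (curvature N X Y Z)" unfolding e using v by (intro vf_vadd vf_smul vf_N vf_bracket sm_closed(1))
  show "ip (curvature N X Y Z) W x = Rm X Y Z W x" if "vf W"
    unfolding e Rm_def using v that by (simp del: N_linear)
qed

lemma Rm_skew12:
  assumes "vf X" "vf Y" "vf Z" "vf W"
  shows "Rm Y X Z W x = - Rm X Y Z W x"
proof -
  have "lie_bracket Y X = smul (\<lambda>_. -1) (lie_bracket X Y)"
    by (auto simp: lie_bracket_def smul_def scaleR_fun_def)
  then show ?thesis using assms by (simp add: Rm_def)
qed

lemma Rm_skew34:
  assumes "vf X" "vf Y" "vf Z" "vf W"
  shows "Rm X Y W Z x = - Rm X Y Z W x"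
proof -
  have e: "D X (ip Y Z) = (\<lambda>x. ip (N X Y) Z x + ip Y (N X Z) x)" if "vf X" "vf Y" "vf Z" for X Y Z
    using D_ip[OF that] by auto
  have "D (lie_bracket X Y) (ip Z W) x = D X (D Y (ip Z W)) x - D Y (D X (ip Z W)) x"
    by (rule D_bracket)
  then show ?thesis
    using assms by (simp add: e Rm_def ip_commute[of Z] ip_commute[of "N X Z"] ip_commute[of "N Y Z"]
        ip_commute[of W "N X (N Y Z)"] ip_commute[of W "N Y (N X Z)"])
qed

lemma Rm_Bianchi:
  assumes "vf X" "vf Y" "vf Z" "vf W"
  shows "Rm X Y Z W x + Rm Y Z X W x + Rm Z X Y W x = 0"
proof -
  \<comment> \<open>Torsion-freeness reduces the cyclic sum to the Jacobi identity.\<close>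
  have b: "ip (N X (N Y Z)) W x - ip (N X (N Z Y)) W x - ip (N (lie_bracket Y Z) X) W x
      = ip (lie_bracket X (lie_bracket Y Z)) W x" if "vf X" "vf Y" "vf Z" for X Y Z
    using that assms(4) by (simp add: ip_bracket) (simp add: torsion_free)
  \<comment> \<open>On functions that are not smooth both sides vanish by convention.\<close>
  have jac: "vadd (lie_bracket X (lie_bracket Y Z))
      (vadd (lie_bracket Y (lie_bracket Z X)) (lie_bracket Z (lie_bracket X Y))) x = 0"
  proof
    fix f
    show "vadd (lie_bracket X (lie_bracket Y Z))
      (vadd (lie_bracket Y (lie_bracket Z X)) (lie_bracket Z (lie_bracket X Y))) x f = 0 f"
    proof (cases "sm f")
      case True
      have d: "X x (\<lambda>y. f y - h y) = X x f - X x h" if "vf X" "sm f" "sm h" for X f h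
        using D_diff[OF that] by (simp add: deriv_along_def)
      have s: "sm (\<lambda>y. X y f)" if "vf X" "sm f" for X f
        using that by (simp add: vector_field_def)
      show ?thesis using assms True
        by (simp add: vadd_def lie_bracket_def d[of X] d[of Y] d[of Z] s[of X] s[of Y] s[of Z])
    next
      case False
      have "vf (vadd (lie_bracket X (lie_bracket Y Z))
        (vadd (lie_bracket Y (lie_bracket Z X)) (lie_bracket Z (lie_bracket X Y))))"
        using assms by simp
      then show ?thesis using tangent_nonsmooth[OF vf_tangent False] by simp
    qed
  qed
  have "ip (vadd (lie_bracket X (lie_bracket Y Z))
      (vadd (lie_bracket Y (lie_bracket Z X)) (lie_bracket Z (lie_bracket X Y)))) W x = 0"
    using jac assms by (simp add: ip_def)
  then show ?thesis
    using b[OF assms(1,2,3)] b[OF assms(2,3,1)] b[OF assms(3,1,2)] assms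
    by (simp add: Rm_def)
qed

text \<open>
  Four instances of the Bianchi identity, combined by the two skew symmetries.
\<close>
lemma Rm_pair:
  assumes "vf X" "vf Y" "vf Z" "vf W"
  shows "Rm X Y Z W x = Rm Z W X Y x"
  using Rm_Bianchi[of X Y Z W x] Rm_Bianchi[of Y Z W X x] Rm_Bianchi[of Z W X Y x] Rm_Bianchi[of W X Y Z x]
    Rm_skew12[of X Y Z W x] Rm_skew12[of Y Z X W x] Rm_skew12[of Z X Y W x] Rm_skew12[of X W Y Z x]
    Rm_skew12[of Y W Z X x] Rm_skew12[of Z W X Y x]
    Rm_skew34[of X Y Z W x] Rm_skew34[of Y Z X W x] Rm_skew34[of Z X Y W x] Rm_skew34[of X W Y Z x]
    Rm_skew34[of W X Y Z x]
    Rm_skew34[of Y W Z X x] Rm_skew34[of Z W X Y x] Rm_skew34[of X Z Y W x] Rm_skew34[of W Y Z X x] Rm_skew12[of Z X W Y x] Rm_skew12[of W Y X Z x]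
    assms
  by (smt (verit))

lemma Rm_add:
  assumes "vf X" "vf X'" "vf Y" "vf Z" "vf W"
  shows "Rm (vadd X X') Y Z W x = Rm X Y Z W x + Rm X' Y Z W x"
    "Rm Y Z W (vadd X X') x = Rm Y Z W X x + Rm Y Z W X' x"
proof -
  show "Rm (vadd X X') Y Z W x = Rm X Y Z W x + Rm X' Y Z W x"
    using assms by (simp add: Rm_def) (simp add: torsion_free)
  show "Rm Y Z W (vadd X X') x = Rm Y Z W X x + Rm Y Z W X' x"
    using assms by (simp add: Rm_def)
qed

lemma Rm_scale:
  assumes "sm f" "vf X" "vf Y" "vf Z" "vf W"
  shows "Rm (smul f X) Y Z W x = f x * Rm X Y Z W x"
    "Rm Y Z W (smul f X) x = f x * Rm Y Z W X x"
proof -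
  show "Rm (smul f X) Y Z W x = f x * Rm X Y Z W x"
    using assms by (simp add: Rm_def) (simp add: torsion_free algebra_simps)
  show "Rm Y Z W (smul f X) x = f x * Rm Y Z W X x"
    using assms by (simp add: Rm_def algebra_simps)
qed

end

section \<open>Trans-Sasakian threefolds of constant type\<close>

locale trans_sasakian_3 = riemannian_manifold A g N
  for A :: "('m::{t2_space,second_countable_topology}, real ^ 3) chart set"
    and g :: "'m \<Rightarrow> 'm tvec \<Rightarrow> 'm tvec \<Rightarrow> real"
    and N :: "'m vfield \<Rightarrow> 'm vfield \<Rightarrow> 'm vfield" +
  fixes \<phi> :: "'m \<Rightarrow> 'm tvec \<Rightarrow> 'm tvec" and \<xi> :: "'m vfield"
    and \<eta> :: "'m \<Rightarrow> 'm tvec \<Rightarrow> real" and \<alpha> \<beta> :: real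
  assumes trans_sasakian: "trans_sasakian A \<phi> \<xi> \<eta> g N (\<lambda>_. \<alpha>) (\<lambda>_. \<beta>)"
    and \<alpha>_nonzero: "\<alpha> \<noteq> 0"
begin

definition ph :: "'m vfield \<Rightarrow> 'm vfield" where "ph X = (\<lambda>x. \<phi> x (X x))"
definition et :: "'m vfield \<Rightarrow> 'm \<Rightarrow> real" where "et X = (\<lambda>x. \<eta> x (X x))"

lemma acm: "almost_contact_metric A \<phi> \<xi> \<eta> g"
  using trans_sasakian by (simp add: trans_sasakian_def)

lemma vf_xi [simp, intro]: "vf \<xi>"
  using acm by (simp add: almost_contact_metric_def)

lemma vf_ph [simp, intro]: "vf X \<Longrightarrow> vf (ph X)"
  using acm by (simp add: almost_contact_metric_def tensor_field_11_def ph_def)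

lemma phi_tangent [simp, intro]: "v \<in> T x \<Longrightarrow> \<phi> x v \<in> T x"
proof -
  have "\<phi> x ` T x \<subseteq> T x" using acm by (simp add: almost_contact_metric_def tensor_field_11_def)
  then show "v \<in> T x \<Longrightarrow> \<phi> x v \<in> T x" by blast
qed

lemma phi_linear:
  assumes "v \<in> T x"
  shows "w \<in> T x \<Longrightarrow> \<phi> x (v + w) = \<phi> x v + \<phi> x w" "\<phi> x (a *\<^sub>R v) = a *\<^sub>R \<phi> x v"
    "w \<in> T x \<Longrightarrow> \<eta> x (v + w) = \<eta> x v + \<eta> x w" "\<eta> x (a *\<^sub>R v) = a * \<eta> x v"
proof -
  have "linear_within (T x) (\<phi> x)" "linear_within (T x) (\<eta> x)"
    using acm by (simp_all add: almost_contact_metric_def tensor_field_11_def one_form_def)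
  then show "w \<in> T x \<Longrightarrow> \<phi> x (v + w) = \<phi> x v + \<phi> x w" "\<phi> x (a *\<^sub>R v) = a *\<^sub>R \<phi> x v"
    "w \<in> T x \<Longrightarrow> \<eta> x (v + w) = \<eta> x v + \<eta> x w" "\<eta> x (a *\<^sub>R v) = a * \<eta> x v"
    using assms by (simp_all add: linear_within_def)
qed

lemma sm_et [simp, intro]: "vf X \<Longrightarrow> sm (et X)"
  using acm by (simp add: almost_contact_metric_def one_form_def et_def)

lemma ph_linear [simp]:
  "vf X \<Longrightarrow> vf Y \<Longrightarrow> ph (vadd X Y) = vadd (ph X) (ph Y)"
  "vf X \<Longrightarrow> ph (smul f X) = smul f (ph X)"
  by (auto simp: ph_def vadd_def smul_def phi_linear)

lemma et_linear [simp]: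
  "vf X \<Longrightarrow> vf Y \<Longrightarrow> et (vadd X Y) = (\<lambda>x. et X x + et Y x)"
  "vf X \<Longrightarrow> et (smul f X) = (\<lambda>x. f x * et X x)"
  by (auto simp: et_def vadd_def smul_def phi_linear)

lemma phi_phi: "v \<in> T x \<Longrightarrow> \<phi> x (\<phi> x v) = - v + \<eta> x v *\<^sub>R \<xi> x"
  using acm by (simp add: almost_contact_metric_def)

lemma et_xi [simp]: "et \<xi> = (\<lambda>_. 1)"
  using acm by (auto simp: almost_contact_metric_def et_def)

lemma ip_ph_ph [simp]: "vf X \<Longrightarrow> vf Y \<Longrightarrow> ip (ph X) (ph Y) x = ip X Y x - et X x * et Y x"
  using acm by (simp add: almost_contact_metric_def ip_def ph_def et_def)

lemma xi_nonzero: "\<xi> x \<noteq> 0"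
proof
  assume "\<xi> x = 0"
  moreover have "\<eta> x (\<xi> x) = 1" using fun_cong[OF et_xi, of x] by (simp add: et_def)
  ultimately have "\<eta> x 0 = 1" by metis
  then show False using phi_linear(4)[of "\<xi> x" x 0] by simp
qed

lemma phi_xi: "\<phi> x (\<xi> x) = 0"
proof -
  have e: "\<eta> x (\<xi> x) = 1" using fun_cong[OF et_xi, of x] by (simp add: et_def)
  have 0: "\<phi> x (\<phi> x (\<xi> x)) = 0" using phi_phi[of "\<xi> x" x] e by simp
  define t where "t = \<eta> x (\<phi> x (\<xi> x))"
  have "\<phi> x (\<phi> x (\<phi> x (\<xi> x))) = 0" using 0 phi_linear(2)[of 0 x 0] by simp
  then have t: "\<phi> x (\<xi> x) = t *\<^sub>R \<xi> x" using phi_phi[of "\<phi> x (\<xi> x)" x] by (simp add: t_def)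
  then have "\<phi> x (\<phi> x (\<xi> x)) = t *\<^sub>R \<phi> x (\<xi> x)" using phi_linear(2)[of "\<xi> x" x t] by simp
  then have "(t * t) *\<^sub>R \<xi> x = 0" using 0 t by simp
  then show ?thesis using t xi_nonzero by simp
qed

lemma eta_phi: "v \<in> T x \<Longrightarrow> \<eta> x (\<phi> x v) = 0"
proof -
  assume v: "v \<in> T x"
  have "\<phi> x (\<phi> x (\<phi> x v)) = \<phi> x ((-1) *\<^sub>R v + \<eta> x v *\<^sub>R \<xi> x)" using phi_phi[OF v] by simp
  also have "\<dots> = (-1) *\<^sub>R \<phi> x v + \<eta> x v *\<^sub>R \<phi> x (\<xi> x)"
    using v phi_linear(1)[of "(-1) *\<^sub>R v" x "\<eta> x v *\<^sub>R \<xi> x"]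
      phi_linear(2)[of v x "-1"] phi_linear(2)[of "\<xi> x" x "\<eta> x v"] by simp
  finally have "\<eta> x (\<phi> x v) *\<^sub>R \<xi> x = 0" using phi_phi[of "\<phi> x v" x] v phi_xi by simp
  then show ?thesis using xi_nonzero by simp
qed

lemma et_ph [simp]: "vf X \<Longrightarrow> et (ph X) = (\<lambda>_. 0)"
  by (auto simp: et_def ph_def eta_phi)

lemma ph_xi [simp]: "ph \<xi> = smul (\<lambda>_. 0) \<xi>"
  by (auto simp: ph_def phi_xi smul_def)

lemma ip_xi [simp]:
  assumes "vf X" shows "ip X \<xi> x = et X x" "ip \<xi> X x = et X x"
proof -
  have "ip (ph X) (ph \<xi>) x = 0" using assms by (simp del: ip_ph_ph)
  moreover have "ip (ph X) (ph \<xi>) x = ip X \<xi> x - et X x * 1"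
    using ip_ph_ph[OF assms vf_xi, of x] by (simp only: et_xi)
  ultimately show "ip X \<xi> x = et X x" by linarith
  then show "ip \<xi> X x = et X x" using assms ip_commute by simp
qed

lemma ph_ph [simp]: "vf X \<Longrightarrow> ph (ph X) = vadd (smul (\<lambda>_. -1) X) (smul (et X) \<xi>)"
  by (auto simp: ph_def vadd_def smul_def et_def phi_phi)

lemma ip_ph_skew: "vf X \<Longrightarrow> vf Y \<Longrightarrow> ip X (ph Y) x = - ip (ph X) Y x"
  using ip_ph_ph[of X "ph Y" x] by (simp del: ip_ph_ph)

lemma ip_ph_self [simp]: "vf X \<Longrightarrow> ip (ph X) X x = 0" "vf X \<Longrightarrow> ip X (ph X) x = 0"
  using ip_ph_skew[of X X x] ip_commute[of X "ph X" x] by auto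

text \<open>
  The structure equation for \<open>\<phi>\<close>, paired with a test field.
\<close>
lemma ip_N_ph:
  assumes "vf X" "vf Y" "vf Z"
  shows "ip (N X (ph Y)) Z x = - ip (N X Y) (ph Z) x
     + \<alpha> * (ip X Y x * et Z x - et Y x * ip X Z x)
     + \<beta> * (ip (ph X) Y x * et Z x - et Y x * ip (ph X) Z x)"
proof -
  have "cov_deriv_11 N \<phi> X Y x =
     \<alpha> *\<^sub>R (g x (X x) (Y x) *\<^sub>R \<xi> x - \<eta> x (Y x) *\<^sub>R X x) +
     \<beta> *\<^sub>R (g x (\<phi> x (X x)) (Y x) *\<^sub>R \<xi> x - \<eta> x (Y x) *\<^sub>R \<phi> x (X x))"
    using trans_sasakian assms unfolding trans_sasakian_def by blast
  then have "N X (ph Y) x = vadd (ph (N X Y))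
     (vadd (smul (\<lambda>_. \<alpha>) (vadd (smul (ip X Y) \<xi>) (smul (\<lambda>x. - et Y x) X)))
      (smul (\<lambda>_. \<beta>) (vadd (smul (ip (ph X) Y) \<xi>) (smul (\<lambda>x. - et Y x) (ph X))))) x"
    by (simp add: cov_deriv_11_def ph_def vadd_def smul_def ip_def et_def algebra_simps)
  then have "ip (N X (ph Y)) Z x = ip (vadd (ph (N X Y))
     (vadd (smul (\<lambda>_. \<alpha>) (vadd (smul (ip X Y) \<xi>) (smul (\<lambda>x. - et Y x) X)))
      (smul (\<lambda>_. \<beta>) (vadd (smul (ip (ph X) Y) \<xi>) (smul (\<lambda>x. - et Y x) (ph X)))))) Z x"
    by (simp add: ip_def)
  then show ?thesis
    using assms by (simp add: ip_ph_skew algebra_simps)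
qed

lemma et_N:
  assumes "vf X" "vf Y"
  shows "et (N X Y) x = D X (et Y) x + \<alpha> * ip (ph X) Y x - \<beta> * (ip X Y x - et X x * et Y x)"
proof -
  have "cov_deriv_form N \<eta> X Y x = - \<alpha> * g x (\<phi> x (X x)) (Y x) + \<beta> * g x (\<phi> x (X x)) (\<phi> x (Y x))"
    using trans_sasakian assms unfolding trans_sasakian_def by blast
  moreover have "g x (\<phi> x (X x)) (\<phi> x (Y x)) = ip X Y x - et X x * et Y x"
    using ip_ph_ph[of X Y x] assms by (simp add: ip_def ph_def)
  ultimately show ?thesis
    by (simp add: cov_deriv_form_def deriv_along_def et_def[abs_def] ip_def ph_def algebra_simps)
qed

lemma D_et:
  assumes "vf X" "vf Y"
  shows "D X (et Y) x = et (N X Y) x - \<alpha> * ip (ph X) Y x + \<beta> * (ip X Y x - et X x * et Y x)"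
  using et_N[OF assms] by simp

lemma ip_N_xi:
  assumes "vf X" "vf Y"
  shows "ip (N X \<xi>) Y x = - \<alpha> * ip (ph X) Y x + \<beta> * (ip X Y x - et X x * et Y x)"
    "ip Y (N X \<xi>) x = - \<alpha> * ip (ph X) Y x + \<beta> * (ip X Y x - et X x * et Y x)"
proof -
  have "ip Y \<xi> = et Y" using assms by auto
  then have "D X (et Y) x = et (N X Y) x + ip Y (N X \<xi>) x"
    using D_ip[of X Y \<xi> x] assms by simp
  then show "ip Y (N X \<xi>) x = - \<alpha> * ip (ph X) Y x + \<beta> * (ip X Y x - et X x * et Y x)"
    using D_et[OF assms] by simp
  then show "ip (N X \<xi>) Y x = - \<alpha> * ip (ph X) Y x + \<beta> * (ip X Y x - et X x * et Y x)"
    using ip_commute assms by simp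
qed

lemma N_xi: "vf X \<Longrightarrow> N X \<xi> = vadd (smul (\<lambda>_. - \<alpha>) (ph X)) (smul (\<lambda>_. \<beta>) (vadd X (smul (\<lambda>x. - et X x) \<xi>)))"
proof
  fix x assume X: "vf X"
  show "N X \<xi> x = vadd (smul (\<lambda>_. - \<alpha>) (ph X)) (smul (\<lambda>_. \<beta>) (vadd X (smul (\<lambda>x. - et X x) \<xi>))) x"
    by (rule ip_eqI) (use X in \<open>auto simp: ip_N_xi algebra_simps\<close>)
qed


subsection \<open>Horizontal vector fields and adapted frames\<close>

definition hor :: "'m vfield \<Rightarrow> bool" where "hor X \<longleftrightarrow> vf X \<and> et X = (\<lambda>_. 0)"

lemma hor_vf [simp, intro]: "hor X \<Longrightarrow> vf X" and hor_et [simp]: "hor X \<Longrightarrow> et X = (\<lambda>_. 0)"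
  by (simp_all add: hor_def)

lemma hor_closed [simp, intro]:
  "hor X \<Longrightarrow> hor Y \<Longrightarrow> hor (vadd X Y)" "sm f \<Longrightarrow> hor X \<Longrightarrow> hor (smul f X)" "vf X \<Longrightarrow> hor (ph X)"
  by (simp_all add: hor_def del: hor_vf hor_et)

lemma linear_within_sum:
  fixes L :: "'m tvec \<Rightarrow> real"
  assumes "linear_within (T x) L" "finite S" "S \<subseteq> T x"
  shows "(\<Sum>u\<in>S. k u *\<^sub>R u) \<in> T x \<and> L (\<Sum>u\<in>S. k u *\<^sub>R u) = (\<Sum>u\<in>S. k u * L u)"
  using assms(2,3)
proof (induction S rule: finite_induct)
  case empty
  have "L (0 *\<^sub>R 0) = 0 *\<^sub>R L 0" using assms(1) T_closed(1) unfolding linear_within_def by blast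
  then have "L 0 = 0" by simp
  then show ?case by (simp only: sum.empty T_closed(1) simp_thms)
next
  case (insert u S')
  let ?s = "\<Sum>u\<in>S'. k u *\<^sub>R u"
  have sub: "u \<in> T x" "S' \<subseteq> T x" using insert.prems by blast+
  note u = sub(1) T_closed(3)[OF sub(1), of "k u"]
    and s = conjunct1[OF insert.IH[OF sub(2)]] conjunct2[OF insert.IH[OF sub(2)]]
  have "L (k u *\<^sub>R u) = k u *\<^sub>R L u"
    using assms(1) u unfolding linear_within_def by blast
  moreover have "L (k u *\<^sub>R u + ?s) = L (k u *\<^sub>R u) + L ?s"
    using assms(1) u s(1) unfolding linear_within_def by blast
  ultimately show ?case
    using T_closed(2)[OF u(2) s(1)] s(2)
    by (simp only: sum.insert[OF insert(1,2)] simp_thms real_scaleR_def)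
qed

lemma g_linear_within: "v \<in> T x \<Longrightarrow> linear_within (T x) (g x v)"
  using metric by (simp add: riemannian_metric_def)

lemma orthogonal_independent:
  assumes "finite S" "S \<subseteq> T x" "0 \<notin> S" "\<And>u v. u \<in> S \<Longrightarrow> v \<in> S \<Longrightarrow> u \<noteq> v \<Longrightarrow> g x u v = 0"
  shows "independent S"
proof
  assume "dependent S"
  then obtain k v where v: "v \<in> S" "k v \<noteq> 0" and s: "(\<Sum>u\<in>S. k u *\<^sub>R u) = 0"
    using dependent_finite[OF assms(1)] by auto
  have vT: "v \<in> T x" using v assms(2) by blast
  have "(\<Sum>u\<in>S. k u * g x v u) = g x v (\<Sum>u\<in>S. k u *\<^sub>R u)"
    using linear_within_sum[OF g_linear_within[OF vT] assms(1,2)] by simp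
  then have "(\<Sum>u\<in>S. k u * g x v u) = 0"
    by (simp only: s g_zero(1)[OF vT])
  moreover have "(\<Sum>u\<in>S. k u * g x v u) = (\<Sum>u\<in>S. if u = v then k v * g x v v else 0)"
    by (rule sum.cong) (use assms(4) v in auto)
  moreover have "g x v v > 0" using g_pos[OF vT] v assms(3) by auto
  ultimately show False using v assms(1) by simp
qed

lemma orthogonal_card_le_3:
  assumes "finite S" "S \<subseteq> T x" "0 \<notin> S" "\<And>u v. u \<in> S \<Longrightarrow> v \<in> S \<Longrightarrow> u \<noteq> v \<Longrightarrow> g x u v = 0"
  shows "card S \<le> 3"
proof -
  obtain B where B: "finite B" "card B = DIM(real ^ 3)" "basis_of (T x) B"
    using tangent_space_basis[OF manifold] by blast
  have "S \<subseteq> span B" using B(3) assms(2) by (simp add: basis_of_def)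
  then show ?thesis using independent_span_bound[OF B(1) orthogonal_independent[OF assms]] B(2) by simp
qed

text \<open>
  A horizontal field \<open>E\<close>, its image under \<open>\<phi>\<close> and \<open>\<xi>\<close> are orthogonal, and a nonzero remainder would be a fourth
  orthogonal vector.  The factor \<open>ip E E\<close> avoids division, so that the expansion has smooth coefficients
  and holds globally, even where \<open>E\<close> vanishes.
\<close>
lemma hor_frame:
  assumes E: "hor E" and W: "vf W"
  shows "smul (ip E E) W = vadd (smul (ip W E) E)
      (vadd (smul (ip W (ph E)) (ph E)) (smul (\<lambda>x. ip E E x * et W x) \<xi>))"
proof
  fix x
  let ?n = "ip E E x"
  show "smul (ip E E) W x = vadd (smul (ip W E) E)
      (vadd (smul (ip W (ph E)) (ph E)) (smul (\<lambda>x. ip E E x * et W x) \<xi>)) x"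
  proof (cases "E x = 0")
    case True
    then have "ph E x = 0" using phi_linear(2)[of 0 x 0] by (simp add: ph_def)
    moreover have "?n = 0" using True E by (simp add: ip_zero_iff)
    ultimately show ?thesis using True by (simp add: smul_def vadd_def)
  next
    case False
    then have n: "?n \<noteq> 0" using ip_zero_iff[of E x] E by simp
    define R where "R = vadd (smul (ip E E) W) (smul (\<lambda>_. -1) (vadd (smul (ip W E) E)
      (vadd (smul (ip W (ph E)) (ph E)) (smul (\<lambda>x. ip E E x * et W x) \<xi>))))"
    have vR: "vf R" unfolding R_def using E W by simp
    have o: "ip R E x = 0" "ip R (ph E) x = 0" "ip R \<xi> x = 0"
      unfolding R_def using E W ip_commute[of "ph E" E x] by (simp_all add: ip_linear(3,4) del: ip_xi)
         (simp_all)
    have "R x = 0"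
    proof (rule ccontr)
      assume R0: "R x \<noteq> 0"
      have ne: "ph E x \<noteq> 0" using ip_zero_iff[of "ph E" x] E n by simp
      have gs: "g x (E x) (ph E x) = 0" "g x (ph E x) (E x) = 0" "g x (E x) (\<xi> x) = 0" "g x (\<xi> x) (E x) = 0"
        "g x (ph E x) (\<xi> x) = 0" "g x (\<xi> x) (ph E x) = 0" "g x (R x) (E x) = 0" "g x (E x) (R x) = 0"
        "g x (R x) (ph E x) = 0" "g x (ph E x) (R x) = 0" "g x (R x) (\<xi> x) = 0" "g x (\<xi> x) (R x) = 0"
        using o E vR ip_commute[of R E x] ip_commute[of R "ph E" x] ip_commute[of R \<xi> x]
          ip_ph_self[of E x] ip_xi[of E x] ip_xi[of "ph E" x]
        by (simp_all add: ip_def del: ip_ph_self ip_xi)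
      have pos: "g x (E x) (E x) > 0" "g x (ph E x) (ph E x) > 0" "g x (\<xi> x) (\<xi> x) > 0" "g x (R x) (R x) > 0"
        using g_pos False ne xi_nonzero R0 E vR by (simp_all add: vf_tangent)
      have d: "E x \<noteq> ph E x" "E x \<noteq> \<xi> x" "E x \<noteq> R x" "ph E x \<noteq> \<xi> x" "ph E x \<noteq> R x" "\<xi> x \<noteq> R x"
        using gs pos by (metis less_irrefl)+
      have "card {E x, ph E x, \<xi> x, R x} \<le> 3"
        by (rule orthogonal_card_le_3[of _ x])
           (use gs False ne R0 xi_nonzero E vR in \<open>auto simp: vf_tangent\<close>)
      then show False using d by simp
    qed
    moreover have "R x = smul (ip E E) W x + (-1) *\<^sub>R vadd (smul (ip W E) E)
      (vadd (smul (ip W (ph E)) (ph E)) (smul (\<lambda>x. ip E E x * et W x) \<xi>)) x"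
      by (simp only: R_def vadd_def smul_def)
    ultimately show ?thesis
      by (simp only: scaleR_minus1_left eq_neg_iff_add_eq_0[symmetric] minus_minus)
  qed
qed

text \<open>
  The tangent space is not one-dimensional, so some vector is not a multiple of \<open>\<xi>\<close>.
\<close>
lemma hor_unit_exists:
  obtains E where "hor E" "ip E E x = 1"
proof -
  obtain B where B: "finite B" "card B = DIM(real ^ 3)" "basis_of (T x) B"
    using tangent_space_basis[OF manifold] by blast
  have "\<exists>b\<in>B. b \<notin> span {\<xi> x}"
  proof (rule ccontr)
    assume "\<not> ?thesis"
    then have "B \<subseteq> span {\<xi> x}" by auto
    then have "card B \<le> card {\<xi> x}"
      using independent_span_bound[of "{\<xi> x}" B] B(3) by (simp add: basis_of_def)
    then show False using B(2) by simp
  qed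
  then obtain b where b: "b \<in> B" "b \<notin> span {\<xi> x}" by blast
  have "b \<in> T x" using B(3) b(1) span_base[of b B] by (simp add: basis_of_def)
  then obtain W where W: "vf W" "W x = b" using extension by blast
  define E where "E = vadd W (smul (\<lambda>x. - et W x) \<xi>)"
  have hE: "hor E" unfolding E_def hor_def using W by auto
  have "E x \<noteq> 0"
  proof
    assume "E x = 0"
    then have "b = et W x *\<^sub>R \<xi> x" using W by (simp add: E_def vadd_def smul_def)
    then show False using b(2) by (metis span_breakdown_eq span_zero span_base singletonI span_scale)
  qed
  then have n: "ip E E x > 0" using ip_zero_iff[of E x] ip_nonneg[of E x] hE by (simp add: less_le)
  have "hor (smul (\<lambda>_. 1 / sqrt (ip E E x)) E)" using hE by simp
  moreover have "ip (smul (\<lambda>_. 1 / sqrt (ip E E x)) E) (smul (\<lambda>_. 1 / sqrt (ip E E x)) E) x = 1"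
    using hE n by (simp add: field_simps)
  ultimately show ?thesis by (rule that)
qed

definition unit_at :: "'m \<Rightarrow> 'm vfield" where
  "unit_at x = (SOME E. hor E \<and> ip E E x = 1)"

lemma unit_at: "hor (unit_at x)" "ip (unit_at x) (unit_at x) x = 1"
  unfolding unit_at_def using someI_ex[of "\<lambda>E. hor E \<and> ip E E x = 1"] hor_unit_exists[of x] by metis+

text \<open>
  An operator that is linear over the smooth functions only sees the value of a vector field at the
  point: expand the field in an adapted frame with smooth coefficients.
\<close>

lemma tensorial:
  fixes L :: "'m vfield \<Rightarrow> 'a::real_vector"
  assumes add: "\<And>X Y. vf X \<Longrightarrow> vf Y \<Longrightarrow> L (vadd X Y) = L X + L Y"
    and scale: "\<And>f X. sm f \<Longrightarrow> vf X \<Longrightarrow> L (smul f X) = f x *\<^sub>R L X"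
    and X: "vf X" and Y: "vf Y" and eq: "X x = Y x"
  shows "L X = L Y"
proof -
  obtain E where E: "hor E" "ip E E x = 1" using hor_unit_exists .
  have LW: "L W = ip W E x *\<^sub>R L E + (ip W (ph E) x *\<^sub>R L (ph E) + et W x *\<^sub>R L \<xi>)" if "vf W" for W
  proof -
    have "L W = L (smul (ip E E) W)" using scale[of "ip E E" W] E that by simp
    also have "\<dots> = ip W E x *\<^sub>R L E + (ip W (ph E) x *\<^sub>R L (ph E) + et W x *\<^sub>R L \<xi>)"
      unfolding hor_frame[OF E(1) that] using E that by (simp add: add scale)
    finally show ?thesis .
  qed
  have "ip X E x = ip Y E x" "ip X (ph E) x = ip Y (ph E) x" "et X x = et Y x"
    using eq by (simp_all add: ip_def et_def)
  then show ?thesis unfolding LW[OF X] LW[OF Y] by simp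
qed

subsection \<open>The second structure function vanishes\<close>

text \<open>
  The skew part of \<open>Y \<mapsto> R(Y, \<xi>)\<xi>\<close> is \<open>2\<alpha>\<beta>\<phi>\<close>, but pair symmetry makes this endomorphism self-adjoint.
\<close>
lemma beta_zero: "\<beta> = 0"
proof -
  obtain x :: 'm where True by blast
  obtain E where E: "hor E" "ip E E x = 1" using hor_unit_exists .
  let ?F = "ph E"
  have Nxx: "N \<xi> \<xi> = smul (\<lambda>_. 0) \<xi>" using N_xi[OF vf_xi] by (auto simp: vadd_def smul_def)
  have R: "Rm X \<xi> \<xi> Y x = - (ip (N \<xi> (N X \<xi>)) Y x) - ip (N (lie_bracket X \<xi>) \<xi>) Y x"
    if "vf X" "vf Y" for X Y
    using that by (simp add: Rm_def Nxx)
  have EF: "ip ?F ?F x = 1" using E by simp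
  have s: "Rm E \<xi> \<xi> ?F x = Rm ?F \<xi> \<xi> E x"
    using Rm_pair[of E \<xi> \<xi> ?F x] Rm_skew12[of \<xi> ?F E \<xi> x] Rm_skew34[of ?F \<xi> E \<xi> x] E by simp
  have k: "ip (ph (N \<xi> ?F)) E x = - ip (N \<xi> E) E x"
    using ip_ph_skew[of "N \<xi> ?F" E x] ip_N_ph[of \<xi> E ?F x] E by simp
  have "Rm E \<xi> \<xi> ?F x - Rm ?F \<xi> \<xi> E x = 4 * \<alpha> * \<beta>"
    using E EF
    by (simp add: R N_xi ip_N_ph torsion_free, simp add: ip_N_ph et_N k algebra_simps)
  then show ?thesis using s \<alpha>_nonzero by simp
qed


section \<open>Curvature\<close>

lemma ip_N_ph0:
  assumes "vf X" "vf Y" "vf Z"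
  shows "ip (N X (ph Y)) Z x = - ip (N X Y) (ph Z) x + \<alpha> * (ip X Y x * et Z x - et Y x * ip X Z x)"
  using ip_N_ph[OF assms, of x] beta_zero by simp

lemma et_N0: "vf X \<Longrightarrow> vf Y \<Longrightarrow> et (N X Y) x = D X (et Y) x + \<alpha> * ip (ph X) Y x"
  using et_N[of X Y x] beta_zero by simp

lemma N_xi0: "vf X \<Longrightarrow> N X \<xi> = smul (\<lambda>_. - \<alpha>) (ph X)"
  using N_xi[of X] beta_zero by (simp add: vadd_def smul_def)

lemma Rm_linear [simp]:
  assumes Y: "vf Y" and Z: "vf Z" and W: "vf W" and X: "vf X"
  shows "vf X' \<Longrightarrow> Rm (vadd X X') Y Z W x = Rm X Y Z W x + Rm X' Y Z W x"
    "sm f \<Longrightarrow> Rm (smul f X) Y Z W x = f x * Rm X Y Z W x"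
    "vf X' \<Longrightarrow> Rm Y (vadd X X') Z W x = Rm Y X Z W x + Rm Y X' Z W x"
    "sm f \<Longrightarrow> Rm Y (smul f X) Z W x = f x * Rm Y X Z W x"
    "vf X' \<Longrightarrow> Rm Y Z (vadd X X') W x = Rm Y Z X W x + Rm Y Z X' W x"
    "sm f \<Longrightarrow> Rm Y Z (smul f X) W x = f x * Rm Y Z X W x"
    "vf X' \<Longrightarrow> Rm Y Z W (vadd X X') x = Rm Y Z W X x + Rm Y Z W X' x"
    "sm f \<Longrightarrow> Rm Y Z W (smul f X) x = f x * Rm Y Z W X x"
proof -
  show 2: "Rm (smul f X) Y Z W x = f x * Rm X Y Z W x" if "sm f"
    by (rule Rm_scale(1)[OF that X Y Z W])
  show "Rm Y (smul f X) Z W x = f x * Rm Y X Z W x" if "sm f"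
    using Rm_skew12[OF vf_smul[OF that X] Y Z W, of x] Rm_skew12[OF X Y Z W, of x] 2[OF that] by simp
  show 4: "Rm Y Z W (smul f X) x = f x * Rm Y Z W X x" if "sm f"
    by (rule Rm_scale(2)[OF that X Y Z W])
  show "Rm Y Z (smul f X) W x = f x * Rm Y Z X W x" if "sm f"
    using Rm_skew34[OF Y Z W vf_smul[OF that X], of x] Rm_skew34[OF Y Z W X, of x] 4[OF that] by simp
  assume X': "vf X'"
  show 1: "Rm (vadd X X') Y Z W x = Rm X Y Z W x + Rm X' Y Z W x"
    by (rule Rm_add(1)[OF X X' Y Z W])
  show "Rm Y (vadd X X') Z W x = Rm Y X Z W x + Rm Y X' Z W x"
    using Rm_skew12[OF vf_vadd[OF X X'] Y Z W, of x] Rm_skew12[OF X Y Z W, of x] Rm_skew12[OF X' Y Z W, of x] 1 by simp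
  show 3: "Rm Y Z W (vadd X X') x = Rm Y Z W X x + Rm Y Z W X' x"
    by (rule Rm_add(2)[OF X X' Y Z W])
  show "Rm Y Z (vadd X X') W x = Rm Y Z X W x + Rm Y Z X' W x"
    using Rm_skew34[OF Y Z W vf_vadd[OF X X'], of x] Rm_skew34[OF Y Z W X, of x] Rm_skew34[OF Y Z W X', of x] 3 by simp
qed

lemma Rm_cong:
  assumes "vf X" "vf Y" "vf Z" "vf W" "vf X'" "vf Y'" "vf Z'" "vf W'"
    and "X x = X' x" "Y x = Y' x" "Z x = Z' x" "W x = W' x"
  shows "Rm X Y Z W x = Rm X' Y' Z' W' x"
proof -
  have "Rm X Y Z W x = Rm X' Y Z W x"
    by (rule tensorial[where L = "\<lambda>X. Rm X Y Z W x" and x = x]) (use assms in auto)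
  also have "\<dots> = Rm X' Y' Z W x"
    by (rule tensorial[where L = "\<lambda>Y. Rm X' Y Z W x" and x = x]) (use assms in auto)
  also have "\<dots> = Rm X' Y' Z' W x"
    by (rule tensorial[where L = "\<lambda>Z. Rm X' Y' Z W x" and x = x]) (use assms in auto)
  also have "\<dots> = Rm X' Y' Z' W' x"
    by (rule tensorial[where L = "\<lambda>W. Rm X' Y' Z' W x" and x = x]) (use assms in auto)
  finally show ?thesis .
qed

lemma Rm_xi:
  assumes "vf Y" "vf Z" "vf W"
  shows "Rm Y Z \<xi> W x = \<alpha>\<^sup>2 * (et Z x * ip Y W x - et Y x * ip Z W x)"
proof -
  have "Rm Y Z \<xi> W x = - \<alpha> * ip (N Y (ph Z)) W x + \<alpha> * ip (N Z (ph Y)) W x + \<alpha> * ip (ph (lie_bracket Y Z)) W x"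
    using assms by (simp add: Rm_def N_xi0)
  also have "ip (ph (lie_bracket Y Z)) W x = - ip (N Y Z) (ph W) x + ip (N Z Y) (ph W) x"
    using assms ip_ph_skew[of "lie_bracket Y Z" W x] by (simp add: ip_bracket)
  finally show ?thesis
    using assms ip_commute[of Y Z x] by (simp add: ip_N_ph0 power2_eq_square algebra_simps)
qed

lemma unit_frame_expand:
  assumes "hor U" "ip U U x = 1" "vf Y"
  shows "Y x = vadd (smul (\<lambda>_. ip Y U x) U) (vadd (smul (\<lambda>_. ip Y (ph U) x) (ph U)) (smul (\<lambda>_. et Y x) \<xi>)) x"
  using fun_cong[OF hor_frame[OF assms(1,3)], of x] assms(2) by (simp add: vadd_def smul_def)

text \<open>
  The sectional curvature of the contact plane.
\<close>
definition sec :: "'m \<Rightarrow> real" where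
  "sec x = Rm (unit_at x) (ph (unit_at x)) (ph (unit_at x)) (unit_at x) x"

text \<open>
  The contact plane is two-dimensional and \<open>R(E, \<phi>E)\<close> annihilates \<open>\<xi>\<close>, so a single number determines
  \<open>R(E, \<phi>E)\<close>.
\<close>
lemma Rm_horizontal:
  assumes E: "hor E" and Y: "vf Y" and Z: "vf Z"
  shows "Rm E (ph E) Y Z x = sec x * ip E E x * ip (ph Z) Y x"
proof -
  define U where "U = unit_at x"
  note U = unit_at[of x, folded U_def]
  have K: "Rm U (ph U) (ph U) U x = sec x" by (simp add: sec_def U_def)
  have K': "Rm U (ph U) U (ph U) x = - sec x"
    using K Rm_skew34[of U "ph U" U "ph U" x] U by simp
  have z: "Rm U (ph U) U U x = 0" "Rm U (ph U) (ph U) (ph U) x = 0"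
    using Rm_skew34[of U "ph U" U U x] Rm_skew34[of U "ph U" "ph U" "ph U" x] U by auto
  have xi: "Rm U (ph U) \<xi> W x = 0" "Rm U (ph U) W \<xi> x = 0" if "vf W" for W
    using Rm_xi[of U "ph U" W x] Rm_skew34[of U "ph U" \<xi> W x] U that by auto
  define exp where "exp Y = vadd (smul (\<lambda>_. ip Y U x) U) (vadd (smul (\<lambda>_. ip Y (ph U) x) (ph U)) (smul (\<lambda>_. et Y x) \<xi>))" for Y
  have ve: "vf (exp Y)" "Y x = exp Y x" if "vf Y" for Y
    unfolding exp_def using unit_frame_expand[OF U that] U by auto
  have cU: "Rm U (ph U) Y Z x = sec x * (ip Z U x * ip Y (ph U) x - ip Z (ph U) x * ip Y U x)"
  proof -
    have "Rm U (ph U) Y Z x = Rm U (ph U) (exp Y) (exp Z) x"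
      by (rule Rm_cong) (use ve Y Z U in auto)
    also have "\<dots> = sec x * (ip Z U x * ip Y (ph U) x - ip Z (ph U) x * ip Y U x)"
      unfolding exp_def using Y Z U by (simp add: K K' z xi) (simp add: algebra_simps)
    finally show ?thesis .
  qed
  have w: "ip (ph Z) Y x = ip Z U x * ip Y (ph U) x - ip Z (ph U) x * ip Y U x"
  proof -
    have "ip (ph Z) Y x = ip (ph (exp Z)) (exp Y) x"
      using ve[OF Z] ve[OF Y] by (simp add: ip_def ph_def)
    also have "\<dots> = ip Z U x * ip Y (ph U) x - ip Z (ph U) x * ip Y U x"
      unfolding exp_def using Y Z U by simp
    finally show ?thesis .
  qed
  have n: "ip E E x = (ip E U x)\<^sup>2 + (ip E (ph U) x)\<^sup>2"
  proof -
    have "ip E E x = ip (exp E) (exp E) x" using ve[of E] E by (simp add: ip_def)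
    also have "\<dots> = (ip E U x)\<^sup>2 + (ip E (ph U) x)\<^sup>2"
      unfolding exp_def using E U by (simp add: power2_eq_square)
    finally show ?thesis .
  qed
  have s: "Rm (ph U) U Y Z x = - Rm U (ph U) Y Z x" "Rm U U Y Z x = 0" "Rm (ph U) (ph U) Y Z x = 0"
    using Rm_skew12[of U "ph U" Y Z x] Rm_skew12[of U U Y Z x] Rm_skew12[of "ph U" "ph U" Y Z x] U Y Z by auto
  define E' where "E' = vadd (smul (\<lambda>_. ip E U x) U) (smul (\<lambda>_. ip E (ph U) x) (ph U))"
  have E': "vf E'" "E x = E' x"
    using ve(2)[of E] E U by (simp add: E'_def) (use ve(2)[of E] E in \<open>simp add: E'_def exp_def vadd_def smul_def\<close>)
  have pE: "ph E x = ph E' x" using E' by (simp add: ph_def)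
  have "Rm E (ph E) Y Z x = Rm E' (ph E') Y Z x"
    by (rule Rm_cong) (use E' pE E Y Z in auto)
  also have "\<dots> = ((ip E U x)\<^sup>2 + (ip E (ph U) x)\<^sup>2) * Rm U (ph U) Y Z x"
    unfolding E'_def using U Y Z E by (simp add: s) (simp add: power2_eq_square algebra_simps)
  finally show ?thesis unfolding n cU w by (simp add: algebra_simps)
qed


lemma sm_sec [simp, intro]: "sm sec"
proof (rule smooth_fun_quotient[OF manifold])
  fix x
  obtain E where E: "hor E" "ip E E x = 1" using hor_unit_exists .
  have v: "vf E" "vf (ph E)" using E by auto
  let ?P = "\<lambda>y. Rm E (ph E) (ph E) E y"
  have "sec y * (ip E E y * ip E E y) = ?P y" for y
    using Rm_horizontal[OF E(1) v(2,1), of y] E by simp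
  moreover have "sm ?P" unfolding Rm_def using v by (intro sm_diff sm_ip vf_N vf_bracket)
  moreover have "sm (\<lambda>y. ip E E y * ip E E y)" using v by auto
  ultimately show "\<exists>N P. sm N \<and> sm P \<and> N x \<noteq> 0 \<and> (\<forall>y. sec y * N y = P y)"
    using E by (intro exI[of _ "\<lambda>y. ip E E y * ip E E y"] exI[of _ ?P]) auto
qed

lemma curvature_at_eq:
  assumes "vf X" "vf Y" "vf Z"
  shows "curvature_at A N x (X x) (Y x) (Z x) = curvature N X Y Z x"
proof -
  have e: "vf (extension A x (X x))" "extension A x (X x) x = X x" if "vf X" for X
    unfolding extension_def using someI_ex[of "\<lambda>Y. vf Y \<and> Y x = X x"] that by blast+
  show ?thesis unfolding curvature_at_def
  proof (rule ip_eqI[where Y = "curvature N X Y Z" and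
        X = "curvature N (extension A x (X x)) (extension A x (Y x)) (extension A x (Z x))"])
    fix W assume W: "vf W"
    show "ip (curvature N (extension A x (X x)) (extension A x (Y x)) (extension A x (Z x))) W x = ip (curvature N X Y Z) W x"
      using W assms by (simp add: ip_curvature e) (rule Rm_cong; simp add: e)
  qed (use assms e in auto)
qed

lemma basis_finite: "basis_of (T x) B \<Longrightarrow> finite B \<and> card B = 3 \<and> B \<subseteq> T x"
proof -
  assume B: "basis_of (T x) B"
  obtain C where C: "finite C" "card C = DIM(real ^ 3)" "basis_of (T x) C"
    using tangent_space_basis[OF manifold] by blast
  have s: "B \<subseteq> span C" "C \<subseteq> span B" using B C span_superset unfolding basis_of_def by blast+
  have "finite B \<and> card B \<le> card C" using independent_span_bound[OF C(1) _ s(1)] B by (simp add: basis_of_def)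
  moreover have "card C \<le> card B" using independent_span_bound[OF _ _ s(2)] C B calculation by (simp add: basis_of_def)
  moreover have "B \<subseteq> T x" using B span_superset unfolding basis_of_def by blast
  ultimately show ?thesis using C(2) by simp
qed

text \<open>
  The trace is defined by an unspecified basis.  Expanding both that basis in the frame and the frame
  in that basis shows that it is the sum of diagonal entries in the adapted frame.
\<close>
lemma trace_frame:
  assumes U: "hor U" "ip U U x = 1"
    and L: "linear_within (T x) L" "\<And>v. v \<in> T x \<Longrightarrow> L v \<in> T x"
  shows "trace_on (T x) L = g x (L (U x)) (U x) + g x (L (ph U x)) (ph U x) + g x (L (\<xi> x)) (\<xi> x)"
proof -
  define B where "B = (SOME B. basis_of (T x) B)"
  have B: "basis_of (T x) B" unfolding B_def using tangent_space_basis[OF manifold] someI_ex by metis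
  note fB = basis_finite[OF B]
  have ind: "independent B" and sp: "span B = T x" using B by (simp_all add: basis_of_def)
  have exp: "v = g x v (U x) *\<^sub>R U x + (g x v (ph U x) *\<^sub>R ph U x + g x v (\<xi> x) *\<^sub>R \<xi> x)" if v: "v \<in> T x" for v
  proof -
    obtain Y where Y: "vf Y" "Y x = v" using extension[OF v] .
    have "et Y x = g x v (\<xi> x)" using ip_xi(1)[OF Y(1), of x] Y(2) by (simp add: ip_def)
    then show ?thesis using unit_frame_expand[OF U Y(1)] Y(2) by (simp add: vadd_def smul_def ip_def)
  qed
  have mem: "U x \<in> span B" "ph U x \<in> span B" "\<xi> x \<in> span B" using sp U by auto
  have rep: "representation B v b = g x v (U x) * representation B (U x) b
      + (g x v (ph U x) * representation B (ph U x) b + g x v (\<xi> x) * representation B (\<xi> x) b)"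
    if "v \<in> T x" for v b
    by (subst exp[OF that])
       (simp only: representation_add[OF ind] representation_scale[OF ind] mem span_scale span_add)
  \<comment> \<open>Each frame vector is recovered from its coordinates in the basis.\<close>
  have s: "(\<Sum>b\<in>B. representation B e b * g x (L b) e) = g x (L e) e" if e: "e \<in> T x" for e
  proof -
    have l: "linear_within (T x) (\<lambda>v. g x (L v) e)"
      using L e g_linear(3,4) unfolding linear_within_def by (metis T_closed(3) real_scaleR_def)
    have "(\<Sum>b\<in>B. representation B e b *\<^sub>R b) = e"
      by (rule sum_representation_eq[OF ind]) (use e sp fB in auto)
    then show ?thesis
      using linear_within_sum[OF l, of B "representation B e"] fB by metis
  qed
  have "trace_on (T x) L = (\<Sum>b\<in>B. representation B (L b) b)"
    unfolding trace_on_def B_def by (simp only: Let_def)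
  also have "\<dots> = (\<Sum>b\<in>B. representation B (U x) b * g x (L b) (U x)
      + (representation B (ph U x) b * g x (L b) (ph U x) + representation B (\<xi> x) b * g x (L b) (\<xi> x)))"
  proof (rule sum.cong[OF refl])
    fix b assume "b \<in> B"
    then have "L b \<in> T x" using L(2) fB by blast
    from rep[OF this] show "representation B (L b) b = representation B (U x) b * g x (L b) (U x)
      + (representation B (ph U x) b * g x (L b) (ph U x) + representation B (\<xi> x) b * g x (L b) (\<xi> x))"
      by (simp only: mult.commute)
  qed
  also have "\<dots> = g x (L (U x)) (U x) + (g x (L (ph U x)) (ph U x) + g x (L (\<xi> x)) (\<xi> x))"
    using s mem sp by (simp only: sum.distrib)
  finally show ?thesis by simp
qed


lemma curvature_at_tangent [simp, intro]:
  assumes "u \<in> T x" "v \<in> T x" "w \<in> T x" shows "curvature_at A N x u v w \<in> T x"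
proof -
  obtain X where X: "vf X" "X x = u" using extension[OF assms(1)] .
  obtain Y where Y: "vf Y" "Y x = v" using extension[OF assms(2)] .
  obtain Z where Z: "vf Z" "Z x = w" using extension[OF assms(3)] .
  show ?thesis
    using vf_tangent[OF curvature_vf[OF X(1) Y(1) Z(1)], of x] curvature_at_eq[OF X(1) Y(1) Z(1), of x] X Y Z
    by simp
qed

lemma curvature_linear:
  assumes "vf X" "vf Y" "vf Z" "vf Z'"
  shows "curvature N X Y (vadd Z Z') x = curvature N X Y Z x + curvature N X Y Z' x"
    "curvature N X Y (smul (\<lambda>_. a) Z) x = a *\<^sub>R curvature N X Y Z x"
    "curvature N (vadd Z Z') X Y x = curvature N Z X Y x + curvature N Z' X Y x"
    "curvature N (smul (\<lambda>_. a) Z) X Y x = a *\<^sub>R curvature N Z X Y x"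
proof -
  have "curvature N X Y (vadd Z Z') x = vadd (curvature N X Y Z) (curvature N X Y Z') x"
    by (rule ip_eqI[where X = "curvature N X Y (vadd Z Z')" and Y = "vadd (curvature N X Y Z) (curvature N X Y Z')"]) (use assms in \<open>auto simp: ip_curvature\<close>)
  moreover have "curvature N X Y (smul (\<lambda>_. a) Z) x = smul (\<lambda>_. a) (curvature N X Y Z) x"
    by (rule ip_eqI[where X = "curvature N X Y (smul (\<lambda>_. a) Z)" and Y = "smul (\<lambda>_. a) (curvature N X Y Z)"]) (use assms in \<open>auto simp: ip_curvature\<close>)
  moreover have "curvature N (vadd Z Z') X Y x = vadd (curvature N Z X Y) (curvature N Z' X Y) x"
    by (rule ip_eqI[where X = "curvature N (vadd Z Z') X Y" and Y = "vadd (curvature N Z X Y) (curvature N Z' X Y)"]) (use assms in \<open>auto simp: ip_curvature\<close>)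
  moreover have "curvature N (smul (\<lambda>_. a) Z) X Y x = smul (\<lambda>_. a) (curvature N Z X Y) x"
    by (rule ip_eqI[where X = "curvature N (smul (\<lambda>_. a) Z) X Y" and Y = "smul (\<lambda>_. a) (curvature N Z X Y)"]) (use assms in \<open>auto simp: ip_curvature\<close>)
  ultimately show "curvature N X Y (vadd Z Z') x = curvature N X Y Z x + curvature N X Y Z' x"
    "curvature N X Y (smul (\<lambda>_. a) Z) x = a *\<^sub>R curvature N X Y Z x"
    "curvature N (vadd Z Z') X Y x = curvature N Z X Y x + curvature N Z' X Y x"
    "curvature N (smul (\<lambda>_. a) Z) X Y x = a *\<^sub>R curvature N Z X Y x"
    by (simp_all only: vadd_def smul_def)
qed

lemma curvature_at_linear:
  assumes "u \<in> T x" "v \<in> T x"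
  shows "linear_within (T x) (\<lambda>w. curvature_at A N x u v w)"
    "linear_within (T x) (\<lambda>w. curvature_at A N x w u v)"
proof -
  obtain X where X: "vf X" "X x = u" using extension[OF assms(1)] .
  obtain Y where Y: "vf Y" "Y x = v" using extension[OF assms(2)] .
  have "curvature_at A N x u v (w + w') = curvature_at A N x u v w + curvature_at A N x u v w'
     \<and> curvature_at A N x (w + w') u v = curvature_at A N x w u v + curvature_at A N x w' u v"
    if w: "w \<in> T x" and w': "w' \<in> T x" for w w'
  proof -
    obtain Z where Z: "vf Z" "Z x = w" using extension[OF w] .
    obtain Z' where Z': "vf Z'" "Z' x = w'" using extension[OF w'] .
    have e: "w + w' = vadd Z Z' x" by (simp only: vadd_def Z Z')
    show ?thesis
      unfolding e unfolding X(2)[symmetric] Y(2)[symmetric] Z(2)[symmetric] Z'(2)[symmetric]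
      using X(1) Y(1) Z(1) Z'(1) curvature_linear[OF X(1) Y(1) Z(1) Z'(1)]
      by (simp only: curvature_at_eq vf_vadd simp_thms)
  qed
  moreover have "curvature_at A N x u v (a *\<^sub>R w) = a *\<^sub>R curvature_at A N x u v w
     \<and> curvature_at A N x (a *\<^sub>R w) u v = a *\<^sub>R curvature_at A N x w u v"
    if w: "w \<in> T x" for w a
  proof -
    obtain Z where Z: "vf Z" "Z x = w" using extension[OF w] .
    have e: "a *\<^sub>R w = smul (\<lambda>_. a) Z x" by (simp only: smul_def Z)
    show ?thesis
      unfolding e unfolding X(2)[symmetric] Y(2)[symmetric] Z(2)[symmetric]
      using X(1) Y(1) Z(1) curvature_linear[OF X(1) Y(1) Z(1) Z(1)]
      by (simp only: curvature_at_eq vf_smul sm_closed simp_thms)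
  qed
  ultimately show "linear_within (T x) (\<lambda>w. curvature_at A N x u v w)"
    "linear_within (T x) (\<lambda>w. curvature_at A N x w u v)"
    unfolding linear_within_def by blast+
qed

lemma star_ricci_eq:
  assumes "vf X" "vf Y"
  shows "star_ricci A \<phi> N x (X x) (Y x) = sec x * (ip X Y x - et X x * et Y x)"
proof -
  obtain U where U: "hor U" "ip U U x = 1" using hor_unit_exists .
  define L where "L u = \<phi> x (curvature_at A N x (X x) (\<phi> x (Y x)) u)" for u
  have Lf: "L (Z x) = ph (curvature N X (ph Y) Z) x" if "vf Z" for Z
    using curvature_at_eq[OF assms(1) vf_ph[OF assms(2)] that, of x] by (simp add: L_def ph_def)
  have "linear_within (T x) L"
    unfolding linear_within_def
  proof (intro conjI ballI allI)
    let ?c = "curvature_at A N x (X x) (\<phi> x (Y x))"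
    have l: "linear_within (T x) ?c"
      by (rule curvature_at_linear(1)) (use assms in auto)
    fix v assume v: "v \<in> T x"
    have cT: "?c w \<in> T x" if "w \<in> T x" for w
      using assms that by auto
    show "L (a *\<^sub>R v) = a *\<^sub>R L v" for a
    proof -
      have "?c (a *\<^sub>R v) = a *\<^sub>R ?c v" using l v unfolding linear_within_def by blast
      then show ?thesis unfolding L_def by (simp only: phi_linear(2)[OF cT[OF v]])
    qed
    fix w assume w: "w \<in> T x"
    have "?c (v + w) = ?c v + ?c w" using l v w unfolding linear_within_def by blast
    then show "L (v + w) = L v + L w" unfolding L_def by (simp only: phi_linear(1)[OF cT[OF v] cT[OF w]])
  qed
  then have "trace_on (T x) L = g x (L (U x)) (U x) + g x (L (ph U x)) (ph U x) + g x (L (\<xi> x)) (\<xi> x)"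
    by (rule trace_frame[OF U]) (use assms in \<open>auto simp: L_def\<close>)
  also have "\<dots> = ip (ph (curvature N X (ph Y) U)) U x + ip (ph (curvature N X (ph Y) (ph U))) (ph U) x
      + ip (ph (curvature N X (ph Y) \<xi>)) \<xi> x"
    using U by (simp add: Lf ip_def)
  also have "\<dots> = - 2 * Rm U (ph U) X (ph Y) x"
  proof -
    have "ip (ph (curvature N X (ph Y) U)) U x = - Rm X (ph Y) U (ph U) x"
      using ip_ph_skew[of "curvature N X (ph Y) U" U x] assms U by (simp add: ip_curvature)
    moreover have "ip (ph (curvature N X (ph Y) (ph U))) (ph U) x = Rm X (ph Y) (ph U) U x"
      using assms U by (simp add: ip_curvature)
    moreover have "Rm X (ph Y) (ph U) U x = - Rm X (ph Y) U (ph U) x"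
      using Rm_skew34[of X "ph Y" U "ph U" x] assms U by simp
    ultimately show ?thesis
      using Rm_pair[of X "ph Y" U "ph U" x] assms U by simp
  qed
  also have "Rm U (ph U) X (ph Y) x = - sec x * (ip X Y x - et X x * et Y x)"
    using Rm_horizontal[OF U(1) assms(1) vf_ph[OF assms(2)], of x] U assms ip_commute[of X Y x] by (simp add: algebra_simps)
  finally show ?thesis unfolding star_ricci_def L_def[symmetric] by simp
qed

lemma ricci_eq:
  assumes X: "vf X"
  shows "ricci A N x (X x) (X x) = (sec x + \<alpha>\<^sup>2) * ip X X x + (\<alpha>\<^sup>2 - sec x) * (et X x)\<^sup>2"
proof -
  obtain U where U: "hor U" "ip U U x = 1" using hor_unit_exists .
  let ?F = "ph U"
  define L where "L u = curvature_at A N x u (X x) (X x)" for u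
  have Lf: "L (Z x) = curvature N Z X X x" if "vf Z" for Z
    using curvature_at_eq that X by (simp add: L_def)
  have e: "g x (L (Z x)) (Z x) = Rm Z X X Z x" if "vf Z" for Z
    using Lf[OF that] ip_curvature[OF that X X that, of x] by (simp add: ip_def)
  have "linear_within (T x) L"
    using curvature_at_linear(2)[of "X x" x "X x"] X unfolding L_def by simp
  then have "trace_on (T x) L = g x (L (U x)) (U x) + g x (L (ph U x)) (ph U x) + g x (L (\<xi> x)) (\<xi> x)"
    by (rule trace_frame[OF U]) (use X in \<open>auto simp: L_def\<close>)
  also have "\<dots> = Rm U X X U x + Rm ?F X X ?F x + Rm \<xi> X X \<xi> x"
    using e[of U] e[of "ph U"] e[of \<xi>] U by simp
  also have "\<dots> = (sec x + \<alpha>\<^sup>2) * ip X X x + (\<alpha>\<^sup>2 - sec x) * (et X x)\<^sup>2"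
  proof -
    define X' where "X' = vadd (smul (\<lambda>_. ip X U x) U) (vadd (smul (\<lambda>_. ip X (ph U) x) (ph U)) (smul (\<lambda>_. et X x) \<xi>))"
    have X': "vf X'" "X x = X' x" unfolding X'_def using unit_frame_expand[OF U X] U by auto
    have 1: "Rm U \<xi> X U x = \<alpha>\<^sup>2 * et X x"
      using Rm_pair[of U \<xi> X U x] Rm_skew34[of X U \<xi> U x] Rm_xi[of X U U x] U X by simp
    have 2: "Rm ?F \<xi> X ?F x = \<alpha>\<^sup>2 * et X x"
      using Rm_pair[of ?F \<xi> X ?F x] Rm_skew34[of X ?F \<xi> ?F x] Rm_xi[of X ?F ?F x] U X by simp
    have 3: "Rm \<xi> X X \<xi> x = \<alpha>\<^sup>2 * (ip X X x - (et X x)\<^sup>2)"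
      using Rm_skew12[of X \<xi> X \<xi> x] Rm_skew34[of X \<xi> X \<xi> x] Rm_xi[of X \<xi> X x] X
      by (simp add: power2_eq_square)
    have 4: "Rm U ?F X U x = sec x * ip X ?F x" "Rm ?F U X ?F x = sec x * ip X U x"
      using Rm_horizontal[OF U(1) X, of U x] Rm_horizontal[OF U(1) X, of ?F x]
        Rm_skew12[of U ?F X ?F x] U X ip_commute[of X ?F x] ip_commute[of X U x] by simp_all
    have 5: "Rm U U X U x = 0" "Rm ?F ?F X ?F x = 0"
      using Rm_skew12[of U U X U x] Rm_skew12[of ?F ?F X ?F x] U X by auto
    have a: "Rm U X X U x = ip X ?F x * (sec x * ip X ?F x) + et X x * (\<alpha>\<^sup>2 * et X x)"
    proof -
      have "Rm U X X U x = Rm U X' X U x" by (rule Rm_cong) (use X' X U in auto)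
      also have "\<dots> = ip X ?F x * (sec x * ip X ?F x) + et X x * (\<alpha>\<^sup>2 * et X x)"
        unfolding X'_def using U X by (simp add: 1 4 5)
      finally show ?thesis .
    qed
    have b: "Rm ?F X X ?F x = ip X U x * (sec x * ip X U x) + et X x * (\<alpha>\<^sup>2 * et X x)"
    proof -
      have "Rm ?F X X ?F x = Rm ?F X' X ?F x" by (rule Rm_cong) (use X' X U in auto)
      also have "\<dots> = ip X U x * (sec x * ip X U x) + et X x * (\<alpha>\<^sup>2 * et X x)"
        unfolding X'_def using U X by (simp add: 2 4 5)
      finally show ?thesis .
    qed
    have n: "ip X X x = ip X U x * ip X U x + ip X ?F x * ip X ?F x + et X x * et X x"
    proof -
      have "ip X X x = ip X' X x" using X' by (simp add: ip_def)
      also have "\<dots> = ip X U x * ip X U x + ip X ?F x * ip X ?F x + et X x * et X x"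
        unfolding X'_def using U X ip_commute[of X U x] ip_commute[of X ?F x] by simp
      finally show ?thesis .
    qed
    show ?thesis unfolding a b 3 n by (simp add: power2_eq_square algebra_simps)
  qed
  finally show ?thesis unfolding ricci_def L_def[symmetric] .
qed

text \<open>
  By \<open>ricci_eq\<close> the sum over any orthonormal basis needs only its cardinality and \<open>\<Sum> \<eta>(b)\<^sup>2 = 1\<close>, which is
  Parseval's identity for \<open>\<xi>\<close>.
\<close>
lemma scalar_curvature_eq: "scalar_curvature A g N x = 2 * sec x + 4 * \<alpha>\<^sup>2"
proof -
  obtain U where U: "hor U" "ip U U x = 1" using hor_unit_exists .
  define B where "B = (SOME B. orthonormal_basis_at A g x B)"
  have ex: "orthonormal_basis_at A g x {U x, ph U x, \<xi> x}"
  proof -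
    have gs: "g x (U x) (U x) = 1" "g x (ph U x) (ph U x) = 1" "g x (\<xi> x) (\<xi> x) = 1"
      "g x (U x) (ph U x) = 0" "g x (ph U x) (U x) = 0" "g x (U x) (\<xi> x) = 0" "g x (\<xi> x) (U x) = 0"
      "g x (ph U x) (\<xi> x) = 0" "g x (\<xi> x) (ph U x) = 0"
      using U ip_ph_ph[of U U x] ip_xi[of U x] ip_xi[of "ph U" x] ip_xi[of \<xi> x] ip_ph_self[of U x]
      by (simp_all add: ip_def del: ip_ph_ph ip_xi ip_ph_self)
    have d: "U x \<noteq> ph U x" "U x \<noteq> \<xi> x" "ph U x \<noteq> \<xi> x" using gs by (metis zero_neq_one)+
    have T3: "U x \<in> T x" "ph U x \<in> T x" "\<xi> x \<in> T x" using U by auto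
    have nz: "U x \<noteq> 0" "ph U x \<noteq> 0" "\<xi> x \<noteq> 0" using gs g_zero(1)[OF T_closed(1), of x] by (metis zero_neq_one)+
    have ind: "independent {U x, ph U x, \<xi> x}"
      by (rule orthogonal_independent[of _ x]) (use gs T3 nz in auto)
    have "span {U x, ph U x, \<xi> x} = T x"
    proof
      show "span {U x, ph U x, \<xi> x} \<subseteq> T x"
        by (rule span_minimal) (use T3 subspace_tangent_space[OF manifold] in auto)
      show "T x \<subseteq> span {U x, ph U x, \<xi> x}"
      proof
        fix v assume v: "v \<in> T x"
        obtain Y where Y: "vf Y" "Y x = v" using extension[OF v] .
        have "v = ip Y U x *\<^sub>R U x + (ip Y (ph U) x *\<^sub>R ph U x + et Y x *\<^sub>R \<xi> x)"
          using unit_frame_expand[OF U Y(1)] Y(2) by (simp only: vadd_def smul_def)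
        also have "\<dots> \<in> span {U x, ph U x, \<xi> x}"
          by (intro span_add span_scale span_base) auto
        finally show "v \<in> span {U x, ph U x, \<xi> x}" .
      qed
    qed
    then show ?thesis using ind gs d by (simp add: orthonormal_basis_at_def basis_of_def)
  qed
  then have oB: "orthonormal_basis_at A g x B" unfolding B_def by (rule someI)
  then have B: "basis_of (T x) B" and o: "\<And>u v. u \<in> B \<Longrightarrow> v \<in> B \<Longrightarrow> g x u v = (if u = v then 1 else 0)"
    by (auto simp: orthonormal_basis_at_def)
  note fB = basis_finite[OF B]
  have ind: "independent B" and sp: "span B = T x" using B by (simp_all add: basis_of_def)
  have xi: "\<xi> x \<in> T x" by auto
  have "(\<Sum>b\<in>B. (\<eta> x b)\<^sup>2) = 1"
  proof -
    define k where "k = representation B (\<xi> x)"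
    have e: "(\<Sum>b\<in>B. k b *\<^sub>R b) = \<xi> x"
      unfolding k_def by (rule sum_representation_eq[OF ind]) (use xi sp fB in auto)
    have ls: "g x v (\<xi> x) = (\<Sum>b\<in>B. k b * g x v b)" if "v \<in> T x" for v
      using linear_within_sum[OF g_linear_within[OF that], of B k] fB e by metis
    have eta: "\<eta> x b = g x b (\<xi> x)" "g x (\<xi> x) b = \<eta> x b" if b: "b \<in> T x" for b
    proof -
      obtain Y where Y: "vf Y" "Y x = b" using extension[OF b] .
      show "\<eta> x b = g x b (\<xi> x)" "g x (\<xi> x) b = \<eta> x b" using ip_xi[OF Y(1), of x] Y(2) by (auto simp: ip_def et_def)
    qed
    have kb: "\<eta> x b = k b" if b: "b \<in> B" for b
    proof -
      have bT: "b \<in> T x" using b fB by blast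
      have "\<eta> x b = (\<Sum>c\<in>B. k c * g x b c)" using eta(1)[OF bT] ls[OF bT] by simp
      also have "\<dots> = (\<Sum>c\<in>B. if c = b then k b else 0)"
        by (rule sum.cong) (use o b in auto)
      also have "\<dots> = k b" using b fB by simp
      finally show ?thesis .
    qed
    have "1 = g x (\<xi> x) (\<xi> x)" using ip_xi(1)[OF vf_xi, of x] by (simp add: ip_def)
    also have "\<dots> = (\<Sum>b\<in>B. k b * g x (\<xi> x) b)" using ls[OF xi] .
    also have "\<dots> = (\<Sum>b\<in>B. (\<eta> x b)\<^sup>2)"
    proof (rule sum.cong[OF refl])
      fix b assume b: "b \<in> B"
      then have "b \<in> T x" using fB by blast
      then show "k b * g x (\<xi> x) b = (\<eta> x b)\<^sup>2" using kb[OF b] eta(2) by (simp add: power2_eq_square)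
    qed
    finally show ?thesis by simp
  qed
  moreover have "ricci A N x b b = (sec x + \<alpha>\<^sup>2) + (\<alpha>\<^sup>2 - sec x) * (\<eta> x b)\<^sup>2" if b: "b \<in> B" for b
  proof -
    have "b \<in> T x" using b fB by blast
    then obtain Y where Y: "vf Y" "Y x = b" using extension by blast
    show ?thesis using ricci_eq[OF Y(1), of x] Y(2) o[OF b b] by (simp add: ip_def et_def)
  qed
  ultimately have "(\<Sum>b\<in>B. ricci A N x b b) = 3 * (sec x + \<alpha>\<^sup>2) + (\<alpha>\<^sup>2 - sec x)"
    using fB by (simp add: sum.distrib flip: sum_distrib_left)
  then show ?thesis unfolding scalar_curvature_def B_def[symmetric] by (simp add: Let_def)
qed


section \<open>The Reeb field as an infinitesimal automorphism\<close>

abbreviation lx :: "'m vfield \<Rightarrow> 'm vfield" where "lx \<equiv> lie_bracket \<xi>"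

lemma et_bracket:
  assumes "vf X" "vf Y"
  shows "et (lie_bracket X Y) x = D X (et Y) x - D Y (et X) x + 2 * \<alpha> * ip (ph X) Y x"
proof -
  have "et (lie_bracket X Y) x = et (N X Y) x - et (N Y X) x"
    using assms by (simp add: torsion_free)
  moreover have "ip (ph Y) X x = - ip (ph X) Y x"
    using ip_ph_skew[of X Y x] ip_commute[of X "ph Y" x] assms by simp
  ultimately show ?thesis using assms by (simp add: et_N0)
qed

lemma et_lx: "vf X \<Longrightarrow> et (lx X) = D \<xi> (et X)"
proof
  fix x assume "vf X"
  then show "et (lx X) x = D \<xi> (et X) x" using et_bracket[of \<xi> X x] by simp
qed

lemma hor_lx [simp, intro]: "hor X \<Longrightarrow> hor (lx X)"
proof -
  assume X: "hor X"
  have "et (lx X) x = 0" for x using et_lx[of X] X by simp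
  then show "hor (lx X)" using X unfolding hor_def[of "lx X"] by auto
qed

lemma lx_N: "vf X \<Longrightarrow> lx X = vadd (N \<xi> X) (smul (\<lambda>_. \<alpha>) (ph X))"
  by (simp add: torsion_free N_xi0) (simp add: vadd_def smul_def)

text \<open>
  The covariant derivative of \<open>\<xi>\<close> is a multiple of \<open>\<phi>\<close>, which is skew; so \<open>\<xi>\<close> is a Killing field.
\<close>
lemma D_xi_ip:
  assumes "vf X" "vf Y"
  shows "D \<xi> (ip X Y) x = ip (lx X) Y x + ip X (lx Y) x"
  using assms ip_ph_skew[of X Y x] by (simp add: lx_N D_ip)

lemma lx_linear [simp]:
  assumes "vf X"
  shows "vf Y \<Longrightarrow> lx (vadd X Y) = vadd (lx X) (lx Y)"
    "sm h \<Longrightarrow> lx (smul h X) = vadd (smul (D \<xi> h) X) (smul h (lx X))"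
proof -
  show "lx (vadd X Y) = vadd (lx X) (lx Y)" if "vf Y"
    using assms that by (auto simp: lx_N) (simp add: vadd_def smul_def algebra_simps)
  show "lx (smul h X) = vadd (smul (D \<xi> h) X) (smul h (lx X))" if "sm h"
    using assms that by (auto simp: lx_N) (simp add: vadd_def smul_def algebra_simps)
qed

lemma D_const_fun [simp]: "vf X \<Longrightarrow> D X (\<lambda>_. a) = (\<lambda>_. 0)"
  by auto

lemma vadd_smul_zero [simp]: "vadd (smul (\<lambda>_. 0) X) Y = Y" "vadd Y (smul (\<lambda>_. 0) X) = Y"
  by (simp_all add: vadd_def smul_def)

lemma lx_ph [simp]:
  assumes "vf X" shows "lx (ph X) = ph (lx X)"
proof
  fix x
  show "lx (ph X) x = ph (lx X) x"
  proof (rule ip_eqI[where X = "lx (ph X)" and Y = "ph (lx X)"])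
    fix Z assume Z: "vf Z"
    have "ip (lx (ph X)) Z x = - ip (N \<xi> X) (ph Z) x + \<alpha> * ip (ph (ph X)) Z x"
      using assms Z by (simp add: lx_N ip_N_ph0)
    also have "\<alpha> * ip (ph (ph X)) Z x = - \<alpha> * ip (ph X) (ph Z) x"
      using ip_ph_skew[of "ph X" Z x] assms Z by (simp del: ip_ph_ph ph_ph)
    also have "- ip (N \<xi> X) (ph Z) x + - \<alpha> * ip (ph X) (ph Z) x = - ip (lx X) (ph Z) x"
      using assms Z by (simp add: lx_N del: ip_ph_ph)
    also have "\<dots> = ip (ph (lx X)) Z x" using ip_ph_skew[of "lx X" Z x] assms Z by simp
    finally show "ip (lx (ph X)) Z x = ip (ph (lx X)) Z x" .
  qed (use assms in auto)
qed

text \<open>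
  A Killing field preserves the connection.  Here the difference of the two sides is
  \<open>R(\<xi>, Y)X - \<alpha> (\<nabla>\<^sub>Y \<phi>)X\<close>, which vanishes by the formula for the curvature in the direction of \<open>\<xi>\<close>.
\<close>
lemma lx_connection:
  assumes "vf X" "vf Y"
  shows "lx (N Y X) = vadd (N (lx Y) X) (N Y (lx X))"
proof
  fix x
  show "lx (N Y X) x = vadd (N (lx Y) X) (N Y (lx X)) x"
  proof (rule ip_eqI[where X = "lx (N Y X)" and Y = "vadd (N (lx Y) X) (N Y (lx X))"])
    fix W assume W: "vf W"
    have "ip (lx (N Y X)) W x - ip (N (lx Y) X) W x - ip (N Y (lx X)) W x
      = Rm \<xi> Y X W x + \<alpha> * ip (ph (N Y X)) W x - \<alpha> * ip (N Y (ph X)) W x"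
      using assms W lx_N[of X] lx_N[of "N Y X"] by (simp add: Rm_def del: lx_linear)
    also have "\<alpha> * ip (ph (N Y X)) W x = - \<alpha> * ip (N Y X) (ph W) x"
      using ip_ph_skew[of "N Y X" W x] assms W by simp
    also have "Rm \<xi> Y X W x = \<alpha>\<^sup>2 * (et W x * ip X Y x - et X x * ip W Y x)"
      using Rm_pair[of \<xi> Y X W x] Rm_xi[of X W Y x] assms W by simp
    also have "\<dots> + - \<alpha> * ip (N Y X) (ph W) x - \<alpha> * ip (N Y (ph X)) W x = 0"
      using assms W ip_commute[of X Y x] ip_commute[of W Y x]
      by (simp add: ip_N_ph0 power2_eq_square algebra_simps)
    finally show "ip (lx (N Y X)) W x = ip (vadd (N (lx Y) X) (N Y (lx X))) W x"
      using assms W by simp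
  qed (use assms in auto)
qed

lemma lx_bracket:
  assumes "vf X" "vf Y"
  shows "lx (lie_bracket X Y) = vadd (lie_bracket (lx X) Y) (lie_bracket X (lx Y))"
proof -
  have "lx (lie_bracket X Y) = vadd (lx (N X Y)) (smul (\<lambda>_. -1) (lx (N Y X)))"
    using assms by (simp add: torsion_free[of X Y])
  also have "\<dots> = vadd (lie_bracket (lx X) Y) (lie_bracket X (lx Y))"
    using assms by (simp add: lx_connection torsion_free[of "lx X" Y] torsion_free[of X "lx Y"])
      (simp add: vadd_def smul_def algebra_simps)
  finally show ?thesis .
qed

lemma D_xi_Rm:
  assumes "vf X" "vf Y" "vf Z" "vf W"
  shows "D \<xi> (Rm X Y Z W) x = Rm (lx X) Y Z W x + Rm X (lx Y) Z W x + Rm X Y (lx Z) W x + Rm X Y Z (lx W) x"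
proof -
  have "Rm X Y Z W = (\<lambda>x. ip (N X (N Y Z)) W x - ip (N Y (N X Z)) W x - ip (N (lie_bracket X Y) Z) W x)"
    by (auto simp: Rm_def)
  then have "D \<xi> (Rm X Y Z W) x = D \<xi> (ip (N X (N Y Z)) W) x - D \<xi> (ip (N Y (N X Z)) W) x
      - D \<xi> (ip (N (lie_bracket X Y) Z) W) x"
    using assms by (simp del: D_ip)
  then show ?thesis
    using assms by (simp add: D_xi_ip lx_connection lx_bracket Rm_def)
qed

text \<open>
  \<open>\<xi>\<close> preserves metric, \<open>\<phi>\<close> and curvature tensor.
\<close>
lemma D_xi_sec [simp]: "D \<xi> sec = (\<lambda>_. 0)"
proof
  fix x
  obtain E where E: "hor E" "ip E E x = 1" using hor_unit_exists .
  let ?F = "ph E"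
  have v: "vf E" "vf ?F" "vf (lx E)" "vf (lx ?F)" using E by auto
  have f: "Rm E ?F ?F E = (\<lambda>x. sec x * (ip E E x * ip E E x))"
    using Rm_horizontal[OF E(1) v(2,1)] E by auto
  have c: "ip (lx E) E x = ip E (lx E) x" "ip (ph (lx E)) ?F x = ip E (lx E) x"
    using ip_commute[of E "lx E" x] E by auto
  have 1: "Rm (lx E) ?F ?F E x = sec x * ip E (lx E) x"
    using Rm_pair[of "lx E" ?F ?F E x] Rm_skew12[of E ?F "lx E" ?F x] Rm_horizontal[OF E(1) v(3,2), of x] E
    by simp
  have 2: "Rm E (lx ?F) ?F E x = sec x * ip E (lx E) x"
    using Rm_pair[of E "lx ?F" ?F E x] Rm_skew12[of E ?F E "lx ?F" x] Rm_horizontal[OF E(1) v(1,4), of x]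
      E ip_commute[of "lx E" E x]
    by simp
  have 3: "Rm E ?F (lx ?F) E x = sec x * ip E (lx E) x"
    using Rm_horizontal[OF E(1) v(4,1), of x] E by simp
  have 4: "Rm E ?F ?F (lx E) x = sec x * ip E (lx E) x"
    using Rm_horizontal[OF E(1) v(2,3), of x] E c by simp
  have "D \<xi> (Rm E ?F ?F E) x = 4 * (sec x * ip E (lx E) x)"
    using D_xi_Rm[of E ?F ?F E x] v unfolding 1 2 3 4 by simp
  moreover have "D \<xi> (Rm E ?F ?F E) x = D \<xi> sec x + sec x * (4 * ip E (lx E) x)"
    unfolding f using E c by (simp add: D_xi_ip)
  ultimately show "D \<xi> sec x = 0" by simp
qed

section \<open>Horizontal gradients, divergence and rotation\<close>

text \<open>
  \<open>W\<close> is the horizontal gradient of \<open>h\<close>: the orthogonal projection of the gradient to the contact planes.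
\<close>
definition hgrad :: "('m \<Rightarrow> real) \<Rightarrow> 'm vfield \<Rightarrow> bool" where
  "hgrad h W \<longleftrightarrow> sm h \<and> hor W \<and> (\<forall>Z x. hor Z \<longrightarrow> D Z h x = ip W Z x)"

lemma hgradD: assumes "hgrad h W" shows "sm h" "hor W" "vf W" "hor Z \<Longrightarrow> D Z h x = ip W Z x"
  using assms by (auto simp: hgrad_def)

lemma hor_eqI:
  assumes "hor W" "hor W'" "\<And>Z. hor Z \<Longrightarrow> ip W Z x = ip W' Z x"
  shows "W x = W' x"
proof (rule ip_eqI[where X = W and Y = W'])
  fix Z assume Z: "vf Z"
  let ?H = "vadd Z (smul (\<lambda>x. - et Z x) \<xi>)"
  have "hor ?H" using Z by (simp add: hor_def del: hor_vf hor_et)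
  from assms(3)[OF this] show "ip W Z x = ip W' Z x" using assms(1,2) Z by simp
qed (use assms in auto)

lemma hgrad_unique: "hgrad h W \<Longrightarrow> hgrad h W' \<Longrightarrow> W = W'"
  by (rule ext, rule hor_eqI) (auto simp: hgrad_def)

lemma hgrad_D:
  assumes "hgrad h W" "vf Y"
  shows "D Y h x = ip W Y x + et Y x * D \<xi> h x"
proof -
  let ?H = "vadd Y (smul (\<lambda>x. - et Y x) \<xi>)"
  have "hor ?H" using assms by (simp add: hor_def del: hor_vf hor_et)
  then have "D ?H h x = ip W ?H x" using assms(1) unfolding hgrad_def by blast
  then show ?thesis using assms hgradD[OF assms(1)] by simp
qed

text \<open>
  The gradient is chosen at each point.  Its smoothness follows from the expansion in a horizontal
  frame near that point, multiplied by the square of the length of the frame.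
\<close>
lemma hgrad_exists:
  assumes h: "sm h" obtains W where "hgrad h W"
proof -
  define U where "U = (unit_at :: 'm \<Rightarrow> 'm vfield)"
  have U: "hor (U x)" "ip (U x) (U x) x = 1" for x
    unfolding U_def by (rule unit_at)+
  define W where "W x = vadd (smul (D (U x) h) (U x)) (smul (D (ph (U x)) h) (ph (U x))) x" for x
  have n: "ip E E x * D (U x) h x = ip (U x) E x * D E h x + ip (U x) (ph E) x * D (ph E) h x"
      "ip E E x * D (ph (U x)) h x = ip (ph (U x)) E x * D E h x + ip (U x) E x * D (ph E) h x"
     if E: "hor E" for E x
  proof -
    have "D (smul (ip E E) Y) h x = ip Y E x * D E h x + ip Y (ph E) x * D (ph E) h x" if "hor Y" for Y
      unfolding hor_frame[OF E hor_vf[OF that]] using that by simp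
    from this[of "U x"] this[of "ph (U x)"] show
      "ip E E x * D (U x) h x = ip (U x) E x * D E h x + ip (U x) (ph E) x * D (ph E) h x"
      "ip E E x * D (ph (U x)) h x = ip (ph (U x)) E x * D E h x + ip (U x) E x * D (ph E) h x"
      using U[of x] E by simp_all
  qed
  have T: "W x \<in> T x" for x
    unfolding W_def using U[of x] h by (intro vf_tangent) auto
  have ipW: "g x (W x) (Z x) = D Z h x" if "hor Z" for Z x
  proof -
    have "g x (W x) (Z x) = ip (vadd (smul (D (U x) h) (U x)) (smul (D (ph (U x)) h) (ph (U x)))) Z x"
      by (simp add: ip_def W_def)
    also have "\<dots> = D (smul (ip (U x) (U x)) Z) h x"
      unfolding hor_frame[OF U(1) hor_vf[OF that]]
      using U[of x] h that ip_commute[of "U x" Z x] ip_commute[of "ph (U x)" Z x] by simp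
    also have "\<dots> = D Z h x" using U(2)[of x] by simp
    finally show ?thesis .
  qed
  have etW: "\<eta> x (W x) = 0" for x
  proof -
    have "\<eta> x (W x) = et (vadd (smul (D (U x) h) (U x)) (smul (D (ph (U x)) h) (ph (U x)))) x"
      by (simp add: et_def W_def)
    then show ?thesis using U[of x] h by simp
  qed
  have vW: "vf W"
    unfolding vector_field_def
  proof (intro conjI allI impI T)
    fix q assume q: "sm q"
    show "sm (\<lambda>x. W x q)"
    proof (rule smooth_fun_quotient[OF manifold])
      fix x
      obtain E where E: "hor E" "ip E E x = 1" using hor_unit_exists .
      let ?P = "\<lambda>y. D E h y * D E q y + D (ph E) h y * D (ph E) q y"
      have "W y q * ip E E y = ?P y" for y
      proof -
        have t: "W y \<in> T y" by (rule T)
        obtain Y where Y: "vf Y" "Y y = W y" using extension[OF t] .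
        have "W y q * ip E E y = D (smul (ip E E) Y) q y"
          using Y by (simp add: deriv_along_def smul_def)
        also have "\<dots> = ip Y E y * D E q y + ip Y (ph E) y * D (ph E) q y"
        proof -
          have "et Y y = 0" using Y etW by (simp add: et_def)
          then show ?thesis unfolding hor_frame[OF E(1) Y(1)] by simp
        qed
        also have "ip Y E y = D E h y" using ipW[OF E(1), of y] Y by (simp add: ip_def)
        also have "ip Y (ph E) y = D (ph E) h y" using ipW[of "ph E" y] E Y by (simp add: ip_def)
        finally show ?thesis .
      qed
      moreover have "sm ?P" using E h q by simp
      moreover have "sm (ip E E)" using E by simp
      ultimately show "\<exists>N P. sm N \<and> sm P \<and> N x \<noteq> 0 \<and> (\<forall>y. W y q * N y = P y)"
        using E(2) by (intro exI[of _ "ip E E"] exI[of _ ?P]) simp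
    qed
  qed
  have "et W = (\<lambda>_. 0)" using etW by (auto simp: et_def)
  then have "hor W" using vW unfolding hor_def by simp
  then have "hgrad h W" using h ipW unfolding hgrad_def by (simp add: ip_def)
  then show ?thesis by (rule that)
qed

lemma hgrad_lx:
  assumes "hgrad h W" shows "hgrad (D \<xi> h) (lx W)"
proof -
  note W = hgradD[OF assms]
  have "D Z (D \<xi> h) x = ip (lx W) Z x" if Z: "hor Z" for Z x
  proof -
    have e: "D Z h = ip W Z" using W(4)[OF Z] by auto
    have "D (lx Z) h x = D \<xi> (D Z h) x - D Z (D \<xi> h) x" by (rule D_bracket)
    then show ?thesis using W(4)[of "lx Z" x] W Z by (simp add: e D_xi_ip)
  qed
  then show ?thesis using W by (auto simp: hgrad_def)
qed

lemma hgrad_lincomb: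
  assumes "hgrad h W" "hgrad k Z"
  shows "hgrad (\<lambda>x. h x + a * k x) (vadd W (smul (\<lambda>_. a) Z))"
  using assms unfolding hgrad_def by auto

text \<open>
  Divergence and rotation along the contact plane, in the frame \<open>E, \<phi>E\<close>.  As \<open>E\<close> need not have length one,
  both carry the factor \<open>ip E E\<close>.
\<close>
definition hdiv :: "'m vfield \<Rightarrow> 'm vfield \<Rightarrow> 'm \<Rightarrow> real" where
  "hdiv E W x = ip (N E W) E x + ip (N (ph E) W) (ph E) x"

definition hrot :: "'m vfield \<Rightarrow> 'm vfield \<Rightarrow> 'm \<Rightarrow> real" where
  "hrot E W x = ip (N E W) (ph E) x - ip (N (ph E) W) E x"

lemma hdiv_vadd [simp]:
  "hor E \<Longrightarrow> vf W \<Longrightarrow> vf W' \<Longrightarrow> hdiv E (vadd W W') x = hdiv E W x + hdiv E W' x"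
  "hor E \<Longrightarrow> vf W \<Longrightarrow> vf W' \<Longrightarrow> hrot E (vadd W W') x = hrot E W x + hrot E W' x"
  by (simp_all add: hdiv_def hrot_def)

lemma hdiv_smul [simp]:
  assumes "hor E" "hor W" "sm h"
  shows "hdiv E (smul h W) x = h x * hdiv E W x + ip E E x * D W h x"
    "hrot E (smul h W) x = h x * hrot E W x - ip E E x * D (ph W) h x"
proof -
  have "D (smul (ip E E) Y) h x = ip Y E x * D E h x + ip Y (ph E) x * D (ph E) h x" if "hor Y" for Y
    unfolding hor_frame[OF assms(1) hor_vf[OF that]] using that by simp
  from this[OF assms(2)] this[of "ph W"]
  show "hdiv E (smul h W) x = h x * hdiv E W x + ip E E x * D W h x"
    "hrot E (smul h W) x = h x * hrot E W x - ip E E x * D (ph W) h x"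
    using assms ip_ph_skew[of W E x] by (simp_all add: hdiv_def hrot_def algebra_simps)
qed

lemma hdiv_ph [simp]:
  assumes "hor E" "hor W"
  shows "hdiv E (ph W) x = - hrot E W x" "hrot E (ph W) x = hdiv E W x"
  using assms by (simp_all add: hdiv_def hrot_def ip_N_ph0)

text \<open>
  The vertical component of \<open>[E, \<phi>E]\<close> is \<open>2\<alpha> ip E E\<close>: the failure of the contact planes to be integrable
  lets the derivative along \<open>\<xi>\<close> appear.
\<close>
lemma hrot_hgrad:
  assumes E: "hor E" and "hgrad h W"
  shows "hrot E W x = 2 * \<alpha> * ip E E x * D \<xi> h x"
proof -
  note W = hgradD[OF assms(2)]
  have e: "D E h = ip W E" "D (ph E) h = ip W (ph E)" using W(4) E by auto
  have "D (lie_bracket E (ph E)) h x = D E (ip W (ph E)) x - D (ph E) (ip W E) x"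
    unfolding D_bracket e ..
  moreover have "D (lie_bracket E (ph E)) h x = ip W (lie_bracket E (ph E)) x + 2 * \<alpha> * ip E E x * D \<xi> h x"
    using hgrad_D[OF assms(2), of "lie_bracket E (ph E)" x] et_bracket[of E "ph E" x] E by simp
  ultimately show ?thesis
    using W E by (simp add: D_ip ip_bracket hrot_def)
qed


section \<open>Conformal Cauchy-Riemann fields\<close>

text \<open>
  Along the contact planes, with \<open>\<phi>\<close> as the imaginary unit, the covariant derivative of \<open>X\<close> is multiplication
  by \<open>f + i\<rho>\<close>.
\<close>
definition cr :: "'m vfield \<Rightarrow> ('m \<Rightarrow> real) \<Rightarrow> ('m \<Rightarrow> real) \<Rightarrow> bool" where
  "cr X f \<rho> \<longleftrightarrow> hor X \<and> sm f \<and> sm \<rho> \<and>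
     (\<forall>Y Z x. hor Y \<longrightarrow> hor Z \<longrightarrow> ip (N Y X) Z x = f x * ip Y Z x + \<rho> x * ip (ph Y) Z x)"

lemma crD:
  assumes "cr X f \<rho>"
  shows "hor X" "vf X" "sm f" "sm \<rho>"
    "hor Y \<Longrightarrow> hor Z \<Longrightarrow> ip (N Y X) Z x = f x * ip Y Z x + \<rho> x * ip (ph Y) Z x"
  using assms by (auto simp: cr_def)

lemma cr_lx:
  assumes "cr X f \<rho>" shows "cr (lx X) (D \<xi> f) (D \<xi> \<rho>)"
proof -
  note X = crD[OF assms]
  have "ip (N Y (lx X)) Z x = D \<xi> f x * ip Y Z x + D \<xi> \<rho> x * ip (ph Y) Z x"
    if Y: "hor Y" and Z: "hor Z" for Y Z x
  proof -
    have e: "ip (N Y X) Z = (\<lambda>x. f x * ip Y Z x + \<rho> x * ip (ph Y) Z x)"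
      using X(5)[OF Y Z] by auto
    have "D \<xi> (ip (N Y X) Z) x = ip (N (lx Y) X) Z x + ip (N Y (lx X)) Z x + ip (N Y X) (lx Z) x"
      using X Y Z by (simp add: D_xi_ip lx_connection)
    moreover have "D \<xi> (ip (N Y X) Z) x = D \<xi> f x * ip Y Z x + f x * (ip (lx Y) Z x + ip Y (lx Z) x)
        + D \<xi> \<rho> x * ip (ph Y) Z x + \<rho> x * (ip (ph (lx Y)) Z x + ip (ph Y) (lx Z) x)"
      unfolding e using X Y Z by (simp add: D_xi_ip)
    ultimately show ?thesis
      using X(5)[OF hor_lx[OF Y] Z, of x] X(5)[OF Y hor_lx[OF Z], of x] by (simp add: algebra_simps)
  qed
  then show ?thesis using X by (auto simp: cr_def)
qed

lemma cr_hdiv: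
  assumes "cr X f \<rho>" "hor E"
  shows "hdiv E X x = 2 * f x * ip E E x" "hrot E X x = 2 * \<rho> x * ip E E x"
  using crD(5)[OF assms(1) assms(2,2)] crD(5)[OF assms(1) assms(2), of "ph E"]
    crD(5)[OF assms(1) _ assms(2), of "ph E"] crD(5)[OF assms(1), of "ph E" "ph E"] assms(2)
  by (simp_all add: hdiv_def hrot_def)

text \<open>
  The vertical component is forced by \<open>\<eta>(X) = 0\<close>.
\<close>
lemma cr_N:
  assumes X: "cr X f \<rho>" and Y: "hor Y"
  shows "N Y X = vadd (smul f Y) (vadd (smul \<rho> (ph Y)) (smul (\<lambda>x. - \<alpha> * ip (ph X) Y x) \<xi>))"
proof
  fix x
  let ?R = "vadd (smul f Y) (vadd (smul \<rho> (ph Y)) (smul (\<lambda>x. - \<alpha> * ip (ph X) Y x) \<xi>))"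
  note D = crD[OF X]
  show "N Y X x = ?R x"
  proof (rule ip_eqI[where X = "N Y X" and Y = ?R])
    fix W assume W: "vf W"
    let ?H = "vadd W (smul (\<lambda>x. - et W x) \<xi>)"
    have H: "hor ?H" using W by (simp add: hor_def del: hor_vf hor_et)
    have e: "et (N Y X) x = - \<alpha> * ip (ph X) Y x"
      using et_N0[of Y X x] D Y ip_ph_skew[of Y X x] ip_commute[of Y "ph X" x] by simp
    have "ip (N Y X) W x = ip (N Y X) ?H x + et W x * et (N Y X) x"
      using D Y W by simp
    also have "\<dots> = ip ?R W x"
      unfolding D(5)[OF Y H] e using D Y W by (simp add: algebra_simps)
    finally show "ip (N Y X) W x = ip ?R W x" .
  qed (use D Y in auto)
qed

text \<open>
  Compute \<open>R(E, \<phi>E)X\<close> from the Cauchy-Riemann equations and compare its \<open>E\<close>-component with the value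
  prescribed by \<open>sec\<close>.  Derivatives of the frame cancel, and the vertical part of \<open>[E, \<phi>E]\<close>
  contributes \<open>[\<xi>, X]\<close>.
\<close>
lemma cr_rotation_gradient:
  assumes X: "cr X f \<rho>" and G: "hgrad f G"
  shows "hgrad \<rho> (vadd (ph G) (vadd (smul (\<lambda>x. sec x + 3 * \<alpha>\<^sup>2) (ph X)) (smul (\<lambda>_. - 2 * \<alpha>) (lx X))))"
proof -
  note D = crD[OF X] and G' = hgradD[OF G]
  have main: "D E \<rho> x = - D (ph E) f x + (sec x + 3 * \<alpha>\<^sup>2) * ip (ph X) E x - 2 * \<alpha> * ip (lx X) E x"
    if E: "hor E" for E x
  proof (cases "E x = 0")
    case True
    then have "ph E x = 0" using phi_linear(2)[of 0 x 0] by (simp add: ph_def)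
    then show ?thesis using True D E by (simp add: deriv_along_def ip_def)
  next
    case False
    let ?F = "ph E" and ?n = "ip E E x"
    have n: "?n \<noteq> 0" using False ip_zero_iff[of E x] E by simp
    have F: "hor ?F" and v: "vf E" "vf ?F" using E by auto
    have sw: "ip ?F E x = 0" "ip E ?F x = 0" using E by auto
    have 1: "ip (N E (N ?F X)) E x = f x * ip (N E ?F) E x - ?n * D E \<rho> x - \<rho> x * ip (N E E) E x"
      unfolding cr_N[OF X F] using D E by (simp add: N_xi0)
    have 2: "ip (N ?F (N E X)) E x = ?n * D ?F f x + f x * ip (N ?F E) E x - \<rho> x * ip (N ?F E) ?F x
        - \<alpha>\<^sup>2 * ?n * ip (ph X) E x"
      unfolding cr_N[OF X E] using D E by (simp add: N_xi0 ip_N_ph0 power2_eq_square)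
    let ?b = "lie_bracket E ?F"
    let ?H = "vadd ?b (smul (\<lambda>x. - et ?b x) \<xi>)"
    have H: "hor ?H" using v by (simp add: hor_def del: hor_vf hor_et)
    have eb: "et ?b x = 2 * \<alpha> * ?n" using et_bracket[of E ?F x] E by simp
    have 3: "ip (N ?b X) E x = f x * (ip (N E ?F) E x - ip (N ?F E) E x) - \<rho> x * (ip (N E ?F) ?F x - ip (N ?F E) ?F x)
        + 2 * \<alpha> * ?n * (ip (lx X) E x - \<alpha> * ip (ph X) E x)"
    proof -
      have "ip (N ?H X) E x = ip (N ?b X) E x - et ?b x * ip (N \<xi> X) E x"
        using D v by simp
      moreover have "ip (N \<xi> X) E x = ip (lx X) E x - \<alpha> * ip (ph X) E x"
        using D v by (simp add: lx_N)
      moreover have "ip (N ?H X) E x = f x * ip ?b E x - \<rho> x * ip ?b ?F x"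
        unfolding D(5)[OF H E] using v E ip_ph_skew[of ?b E x] by simp
      ultimately show ?thesis unfolding eb using v by (simp add: ip_bracket)
    qed
    have 4: "Rm E ?F X E x = - sec x * ?n * ip (ph X) E x"
      using Rm_horizontal[OF E D(2) v(1), of x] ip_ph_skew[of X E x] ip_commute[of X ?F x] D v by simp
    have 5: "ip (N E ?F) ?F x = ip (N E E) E x" using E by (simp add: ip_N_ph0)
    have "?n * D E \<rho> x = ?n * (- D (ph E) f x + (sec x + 3 * \<alpha>\<^sup>2) * ip (ph X) E x - 2 * \<alpha> * ip (lx X) E x)"
      using 4 unfolding Rm_def 1 2 3 5 by (simp add: algebra_simps power2_eq_square)
    then show ?thesis using n by simp
  qed
  have "D Z \<rho> x = ip (vadd (ph G) (vadd (smul (\<lambda>x. sec x + 3 * \<alpha>\<^sup>2) (ph X)) (smul (\<lambda>_. - 2 * \<alpha>) (lx X)))) Z x"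
    if Z: "hor Z" for Z x
    using main[OF Z, of x] G'(4)[of "ph Z" x] ip_ph_skew[of G Z x] Z D G' by simp
  then show ?thesis unfolding hgrad_def using D G' by auto
qed

section \<open>Eliminating a logarithm\<close>

lemma sm_poly [simp, intro]: "sm k \<Longrightarrow> sm (\<lambda>x. poly q (k x))"
  by (induction q) auto

lemma D_poly: "vf Y \<Longrightarrow> sm k \<Longrightarrow> D Y (\<lambda>x. poly q (k x)) x = poly (pderiv q) (k x) * D Y k x"
  by (induction q) (simp_all add: pderiv_pCons algebra_simps)

lemma sm_sum [simp, intro]: "finite I \<Longrightarrow> (\<And>i. i \<in> I \<Longrightarrow> sm (h i)) \<Longrightarrow> sm (\<lambda>x. \<Sum>i\<in>I. h i x)"
  by (rule smooth_fun_sum[OF _ manifold])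

lemma D_sum: "finite I \<Longrightarrow> vf Y \<Longrightarrow> (\<And>i. i \<in> I \<Longrightarrow> sm (h i)) \<Longrightarrow> D Y (\<lambda>x. \<Sum>i\<in>I. h i x) x = (\<Sum>i\<in>I. D Y (h i) x)"
  by (induction I rule: finite_induct) auto

lemma D_power: "vf Y \<Longrightarrow> sm w \<Longrightarrow> D Y (\<lambda>x. w x ^ i) x = of_nat i * w x ^ (i - 1) * D Y w x"
proof (induction i)
  case (Suc i)
  then show ?case by (cases i) (simp_all add: algebra_simps)
qed simp

text \<open>
  A relation on the open set where \<open>S\<close> does not vanish may be differentiated there: multiplied by \<open>S\<close> it
  holds everywhere.
\<close>
lemma D_zero_where_nonzero:
  assumes "sm S" "sm h" "vf Y" "\<And>x. S x \<noteq> 0 \<Longrightarrow> h x = 0" "S x \<noteq> 0"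
  shows "D Y h x = 0"
proof -
  have "(\<lambda>x. S x * h x) = (\<lambda>_. 0)" using assms(4) by force
  then have "D Y (\<lambda>x. S x * h x) x = 0" using assms(3) by simp
  then show ?thesis using assms by simp
qed

lemma polynomial_relation_trivial:
  assumes S: "sm S" and k: "sm k" and G: "vf G"
    and dk: "\<And>x. S x \<noteq> 0 \<Longrightarrow> D G k x = S x" and x0: "S x0 \<noteq> 0"
    and z: "\<And>x. S x \<noteq> 0 \<Longrightarrow> poly q (k x) = 0"
  shows "q = 0"
  using z
proof (induction "degree q" arbitrary: q rule: less_induct)
  case less
  show ?case
  proof (cases "degree q = 0")
    case True
    then obtain a where "q = [:a:]" using degree_eq_zeroE by blast
    then show ?thesis using less.prems[OF x0] by simp
  next
    case False
    have "poly (pderiv q) (k x) = 0" if "S x \<noteq> 0" for x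
    proof -
      have "D G (\<lambda>x. poly q (k x)) x = 0"
        by (rule D_zero_where_nonzero[OF S _ G _ that]) (use k less.prems in auto)
      then show ?thesis using D_poly[OF G k, of q x] dk[OF that] that by simp
    qed
    then have "pderiv q = 0" using less.hyps[of "pderiv q"] False by (simp add: degree_pderiv)
    then show ?thesis using False by (simp add: pderiv_eq_0_iff)
  qed
qed

text \<open>
  Along \<open>G\<close> the function \<open>w\<close> behaves like \<open>- 2 k - 4 a ln \<bar>k\<bar>\<close>, which is transcendental over the polynomials
  in \<open>k\<close>.  Combining a relation of degree \<open>d\<close> with its derivative eliminates \<open>w ^ d\<close>.  The leading
  coefficient survives the step if it does not vanish at \<open>k = 0\<close>, because there the operator \<open>k d/dk\<close>
  kills the coefficients and sends \<open>w\<close> to the nonzero constant \<open>- 4 a\<close>.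
\<close>
lemma log_transcendental:
  assumes S: "sm S" and k: "sm k" and w: "sm w" and G: "vf G" and a: "a \<noteq> 0"
    and dk: "\<And>x. S x \<noteq> 0 \<Longrightarrow> D G k x = S x"
    and dw: "\<And>x. S x \<noteq> 0 \<Longrightarrow> k x * D G w x = - (2 * k x + 4 * a) * S x" and x0: "S x0 \<noteq> 0"
    and z: "\<And>x. S x \<noteq> 0 \<Longrightarrow> (\<Sum>i\<le>d. poly (q i) (k x) * w x ^ i) = 0"
    and lead: "poly (q d) 0 \<noteq> 0"
  shows False
  using z lead
proof (induction d arbitrary: q)
  case 0
  have "q 0 = 0" by (rule polynomial_relation_trivial[OF S k G dk x0]) (use 0 in auto)
  then show ?case using 0 by simp
next
  case (Suc d)
  define X where "X = [:0, 1::real:]"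
  define l where "l = [:- 4 * a, - 2:]"
  \<comment> \<open>Coefficients of the leading coefficient times the derivative, minus the derivative of the leading coefficient times the relation.\<close>
  define q' where "q' i = q (Suc d) * (X * pderiv (q i) + of_nat (Suc i) * q (Suc i) * l)
      - X * pderiv (q (Suc d)) * q i" for i
  have "(\<Sum>i\<le>d. poly (q' i) (k x) * w x ^ i) = 0" if x: "S x \<noteq> 0" for x
  proof -
    let ?c = "\<lambda>i. poly (q i) (k x)" and ?c' = "\<lambda>i. poly (pderiv (q i)) (k x)"
    have "D G (\<lambda>x. \<Sum>i\<le>Suc d. poly (q i) (k x) * w x ^ i) x = 0"
      by (rule D_zero_where_nonzero[OF S _ G _ x]) (use k w Suc.prems(1) in auto)
    then have "(\<Sum>i\<le>Suc d. ?c' i * S x * w x ^ i + ?c i * (of_nat i * w x ^ (i - 1) * D G w x)) = 0"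
      using k w G dk[OF x] by (subst (asm) D_sum) (auto simp: D_poly D_power algebra_simps)
    then have "k x * (\<Sum>i\<le>Suc d. ?c' i * S x * w x ^ i + ?c i * (of_nat i * w x ^ (i - 1) * D G w x)) = 0"
      by simp
    also have "k x * (\<Sum>i\<le>Suc d. ?c' i * S x * w x ^ i + ?c i * (of_nat i * w x ^ (i - 1) * D G w x))
        = (\<Sum>i\<le>Suc d. k x * (?c' i * S x * w x ^ i) + ?c i * (of_nat i * w x ^ (i - 1)) * (k x * D G w x))"
      by (simp only: sum_distrib_left distrib_left mult_ac)
    also have "\<dots> = S x * (\<Sum>i\<le>Suc d. k x * ?c' i * w x ^ i + ?c i * of_nat i * w x ^ (i - 1) * (- (2 * k x + 4 * a)))"
      unfolding dw[OF x] by (simp only: sum_distrib_left distrib_left mult_ac)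
    finally have e: "(\<Sum>i\<le>Suc d. k x * ?c' i * w x ^ i + ?c i * of_nat i * w x ^ (i - 1) * (- (2 * k x + 4 * a))) = 0"
      using x by simp
    have e1: "(\<Sum>i\<le>d. poly (q' i) (k x) * w x ^ i) =
      ?c (Suc d) * ((\<Sum>i\<le>d. k x * ?c' i * w x ^ i) + (\<Sum>i\<le>d. ?c (Suc i) * of_nat (Suc i) * w x ^ i * (- (2 * k x + 4 * a))))
      - k x * ?c' (Suc d) * (\<Sum>i\<le>d. ?c i * w x ^ i)"
    proof -
      have "poly (q' i) (k x) * w x ^ i = (?c (Suc d) * (k x * ?c' i * w x ^ i)
        + ?c (Suc d) * (?c (Suc i) * of_nat (Suc i) * w x ^ i * (- (2 * k x + 4 * a)))) - k x * ?c' (Suc d) * (?c i * w x ^ i)" for i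
        unfolding q'_def X_def l_def by (simp add: algebra_simps)
      then show ?thesis by (simp only: sum.distrib sum_subtractf sum_distrib_left distrib_left)
    qed
    have e2: "(\<Sum>i\<le>d. ?c i * w x ^ i) = - (?c (Suc d) * w x ^ Suc d)"
      using Suc.prems(1)[OF x] by simp
    have e3: "(\<Sum>i\<le>d. k x * ?c' i * w x ^ i) + (\<Sum>i\<le>d. ?c (Suc i) * of_nat (Suc i) * w x ^ i * (- (2 * k x + 4 * a)))
        = - (k x * ?c' (Suc d) * w x ^ Suc d)"
    proof -
      have "(\<Sum>i\<le>Suc d. ?c i * of_nat i * w x ^ (i - 1) * (- (2 * k x + 4 * a)))
          = (\<Sum>i\<le>d. ?c (Suc i) * of_nat (Suc i) * w x ^ i * (- (2 * k x + 4 * a)))"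
        by (subst sum.atMost_Suc_shift) simp
      moreover have "(\<Sum>i\<le>Suc d. k x * ?c' i * w x ^ i) + (\<Sum>i\<le>Suc d. ?c i * of_nat i * w x ^ (i - 1) * (- (2 * k x + 4 * a))) = 0"
        using e by (simp only: sum.distrib)
      ultimately show ?thesis by simp
    qed
    show ?thesis unfolding e1 e2 e3 by (simp add: algebra_simps)
  qed
  moreover have "poly (q' d) 0 = - 4 * a * real (Suc d) * (poly (q (Suc d)) 0)\<^sup>2"
    by (simp add: q'_def X_def l_def power2_eq_square algebra_simps)
  then have "poly (q' d) 0 \<noteq> 0" using Suc.prems(2) a by (simp del: of_nat_Suc)
  ultimately show False by (rule Suc.IH)
qed

end

section \<open>The soliton equation\<close>

locale star_soliton_3 = trans_sasakian_3 A g N \<phi> \<xi> \<eta> \<alpha> \<beta>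
  for A :: "('m::{t2_space,second_countable_topology}, real ^ 3) chart set"
    and g N \<phi> \<xi> \<eta> \<alpha> \<beta> +
  fixes V :: "'m vfield" and lam :: real and p :: "'m \<Rightarrow> real"
  assumes soliton: "star_conformal_ricci_soliton A \<phi> g N V lam p"
begin

definition c :: "'m \<Rightarrow> real" where "c x = 2 * lam - (p x + 2 / 3)"
text \<open>
  The horizontal part of \<open>V\<close>, the dilation \<open>f\<close> and the rotation \<open>\<rho>\<close> of \<open>X\<close> along the contact planes.
\<close>
definition X :: "'m vfield" where "X = vadd V (smul (\<lambda>x. - et V x) \<xi>)"
definition f :: "'m \<Rightarrow> real" where "f x = - sec x - c x / 2"
definition \<rho> :: "'m \<Rightarrow> real" where
  "\<rho> x = ip (N (unit_at x) X) (ph (unit_at x)) x"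

lemma vf_V [simp, intro]: "vf V" and sm_p [simp, intro]: "sm p"
  using soliton by (simp_all add: star_conformal_ricci_soliton_def)

lemma sm_c [simp, intro]: "sm c"
proof -
  have "c = (\<lambda>x. 2 * lam - (p x + 2 / 3))" by (auto simp: c_def)
  then show ?thesis by simp
qed

lemma sm_f [simp, intro]: "sm f"
proof -
  have e: "f = (\<lambda>x. - sec x + (- (1 / 2)) * c x)" by (auto simp: f_def)
  show ?thesis unfolding e by (intro sm_closed sm_uminus sm_sec sm_c)
qed

lemma hor_X [simp, intro]: "hor X"
  unfolding X_def hor_def by simp

lemma soliton_eq:
  assumes "vf Y" "vf Z"
  shows "ip (N Y V) Z x + ip Y (N Z V) x + 2 * sec x * (ip Y Z x - et Y x * et Z x) + c x * ip Y Z x = 0"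
proof -
  have "lie_metric V g Y Z x + 2 * star_ricci A \<phi> N x (Y x) (Z x) +
          (2 * lam - (p x + 2 / real DIM(real ^ 3))) * g x (Y x) (Z x) = 0"
    using soliton assms unfolding star_conformal_ricci_soliton_def by blast
  moreover have "lie_metric V g Y Z x = D V (ip Y Z) x - ip (lie_bracket V Y) Z x - ip Y (lie_bracket V Z) x"
    by (simp add: lie_metric_def deriv_along_def ip_def)
  moreover have "\<dots> = ip (N Y V) Z x + ip Y (N Z V) x"
    using assms by (simp add: D_ip ip_bracket)
  ultimately show ?thesis
    using star_ricci_eq[OF assms, of x] by (simp add: c_def ip_def)
qed

lemma V_split: "V = vadd X (smul (et V) \<xi>)"
  by (simp add: X_def vadd_def smul_def)

lemma N_V: "vf Y \<Longrightarrow> vf Z \<Longrightarrow> ip (N Y V) Z x = ip (N Y X) Z x + D Y (et V) x * et Z x - \<alpha> * et V x * ip (ph Y) Z x"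
proof -
  assume Y: "vf Y" "vf Z"
  have "ip (N Y V) Z x = ip (N Y (vadd X (smul (et V) \<xi>))) Z x" using V_split by metis
  also have "\<dots> = ip (N Y X) Z x + D Y (et V) x * et Z x - \<alpha> * et V x * ip (ph Y) Z x"
    using Y by (simp add: N_xi0)
  finally show ?thesis .
qed

text \<open>
  The contact plane block of the soliton equation.
\<close>
lemma hor_symmetric_part:
  assumes "hor Y" "hor Z"
  shows "ip (N Y X) Z x + ip (N Z X) Y x = 2 * f x * ip Y Z x"
  using soliton_eq[of Y Z x] N_V[of Y Z x] N_V[of Z Y x] assms ip_commute[of Y "N Z V" x]
    ip_ph_skew[of Y Z x] ip_commute[of Y "ph Z" x]
  by (simp add: f_def algebra_simps)

text \<open>
  In two dimensions a skew form is a multiple of \<open>\<phi>\<close>.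
\<close>
lemma rho_eq:
  assumes Y: "hor Y" and Z: "hor Z"
  shows "ip (N Y X) Z x = f x * ip Y Z x + \<rho> x * ip (ph Y) Z x"
proof -
  define U where "U = unit_at x"
  note U = unit_at[of x, folded U_def]
  let ?F = "ph U"
  have r: "ip (N U X) ?F x = \<rho> x" by (simp add: \<rho>_def U_def)
  have F: "hor ?F" using U by simp
  have m: "ip (N U X) U x = f x" "ip (N ?F X) ?F x = f x" "ip (N ?F X) U x = - \<rho> x"
    using hor_symmetric_part[OF U(1) U(1), of x] hor_symmetric_part[OF F F, of x]
      hor_symmetric_part[OF U(1) F, of x] U r by auto
  define ex where "ex Y = vadd (smul (\<lambda>_. ip Y U x) U) (smul (\<lambda>_. ip Y (ph U) x) (ph U))" for Y
  have e: "vf (ex Y)" "Y x = ex Y x" if "hor Y" for Y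
    using unit_frame_expand[OF U hor_vf[OF that]] that U unfolding ex_def
    by simp_all
  have "N Y X x = N (ex Y) X x"
  proof (rule tensorial[where L = "\<lambda>Y. N Y X x" and x = x])
    show "N (vadd Y Y') X x = N Y X x + N Y' X x" if "vf Y" "vf Y'" for Y Y'
      unfolding N_vadd_left[OF that hor_vf[OF hor_X]] by (simp only: vadd_def)
    show "N (smul h Y) X x = h x *\<^sub>R N Y X x" if "sm h" "vf Y" for h Y
      unfolding N_smul_left[OF that hor_vf[OF hor_X]] by (simp only: smul_def)
  qed (use e[OF Y] Y in auto)
  then have "ip (N Y X) Z x = ip (N (ex Y) X) (ex Z) x"
    using e(2)[OF Z] by (simp add: ip_def)
  then have 1: "ip (N Y X) Z x = f x * (ip Y U x * ip Z U x + ip Y ?F x * ip Z ?F x) + \<rho> x * (ip Y U x * ip Z ?F x - ip Y ?F x * ip Z U x)"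
    using U Y Z by (simp add: ex_def m r algebra_simps)
  have 2: "ip Y U x * ip Z U x + ip Y ?F x * ip Z ?F x = ip Y Z x"
  proof -
    have "ip Y Z x = ip (ex Y) (ex Z) x" using e(2)[OF Y] e(2)[OF Z] by (simp add: ip_def)
    then show ?thesis unfolding ex_def using U Y Z by simp
  qed
  have 3: "ip Y U x * ip Z ?F x - ip Y ?F x * ip Z U x = ip (ph Y) Z x"
  proof -
    have "ip (ph Y) Z x = ip (ph (ex Y)) (ex Z) x" using e(2)[OF Y] e(2)[OF Z] by (simp add: ip_def ph_def)
    then show ?thesis unfolding ex_def using U Y Z by simp
  qed
  show ?thesis unfolding 1 2 3 ..
qed

lemma sm_rho [simp, intro]: "sm \<rho>"
proof (rule smooth_fun_quotient[OF manifold])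
  fix x
  obtain E where E: "hor E" "ip E E x = 1" using hor_unit_exists .
  have "\<rho> y * ip E E y = ip (N E X) (ph E) y" for y
    using rho_eq[OF E(1), of "ph E" y] E by simp
  moreover have "sm (ip E E)" "sm (ip (N E X) (ph E))" using E by auto
  ultimately show "\<exists>N P. sm N \<and> sm P \<and> N x \<noteq> 0 \<and> (\<forall>y. \<rho> y * N y = P y)"
    using E by (intro exI[of _ "ip E E"] exI[of _ "ip (N E X) (ph E)"]) simp
qed

lemma cr_X: "cr X f \<rho>"
  using rho_eq unfolding cr_def by auto

abbreviation X1 :: "'m vfield" where "X1 \<equiv> lx X"
abbreviation X2 :: "'m vfield" where "X2 \<equiv> lx X1"
abbreviation X3 :: "'m vfield" where "X3 \<equiv> lx X2"
abbreviation f1 :: "'m \<Rightarrow> real" where "f1 \<equiv> D \<xi> f"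
abbreviation f2 :: "'m \<Rightarrow> real" where "f2 \<equiv> D \<xi> f1"

text \<open>
  The mixed block of the soliton equation, for a horizontal field and \<open>\<xi>\<close>.
\<close>
lemma grad_et_V: "hgrad (et V) (vadd (smul (\<lambda>_. 2 * \<alpha>) (ph X)) (smul (\<lambda>_. -1) X1))"
proof -
  have "D Z (et V) x = ip (vadd (smul (\<lambda>_. 2 * \<alpha>) (ph X)) (smul (\<lambda>_. -1) X1)) Z x" if Z: "hor Z" for Z x
  proof -
    have a: "et (N Z V) x + ip Z (N \<xi> V) x = 0"
      using soliton_eq[of Z \<xi> x] Z by simp
    have b: "et (N Z X) x = - \<alpha> * ip (ph X) Z x"
      using et_N0[of Z X x] Z ip_ph_skew[of Z X x] ip_commute[of Z "ph X" x] by simp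
    have c: "ip Z (N \<xi> V) x = ip (N \<xi> X) Z x"
      using N_V[of \<xi> Z x] Z ip_commute[of Z "N \<xi> V" x] by simp
    have d: "ip (N \<xi> X) Z x = ip X1 Z x - \<alpha> * ip (ph X) Z x"
      using Z by (simp add: lx_N)
    show ?thesis
      using a N_V[of Z \<xi> x] Z b c d by simp
  qed
  then show ?thesis unfolding hgrad_def by auto
qed

text \<open>
  The \<open>\<xi>\<close>-block of the soliton equation.
\<close>
lemma D_xi_et_V: "D \<xi> (et V) = (\<lambda>x. f x + sec x)"
proof
  fix x
  have "et (N \<xi> X) x = 0" using et_N0[of \<xi> X x] by simp
  then show "D \<xi> (et V) x = f x + sec x"
    using soliton_eq[of \<xi> \<xi> x] N_V[of \<xi> \<xi> x] by (simp add: f_def)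
qed

text \<open>
  The rotation of \<open>grad_et_V\<close>, computed from \<open>hrot_hgrad\<close> and from the Cauchy-Riemann equations.
\<close>
lemma D_xi_rho: "D \<xi> \<rho> = (\<lambda>x. \<alpha> * (f x - sec x))"
proof
  fix x
  obtain E where E: "hor E" "ip E E x = 1" using hor_unit_exists .
  show "D \<xi> \<rho> x = \<alpha> * (f x - sec x)"
    using hrot_hgrad[OF E(1) grad_et_V, of x] E cr_hdiv[OF cr_X E(1), of x] cr_hdiv[OF cr_lx[OF cr_X] E(1), of x]
    by (simp add: D_xi_et_V algebra_simps)
qed

text \<open>
  The horizontal gradients of \<open>sec\<close>, of \<open>f + sec\<close> and of \<open>f\<close>; the formula for the second one is the derivative of
  \<open>grad_et_V\<close> along \<open>\<xi>\<close>.
\<close>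
definition GK :: "'m vfield" where "GK = (SOME W. hgrad sec W)"
definition G7 :: "'m vfield" where "G7 = vadd (smul (\<lambda>_. 2 * \<alpha>) (ph X1)) (smul (\<lambda>_. -1) X2)"
definition Gf :: "'m vfield" where "Gf = vadd G7 (smul (\<lambda>_. -1) GK)"

lemma grad_sec: "hgrad sec GK"
  unfolding GK_def using hgrad_exists[OF sm_sec] someI_ex by metis

lemma grad_f_sec: "hgrad (\<lambda>x. f x + sec x) G7"
  using hgrad_lx[OF grad_et_V] unfolding D_xi_et_V G7_def by simp

lemma grad_f: "hgrad f Gf"
  using hgrad_lincomb[OF grad_f_sec grad_sec, of "-1"] unfolding Gf_def by simp

lemma hor_GK [simp, intro]: "hor GK" and hor_Gf [simp, intro]: "hor Gf" and hor_G7 [simp, intro]: "hor G7"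
  using grad_sec grad_f grad_f_sec by (auto simp: hgrad_def)

lemma lx_GK: "lx GK = smul (\<lambda>_. 0) \<xi>"
proof (rule hgrad_unique)
  show "hgrad (\<lambda>_. 0) (lx GK)" using hgrad_lx[OF grad_sec] by simp
  show "hgrad (\<lambda>_. 0) (smul (\<lambda>_. 0) \<xi>)" by (auto simp: hgrad_def hor_def simp del: hor_vf hor_et)
qed

lemmas cr_X1 = cr_lx[OF cr_X]
lemmas cr_X2 = cr_lx[OF cr_X1]
lemmas cr_X3 = cr_lx[OF cr_X2]

lemma D_xi2_rho: "D \<xi> (D \<xi> \<rho>) = (\<lambda>x. \<alpha> * f1 x)"
  unfolding D_xi_rho by (auto simp: fun_eq_iff)

lemma D_xi3_rho: "D \<xi> (D \<xi> (D \<xi> \<rho>)) = (\<lambda>x. \<alpha> * f2 x)"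
  unfolding D_xi2_rho by (auto simp: fun_eq_iff)

text \<open>
  \<open>D_xi_rho\<close> gives the gradient of the derivative of \<open>\<rho>\<close> along \<open>\<xi>\<close> in terms of \<open>f\<close> and \<open>sec\<close>,
  \<open>cr_rotation_gradient\<close> for \<open>X1\<close> in terms of the gradient of \<open>f1\<close>.  After inserting the gradient of \<open>f\<close> the
  comparison is a differential equation for \<open>X\<close> along \<open>\<xi>\<close>.
\<close>
lemma ph_X3: "ph X3 = vadd (smul (\<lambda>_. - 3 * \<alpha>) X2)
    (vadd (smul (\<lambda>x. sec x + \<alpha>\<^sup>2) (ph X1)) (smul (\<lambda>_. 2 * \<alpha>) GK))" (is "_ = ?R")
proof
  fix x
  show "ph X3 x = ?R x"
  proof (rule hor_eqI[where W = "ph X3" and W' = ?R])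
    fix Z assume Z: "hor Z"
    have "hgrad (D \<xi> \<rho>) (vadd (ph (lx Gf)) (vadd (smul (\<lambda>x. sec x + 3 * \<alpha>\<^sup>2) (ph X1)) (smul (\<lambda>_. - 2 * \<alpha>) X2)))"
      by (rule cr_rotation_gradient[OF cr_X1 hgrad_lx[OF grad_f]])
    from hgradD(4)[OF this Z, of x]
    have 1: "\<alpha> * (ip Gf Z x - ip GK Z x) = ip (ph (lx Gf)) Z x + (sec x + 3 * \<alpha>\<^sup>2) * ip (ph X1) Z x - 2 * \<alpha> * ip X2 Z x"
      using Z hgradD(4)[OF grad_f Z, of x] hgradD(4)[OF grad_sec Z, of x] by (simp add: D_xi_rho)
    have 2: "ip Gf Z x = 2 * \<alpha> * ip (ph X1) Z x - ip X2 Z x - ip GK Z x"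
      unfolding Gf_def G7_def using Z by simp
    have 3: "ip (ph (lx Gf)) Z x = - 2 * \<alpha> * ip X2 Z x - ip (ph X3) Z x"
      unfolding Gf_def G7_def using Z by (simp add: lx_GK)
    show "ip (ph X3) Z x = ip ?R Z x"
      using 1 Z unfolding 2 3 by (simp add: power2_eq_square algebra_simps)
  qed auto
qed

text \<open>
  The first relation comes from the rotation of the gradient of \<open>\<rho>\<close> and the divergence of the gradient of
  \<open>f + sec\<close>, which both contain the Laplacian of \<open>f\<close>; the second one is the divergence of \<open>ph_X3\<close>.
\<close>
lemma laplace_relations:
  assumes E: "hor E" "ip E E x = 1"
  shows "2 * f2 x = 10 * \<alpha>\<^sup>2 * sec x - 4 * \<alpha>\<^sup>2 * f x - hdiv E GK x + D X sec x + 2 * sec x * f x"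
    and "4 * f2 x = 2 * hdiv E GK x - 2 * (sec x + \<alpha>\<^sup>2) * (f x - sec x) + D (ph X1) sec x / \<alpha>"
proof -
  note h = cr_hdiv[OF cr_X E(1), of x] cr_hdiv[OF cr_X1 E(1), of x] cr_hdiv[OF cr_X2 E(1), of x]
    cr_hdiv[OF cr_X3 E(1), of x]
  \<comment> \<open>Rotation of the gradient of the rotation function of the field.\<close>
  have A: "hdiv E Gf x + 2 * (sec x + 3 * \<alpha>\<^sup>2) * f x + D X sec x = 6 * \<alpha>\<^sup>2 * (f x - sec x)"
    using hrot_hgrad[OF E(1) cr_rotation_gradient[OF cr_X grad_f], of x] E h
    by (simp add: D_xi_rho power2_eq_square algebra_simps)
  have B: "hdiv E Gf x + hdiv E GK x = - 4 * \<alpha>\<^sup>2 * (f x - sec x) - 2 * f2 x"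
    unfolding Gf_def G7_def using E h by (simp add: D_xi_rho) (simp add: power2_eq_square algebra_simps)
  have "hdiv E (ph X3) x = - 6 * \<alpha> * f2 x - 2 * (sec x + \<alpha>\<^sup>2) * (\<alpha> * (f x - sec x)) + D (ph X1) sec x
      + 2 * \<alpha> * hdiv E GK x"
    unfolding ph_X3 using E h by (simp add: D_xi_rho) (simp add: algebra_simps)
  moreover have "hdiv E (ph X3) x = - 2 * \<alpha> * f2 x"
    using E h by (simp add: D_xi3_rho)
  ultimately have C: "4 * \<alpha> * f2 x = - 2 * (sec x + \<alpha>\<^sup>2) * (\<alpha> * (f x - sec x)) + D (ph X1) sec x + 2 * \<alpha> * hdiv E GK x"
    by (simp add: algebra_simps)
  show "2 * f2 x = 10 * \<alpha>\<^sup>2 * sec x - 4 * \<alpha>\<^sup>2 * f x - hdiv E GK x + D X sec x + 2 * sec x * f x"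
    using A B by (simp add: algebra_simps)
  have "\<alpha> * (4 * f2 x) = \<alpha> * (2 * hdiv E GK x - 2 * (sec x + \<alpha>\<^sup>2) * (f x - sec x) + D (ph X1) sec x / \<alpha>)"
    using C \<alpha>_nonzero by (simp add: algebra_simps)
  then show "4 * f2 x = 2 * hdiv E GK x - 2 * (sec x + \<alpha>\<^sup>2) * (f x - sec x) + D (ph X1) sec x / \<alpha>"
    using \<alpha>_nonzero by simp
qed

section \<open>Constant curvature of the contact planes\<close>

text \<open>
  With the derivatives of \<open>sec\<close> gone, the two scalar relations determine \<open>f\<close> as a function of \<open>sec\<close>, so the
  gradient of \<open>f\<close> vanishes too.  Then the gradients of \<open>f + sec\<close> and of the derivative of \<open>\<rho>\<close> leave
  \<open>X1 = 0\<close>, whose rotation is \<open>2\<alpha>(f - sec)\<close>.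
\<close>
lemma f_eq_sec_if_constant:
  assumes G0: "\<And>x. GK x = 0"
  shows "f x = sec x"
proof -
  have GKz: "GK = smul (\<lambda>_. 0) GK" using G0 by (auto simp: smul_def)
  have Dsec: "D Y sec x = 0" if "vf Y" for Y x
    using hgrad_D[OF grad_sec that, of x] G0 that g_zero(2)[OF vf_tangent[OF that]] by (simp add: ip_def)
  have rel: "3 * (\<alpha>\<^sup>2 - sec x) * f x = sec x * (9 * \<alpha>\<^sup>2 - sec x)" for x
  proof -
    obtain E where E: "hor E" "ip E E x = 1" using hor_unit_exists .
    have "hdiv E GK x = 0" by (subst GKz) (use E in simp)
    then show ?thesis using laplace_relations[OF E] by (simp add: Dsec algebra_simps)
  qed
  have ne: "\<alpha>\<^sup>2 - sec x \<noteq> 0" for x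
  proof
    assume "\<alpha>\<^sup>2 - sec x = 0"
    then have "sec x = \<alpha>\<^sup>2" by simp
    then have "\<alpha>\<^sup>2 * (8 * \<alpha>\<^sup>2) = 0" using rel[of x] by simp
    then show False using \<alpha>_nonzero by simp
  qed
  have Df: "D Y f x = 0" if Y: "vf Y" for Y x
  proof -
    have "(\<lambda>x. 3 * ((\<alpha>\<^sup>2 - sec x) * f x)) = (\<lambda>x. sec x * (9 * \<alpha>\<^sup>2 - sec x))" by (rule ext) (use rel in \<open>simp only: mult.assoc\<close>)
    then have "D Y (\<lambda>x. 3 * ((\<alpha>\<^sup>2 - sec x) * f x)) x = D Y (\<lambda>x. sec x * (9 * \<alpha>\<^sup>2 - sec x)) x" by (rule arg_cong)
    then show ?thesis using Y ne[of x] by (simp add: Dsec)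
  qed
  have Gf0: "Gf = smul (\<lambda>_. 0) \<xi>"
  proof (rule hgrad_unique[OF grad_f])
    show "hgrad f (smul (\<lambda>_. 0) \<xi>)" using Df by (auto simp: hgrad_def hor_def simp del: hor_vf hor_et)
  qed
  have X1z: "ip X1 X1 x = 0" for x
  proof -
    have e7: "ip (smul (\<lambda>_. 0) \<xi>) (ph X1) x = 2 * \<alpha> * ip X1 X1 x - ip X2 (ph X1) x"
    proof -
      have "ip Gf (ph X1) x = 2 * \<alpha> * ip X1 X1 x - ip X2 (ph X1) x - ip GK (ph X1) x"
        unfolding Gf_def G7_def by simp
      moreover have "ip GK (ph X1) x = 0" by (subst GKz) simp
      ultimately show ?thesis unfolding Gf0 by simp
    qed
    have "hgrad (D \<xi> \<rho>) (vadd (ph (lx Gf)) (vadd (smul (\<lambda>x. sec x + 3 * \<alpha>\<^sup>2) (ph X1)) (smul (\<lambda>_. - 2 * \<alpha>) X2)))"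
      by (rule cr_rotation_gradient[OF cr_X1 hgrad_lx[OF grad_f]])
    from hgradD(4)[OF this, of "ph X1" x]
    have "0 = (sec x + 3 * \<alpha>\<^sup>2) * ip X1 X1 x - 2 * \<alpha> * ip X2 (ph X1) x"
      unfolding Gf0 by (simp add: D_xi_rho Df Dsec)
    with e7 have "(sec x - \<alpha>\<^sup>2) * ip X1 X1 x = 0" by (auto simp: power2_eq_square algebra_simps)
    then show ?thesis using ne[of x] by simp
  qed
  have X1: "X1 = smul (\<lambda>_. 0) X1" using X1z ip_zero_iff[of X1] by (auto simp: smul_def)
  obtain E where E: "hor E" "ip E E x = 1" using hor_unit_exists .
  have "hrot E X1 x = 0" by (subst X1) (use E in simp)
  then show ?thesis using cr_hdiv(2)[OF cr_X1 E(1), of x] E \<alpha>_nonzero by (simp add: D_xi_rho)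
qed

end

section \<open>Variable curvature of the contact planes\<close>

text \<open>
  The hypothesis \<open>d\<close> is the derivative of the hypothesis \<open>m\<close>; multiplied by \<open>k\<close>, all derivatives and then \<open>m\<close> itself are
  eliminated.  The terms quadratic in \<open>S\<close> cancel.
\<close>
lemma first_elimination:
  fixes A k w S m dm dw dS :: real
  defines "K \<equiv> k - A" and "f \<equiv> w + (k - A)" and "df \<equiv> dw + S"
  assumes k: "k \<noteq> 0"
    and m: "k * m = k\<^sup>2 * w + S - k * (2 * K * f + 10 * A * K - 4 * A * f)"
    and dm: "k * dm = k\<^sup>2 * w * m / 2 + S * m + k * f * S"
    and dS: "k * dS = k\<^sup>2 * w * S + 2 * S\<^sup>2"
    and dw: "k * dw = - (2 * k + 4 * A) * S"
    and d: "S * m + k * dm - 2 * k * S * w - k\<^sup>2 * dw - dS + S * (2 * K * f + 10 * A * K - 4 * A * f)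
      + k * (2 * S * f + 2 * K * df + 10 * A * S - 4 * A * df) = 0"
  shows "((k + 12 * A) * w + 2 * (k\<^sup>2 + 7 * A * k + 28 * A\<^sup>2)) * S
      + k\<^sup>2 * ((6 * A - k) * w\<^sup>2 - 2 * (k + 2 * A) * (k - A) * w) = 0"
proof -
  define Q where "Q = 2 * K * f + 10 * A * K - 4 * A * f"
  have df: "k * df = - (k + 4 * A) * S" using dw by (simp add: df_def algebra_simps)
  have "0 = k * (S * m + k * dm - 2 * k * S * w - k\<^sup>2 * dw - dS + S * Q
      + k * (2 * S * f + 2 * K * df + 10 * A * S - 4 * A * df))"
    using d by (simp add: Q_def)
  also have "\<dots> = S * (k * m) + k * (k * dm) - 2 * k\<^sup>2 * S * w - k\<^sup>2 * (k * dw) - k * dS + k * S * Q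
      + k\<^sup>2 * (2 * S * f + 10 * A * S) + k * (2 * K - 4 * A) * (k * df)"
    by (simp add: power2_eq_square algebra_simps)
  also have "\<dots> = 2 * S * (k * m) + k\<^sup>2 * w * (k * m) / 2 + k\<^sup>2 * f * S - 2 * k\<^sup>2 * S * w
      + k\<^sup>2 * (2 * k + 4 * A) * S - k\<^sup>2 * w * S - 2 * S\<^sup>2 + k * S * Q
      + k\<^sup>2 * (2 * S * f + 10 * A * S) - k * (2 * K - 4 * A) * (k + 4 * A) * S"
    unfolding dm dS dw df by (simp add: power2_eq_square algebra_simps)
  also have "\<dots> = k * (((k + 12 * A) * w + 2 * (k\<^sup>2 + 7 * A * k + 28 * A\<^sup>2)) * S
      + k\<^sup>2 * ((6 * A - k) * w\<^sup>2 - 2 * (k + 2 * A) * (k - A) * w)) / 2"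
    unfolding m Q_def[symmetric] unfolding Q_def K_def f_def by (simp add: power2_eq_square) (simp add: algebra_simps)
  finally show ?thesis using k by simp
qed

text \<open>
  The relation \<open>r\<close> is linear in \<open>S\<close>, and so is \<open>k / S\<close> times its derivative \<open>d\<close>; eliminating \<open>S\<close> leaves a relation
  between \<open>k\<close> and \<open>w\<close>.  \<open>Db\<close> and \<open>Dc\<close> are the derivatives of \<open>b\<close> and \<open>c\<close> by the operator \<open>k d/dk\<close>, for which
  \<open>w\<close> goes to \<open>- (2k + 4A)\<close>.
\<close>
lemma second_elimination:
  fixes A k w S dw dS b c db dc Db Dc :: real
  assumes k: "k \<noteq> 0" and S: "S \<noteq> 0"
    and b: "b = (k + 12 * A) * w + 2 * (k\<^sup>2 + 7 * A * k + 28 * A\<^sup>2)"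
    and c: "c = (6 * A - k) * w\<^sup>2 - 2 * (k + 2 * A) * (k - A) * w"
    and r: "b * S + k\<^sup>2 * c = 0"
    and dS: "k * dS = k\<^sup>2 * w * S + 2 * S\<^sup>2"
    and dw: "k * dw = - (2 * k + 4 * A) * S"
    and db: "db = (k + 12 * A) * dw + S * w + 2 * (2 * k + 7 * A) * S"
    and dc: "dc = (6 * A - k) * (2 * w * dw) - S * w\<^sup>2 - 2 * ((k + 2 * A) * (k - A) * dw + (2 * k + A) * S * w)"
    and d: "db * S + b * dS + 2 * k * S * c + k\<^sup>2 * dc = 0"
    and Db: "Db = k * w - (k + 12 * A) * (2 * k + 4 * A) + 2 * (2 * k + 7 * A) * k"
    and Dc: "Dc = - k * w\<^sup>2 - 2 * (6 * A - k) * w * (2 * k + 4 * A) - 2 * (2 * k + A) * k * w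
      + 2 * (k + 2 * A) * (k - A) * (2 * k + 4 * A)"
  shows "b\<^sup>2 * w + b * Dc - c * Db = 0"
proof -
  have 1: "k * db = S * Db"
  proof -
    have "k * db = (k + 12 * A) * (k * dw) + k * S * w + 2 * (2 * k + 7 * A) * k * S"
      unfolding db by (simp add: algebra_simps)
    then show ?thesis unfolding dw Db by (simp add: algebra_simps)
  qed
  have 2: "k * dc = S * Dc"
  proof -
    have "k * dc = (6 * A - k) * (2 * w * (k * dw)) - k * S * w\<^sup>2 - 2 * ((k + 2 * A) * (k - A) * (k * dw) + (2 * k + A) * k * S * w)"
      unfolding dc by (simp add: algebra_simps)
    then show ?thesis unfolding dw Dc by (simp add: algebra_simps)
  qed
  have "0 = k * (db * S + b * dS + 2 * k * S * c + k\<^sup>2 * dc)" using d by simp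
  also have "\<dots> = S * (k * db) + b * (k * dS) + 2 * k\<^sup>2 * S * c + k\<^sup>2 * (k * dc)"
    by (simp add: power2_eq_square algebra_simps)
  also have "\<dots> = S * (Db * S + b * k\<^sup>2 * w + 2 * (b * S + k\<^sup>2 * c) + k\<^sup>2 * Dc)"
    unfolding 1 2 dS by (simp add: power2_eq_square algebra_simps)
  finally have 3: "Db * S + b * k\<^sup>2 * w + k\<^sup>2 * Dc = 0" using S r by simp
  have "0 = b * (Db * S + b * k\<^sup>2 * w + k\<^sup>2 * Dc)" using 3 by simp
  also have "\<dots> = Db * (b * S + k\<^sup>2 * c) + k\<^sup>2 * (b\<^sup>2 * w + b * Dc - c * Db)"
    by (simp add: power2_eq_square algebra_simps)
  finally show ?thesis using r k by simp
qed

context trans_sasakian_3 begin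

text \<open>
  The two components of the trace-free symmetric part of the derivative along the contact plane; this is
  the Cauchy-Riemann operator, so both vanish on solutions.
\<close>
definition tf1 :: "'m vfield \<Rightarrow> 'm vfield \<Rightarrow> 'm \<Rightarrow> real" where
  "tf1 E W x = ip (N E W) E x - ip (N (ph E) W) (ph E) x"

definition tf2 :: "'m vfield \<Rightarrow> 'm vfield \<Rightarrow> 'm \<Rightarrow> real" where
  "tf2 E W x = ip (N E W) (ph E) x + ip (N (ph E) W) E x"

lemma tf_linear [simp]:
  assumes "hor E" "vf W"
  shows "vf W' \<Longrightarrow> tf1 E (vadd W W') x = tf1 E W x + tf1 E W' x"
    "vf W' \<Longrightarrow> tf2 E (vadd W W') x = tf2 E W x + tf2 E W' x"
    "sm h \<Longrightarrow> tf1 E (smul h W) x = h x * tf1 E W x + D E h x * ip W E x - D (ph E) h x * ip W (ph E) x"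
    "sm h \<Longrightarrow> tf2 E (smul h W) x = h x * tf2 E W x + D E h x * ip W (ph E) x + D (ph E) h x * ip W E x"
  using assms by (simp_all add: tf1_def tf2_def algebra_simps)

lemma tf_ph [simp]:
  assumes "hor E" "hor W"
  shows "tf1 E (ph W) x = - tf2 E W x" "tf2 E (ph W) x = tf1 E W x"
  using assms by (simp_all add: tf1_def tf2_def ip_N_ph0)

lemma cr_tf [simp]:
  assumes "cr W h k" "hor E"
  shows "tf1 E W x = 0" "tf2 E W x = 0"
proof -
  have F: "hor (ph E)" using assms(2) by simp
  show "tf1 E W x = 0" "tf2 E W x = 0"
    unfolding tf1_def tf2_def crD(5)[OF assms] crD(5)[OF assms(1) F F] crD(5)[OF assms F] crD(5)[OF assms(1) F assms(2)]
      crD(5)[OF assms(1,2,2)]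
    using assms(2) by simp_all
qed

lemma unit_norm:
  assumes "hor U" "ip U U x = 1" "hor W"
  shows "ip W W x = (ip W U x)\<^sup>2 + (ip W (ph U) x)\<^sup>2"
proof -
  have "ip W W x = ip (smul (ip U U) W) W x" using assms by simp
  also have "\<dots> = (ip W U x)\<^sup>2 + (ip W (ph U) x)\<^sup>2"
    unfolding hor_frame[OF assms(1) hor_vf[OF assms(3)]]
    using assms ip_commute[of U W x] ip_commute[of "ph U" W x] by (simp add: power2_eq_square)
  finally show ?thesis .
qed

end

context star_soliton_3 begin

abbreviation S :: "'m \<Rightarrow> real" where "S \<equiv> ip GK GK"

text \<open>
  The analogue of \<open>D_zero_where_nonzero\<close> for fields.
\<close>
lemma field_zero_derivative:
  assumes W: "vf W" "\<And>x. S x \<noteq> 0 \<Longrightarrow> W x = 0" and x: "S x \<noteq> 0" and Y: "vf Y"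
  shows "N Y W x = 0"
proof -
  have "smul S W = smul (\<lambda>_. 0) W"
  proof
    fix y show "smul S W y = smul (\<lambda>_. 0) W y"
      by (cases "S y = 0") (simp_all add: smul_def W(2))
  qed
  then have "N Y (smul S W) x = N Y (smul (\<lambda>_. 0) W) x" by simp
  moreover have "N Y (smul (\<lambda>_. 0) W) x = 0"
    unfolding N_smul_right[OF sm_closed(1) Y W(1)] using Y by (simp add: vadd_def smul_def)
  ultimately have "vadd (smul (D Y S) W) (smul S (N Y W)) x = 0"
    using W(1) Y by simp
  then have "S x *\<^sub>R N Y W x = 0" by (simp add: vadd_def smul_def W(2)[OF x])
  then show ?thesis using x by simp
qed

text \<open>
  Apply the Cauchy-Riemann operator to the derivative of \<open>ph_X3\<close> along \<open>\<xi>\<close>.  All fields in it satisfy the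
  Cauchy-Riemann equations, and the coefficient of \<open>X2\<close> is \<open>sec + \<alpha>\<^sup>2\<close>; what survives is the complex product
  of \<open>X2\<close> and the gradient of \<open>sec\<close>.
\<close>
lemma X2_zero: "S x \<noteq> 0 \<Longrightarrow> X2 x = 0"
proof -
  assume x: "S x \<noteq> 0"
  obtain E where E: "hor E" "ip E E x = 1" using hor_unit_exists .
  have d: "D \<xi> (\<lambda>x. sec x + \<alpha>\<^sup>2) = (\<lambda>_. 0)" by auto
  have e: "ph (lx X3) = vadd (smul (\<lambda>_. - 3 * \<alpha>) X3)
    (vadd (smul (\<lambda>x. sec x + \<alpha>\<^sup>2) (ph X2)) (smul (\<lambda>_. 2 * \<alpha>) (smul (\<lambda>_. 0) \<xi>)))"
    using arg_cong[OF ph_X3, of lx] by (simp add: d lx_GK)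
  note c = cr_tf[OF cr_X2 E(1), of x] cr_tf[OF cr_X3 E(1), of x] cr_tf[OF cr_lx[OF cr_X3] E(1), of x]
  define k1 k2 u1 u2 where "k1 = D E sec x" "k2 = D (ph E) sec x" "u1 = ip (ph X2) E x" "u2 = ip (ph X2) (ph E) x"
  note defs = this
  have "tf1 E (ph (lx X3)) x = k1 * u1 - k2 * u2" "tf2 E (ph (lx X3)) x = k1 * u2 + k2 * u1"
    unfolding e using E c by (simp_all add: defs del: ip_ph_ph)
  then have 0: "k1 * u1 - k2 * u2 = 0" "k1 * u2 + k2 * u1 = 0"
    using E c by simp_all
  \<comment> \<open>The absolute value of a complex product is multiplicative.\<close>
  have "(k1\<^sup>2 + k2\<^sup>2) * (u1\<^sup>2 + u2\<^sup>2) = (k1 * u1 - k2 * u2)\<^sup>2 + (k1 * u2 + k2 * u1)\<^sup>2"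
    by (simp add: power2_eq_square algebra_simps)
  then have z: "(k1\<^sup>2 + k2\<^sup>2) * (u1\<^sup>2 + u2\<^sup>2) = 0" unfolding 0 by simp
  have k: "S x = k1\<^sup>2 + k2\<^sup>2"
    using unit_norm[OF E hor_GK] hgradD(4)[OF grad_sec E(1), of x] hgradD(4)[OF grad_sec, of "ph E" x] E
    by (simp add: defs)
  have hp: "hor (ph X2)" by simp
  have "ip (ph X2) (ph X2) x = u1\<^sup>2 + u2\<^sup>2"
    using unit_norm[OF E hp] by (simp only: defs)
  then have "ip X2 X2 x = 0" using z x k by auto
  then show "X2 x = 0" using ip_zero_iff[of X2 x] by simp
qed

lemma f1_zero: "S x \<noteq> 0 \<Longrightarrow> f1 x = 0" and f2_zero: "S x \<noteq> 0 \<Longrightarrow> f2 x = 0"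
proof -
  assume x: "S x \<noteq> 0"
  obtain E where E: "hor E" "ip E E x = 1" using hor_unit_exists .
  have "N Y X2 x = 0" if "vf Y" for Y
    by (rule field_zero_derivative[OF _ X2_zero x that]) simp
  then have z: "ip (N Y X2) Z x = 0" if "vf Y" "vf Z" for Y Z
    using that by (simp add: ip_def)
  have "hdiv E X2 x = 0" "hrot E X2 x = 0"
    unfolding hdiv_def hrot_def using z E by simp_all
  then show "f1 x = 0" "f2 x = 0"
    using cr_hdiv[OF cr_X2 E(1), of x] E \<alpha>_nonzero by (simp_all add: D_xi2_rho)
qed

definition \<kappa> :: "'m \<Rightarrow> real" where "\<kappa> x = sec x + \<alpha>\<^sup>2"
definition w :: "'m \<Rightarrow> real" where "w x = f x - sec x"
definition W0 :: "'m vfield" where "W0 = vadd (smul \<kappa> (ph X1)) (smul (\<lambda>_. 2 * \<alpha>) GK)"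

lemma sm_kappa [simp, intro]: "sm \<kappa>" and sm_w [simp, intro]: "sm w"
proof -
  have e: "\<kappa> = (\<lambda>x. sec x + \<alpha>\<^sup>2)" "w = (\<lambda>x. f x - sec x)" by (auto simp: \<kappa>_def w_def)
  show "sm \<kappa>" "sm w" unfolding e by auto
qed

lemma D_kappa: "vf Y \<Longrightarrow> D Y \<kappa> x = D Y sec x" and D_w: "vf Y \<Longrightarrow> D Y w x = D Y f x - D Y sec x"
proof -
  have e: "\<kappa> = (\<lambda>x. sec x + \<alpha>\<^sup>2)" "w = (\<lambda>x. f x - sec x)" by (auto simp: \<kappa>_def w_def)
  show "vf Y \<Longrightarrow> D Y \<kappa> x = D Y sec x" "vf Y \<Longrightarrow> D Y w x = D Y f x - D Y sec x"
    unfolding e by simp_all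
qed

text \<open>
  With \<open>X2\<close> and \<open>X3\<close> gone, this is \<open>ph_X3\<close>.
\<close>
lemma W0_zero: "S x \<noteq> 0 \<Longrightarrow> W0 x = 0"
proof -
  assume x: "S x \<noteq> 0"
  have l: "lx X2 x = 0"
  proof -
    have "ip (lx X2) Z x = ip (smul (\<lambda>_. 0) \<xi>) Z x" if Z: "vf Z" for Z
    proof -
      have "N \<xi> X2 x = 0" by (rule field_zero_derivative[OF _ X2_zero x]) simp_all
      then show ?thesis using X2_zero[OF x] Z phi_linear(2)[of 0 x 0]
        by (simp add: lx_N[of X2] ip_def vadd_def smul_def ph_def)
    qed
    then have "lx X2 x = smul (\<lambda>_. 0) \<xi> x" by (intro ip_eqI[where X = "lx X2" and Y = "smul (\<lambda>_. 0) \<xi>"]) auto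
    then show ?thesis by (simp add: smul_def)
  qed
  then have "ph X3 x = 0" using phi_linear(2)[of 0 x 0] by (simp add: ph_def)
  then have "smul (\<lambda>_. - 3 * \<alpha>) X2 x + W0 x = 0"
    unfolding ph_X3 W0_def \<kappa>_def[abs_def] by (simp only: vadd_def)
  then show "W0 x = 0" using X2_zero[OF x] by (simp add: smul_def)
qed

lemma kappa_X1:
  assumes "S x \<noteq> 0" "vf Z" shows "\<kappa> x * ip (ph X1) Z x = - 2 * \<alpha> * ip GK Z x"
proof -
  have "ip W0 Z x = 0" using W0_zero[OF assms(1)] assms(2) by (simp add: ip_def)
  then show ?thesis unfolding W0_def using assms(2) by simp
qed

lemma kappa_nonzero: "S x \<noteq> 0 \<Longrightarrow> \<kappa> x \<noteq> 0"
  using kappa_X1[of x GK] \<alpha>_nonzero by auto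

lemma GK_sec: "D GK sec x = S x"
  by (rule hgradD(4)[OF grad_sec hor_GK])

lemma D_GK_f:
  assumes x: "S x \<noteq> 0" shows "\<kappa> x * D GK f x = - (\<kappa> x + 4 * \<alpha>\<^sup>2) * S x"
proof -
  have "ip X2 GK x = 0" using X2_zero[OF x] by (simp add: ip_def)
  then have e: "D GK f x = 2 * \<alpha> * ip (ph X1) GK x - S x"
    unfolding hgradD(4)[OF grad_f hor_GK] Gf_def G7_def by simp
  have "\<kappa> x * D GK f x = 2 * \<alpha> * (\<kappa> x * ip (ph X1) GK x) - \<kappa> x * S x"
    unfolding e by (simp add: algebra_simps)
  then show ?thesis unfolding kappa_X1[OF x hor_vf[OF hor_GK]] by (simp add: power2_eq_square algebra_simps)
qed

text \<open>
  Differentiating \<open>W0 = 0\<close> computes the Hessian of \<open>sec\<close>; only its values in the direction of the gradient are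
  needed, since all further differentiation is along \<open>GK\<close>.
\<close>
lemma N_GK_GK:
  assumes x: "S x \<noteq> 0" and Z: "hor Z"
  shows "\<kappa> x * (2 * ip (N GK GK) Z x) = ((\<kappa> x)\<^sup>2 * w x + 2 * S x) * ip GK Z x"
proof -
  have "N GK W0 x = 0" by (rule field_zero_derivative[OF _ W0_zero x]) (auto simp: W0_def)
  then have "ip (N GK W0) Z x = 0" using Z by (simp add: ip_def)
  moreover have "ip (N GK (ph X1)) Z x = - \<alpha> * w x * ip GK Z x"
    using Z crD(5)[OF cr_X1 hor_GK, of "ph Z" x] f1_zero[OF x] by (simp add: ip_N_ph0 D_xi_rho w_def)
  ultimately have "S x * ip (ph X1) Z x - \<kappa> x * (\<alpha> * w x * ip GK Z x) + 2 * \<alpha> * ip (N GK GK) Z x = 0"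
    unfolding W0_def using Z by (simp add: D_kappa GK_sec)
  then have "\<kappa> x * (S x * ip (ph X1) Z x - \<kappa> x * (\<alpha> * w x * ip GK Z x) + 2 * \<alpha> * ip (N GK GK) Z x) = 0"
    by simp
  also have "\<kappa> x * (S x * ip (ph X1) Z x - \<kappa> x * (\<alpha> * w x * ip GK Z x) + 2 * \<alpha> * ip (N GK GK) Z x)
      = S x * (\<kappa> x * ip (ph X1) Z x) - (\<kappa> x)\<^sup>2 * (\<alpha> * w x * ip GK Z x) + \<kappa> x * (2 * \<alpha> * ip (N GK GK) Z x)"
    by (simp add: power2_eq_square algebra_simps)
  also have "\<dots> = \<alpha> * (\<kappa> x * (2 * ip (N GK GK) Z x) - ((\<kappa> x)\<^sup>2 * w x + 2 * S x) * ip GK Z x)"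
    unfolding kappa_X1[OF x hor_vf[OF Z]] by (simp add: algebra_simps)
  finally show ?thesis using \<alpha>_nonzero by simp
qed

lemma D_GK_S: "S x \<noteq> 0 \<Longrightarrow> \<kappa> x * D GK S x = (\<kappa> x)\<^sup>2 * w x * S x + 2 * (S x)\<^sup>2"
  using N_GK_GK[of x GK] ip_commute[of GK "N GK GK" x]
  by (simp add: D_ip power2_eq_square algebra_simps)

text \<open>
  The derivative of \<open>sec\<close> in the direction of \<open>X\<close>.
\<close>
definition m :: "'m \<Rightarrow> real" where "m = ip GK X"

lemma D_GK_m:
  assumes x: "S x \<noteq> 0"
  shows "\<kappa> x * D GK m x = (\<kappa> x)\<^sup>2 * w x * m x / 2 + S x * m x + \<kappa> x * f x * S x"
proof -
  have "D GK m x = ip (N GK GK) X x + f x * S x"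
    unfolding m_def using crD(5)[OF cr_X hor_GK hor_GK, of x] ip_commute[of GK "N GK X" x] by (simp add: D_ip)
  then show ?thesis using N_GK_GK[OF x hor_X] by (simp add: m_def algebra_simps)
qed

definition relation :: "'m \<Rightarrow> real" where
  "relation x = \<kappa> x * m x - \<kappa> x * \<kappa> x * w x - S x + \<kappa> x * (2 * sec x * f x + 10 * \<alpha>\<^sup>2 * sec x - 4 * \<alpha>\<^sup>2 * f x)"

text \<open>
  The divergence of \<open>W0 = 0\<close> computes the Laplacian of \<open>sec\<close>, which enters the first of the relations
  \<open>laplace_relations\<close>.
\<close>
lemma relation_zero:
  assumes x: "S x \<noteq> 0" shows "relation x = 0"
proof -
  obtain E where E: "hor E" "ip E E x = 1" using hor_unit_exists .
  have mX: "D X sec x = m x" unfolding m_def by (rule hgradD(4)[OF grad_sec hor_X])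
  have "N Y W0 x = 0" if "vf Y" for Y
    by (rule field_zero_derivative[OF _ W0_zero x that]) (auto simp: W0_def)
  then have "hdiv E W0 x = 0" unfolding hdiv_def using E by (simp add: ip_def)
  then have "- \<kappa> x * (2 * (\<alpha> * w x)) + ip GK (ph X1) x + 2 * \<alpha> * hdiv E GK x = 0"
    unfolding W0_def using E cr_hdiv(2)[OF cr_X1 E(1), of x] hgradD(4)[OF grad_sec, of "ph X1" x]
    by (simp add: D_kappa D_xi_rho w_def)
  then have "\<kappa> x * (- \<kappa> x * (2 * (\<alpha> * w x)) + ip GK (ph X1) x + 2 * \<alpha> * hdiv E GK x) = 0" by simp
  moreover have "\<kappa> x * ip GK (ph X1) x = - 2 * \<alpha> * S x"
    using kappa_X1[OF x hor_vf[OF hor_GK]] ip_commute[of GK "ph X1" x] by simp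
  ultimately have "\<alpha> * (2 * (\<kappa> x * hdiv E GK x - (\<kappa> x * \<kappa> x * w x + S x))) = 0"
    by (simp add: algebra_simps)
  then have "\<kappa> x * hdiv E GK x = \<kappa> x * \<kappa> x * w x + S x" using \<alpha>_nonzero by simp
  moreover have "hdiv E GK x = 10 * \<alpha>\<^sup>2 * sec x - 4 * \<alpha>\<^sup>2 * f x + m x + 2 * sec x * f x"
    using laplace_relations(1)[OF E] f2_zero[OF x] mX by simp
  ultimately show ?thesis by (simp add: relation_def algebra_simps)
qed

lemma sm_m [simp, intro]: "sm m" unfolding m_def by auto

lemma sm_S [simp, intro]: "sm S" by auto

lemma D_GK_w: "S x \<noteq> 0 \<Longrightarrow> \<kappa> x * D GK w x = - (2 * \<kappa> x + 4 * \<alpha>\<^sup>2) * S x"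
  using D_GK_f[of x] by (simp add: D_w GK_sec algebra_simps)

lemma reduced_relation:
  assumes x: "S x \<noteq> 0"
  shows "((\<kappa> x + 12 * \<alpha>\<^sup>2) * w x + 2 * (\<kappa> x * \<kappa> x + 7 * \<alpha>\<^sup>2 * \<kappa> x + 28 * \<alpha>\<^sup>2 * \<alpha>\<^sup>2)) * S x
    + \<kappa> x * \<kappa> x * ((6 * \<alpha>\<^sup>2 - \<kappa> x) * (w x * w x) - 2 * (\<kappa> x + 2 * \<alpha>\<^sup>2) * (\<kappa> x - \<alpha>\<^sup>2) * w x) = 0"
proof -
  have sf: "sec x = \<kappa> x - \<alpha>\<^sup>2" "f x = w x + (\<kappa> x - \<alpha>\<^sup>2)" for x by (simp_all add: \<kappa>_def w_def)
  have e: "relation = (\<lambda>x. \<kappa> x * m x - \<kappa> x * \<kappa> x * w x - S x + \<kappa> x * (2 * sec x * f x + 10 * \<alpha>\<^sup>2 * sec x - 4 * \<alpha>\<^sup>2 * f x))"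
    by (auto simp: relation_def)
  have z: "D GK relation x = 0"
    by (rule D_zero_where_nonzero[OF sm_S _ _ relation_zero x]) (auto simp: e)
  have df: "D GK f x = D GK w x + S x" using D_w[of GK x] by (simp add: GK_sec)
  have d: "S x * m x + \<kappa> x * D GK m x - 2 * \<kappa> x * S x * w x - (\<kappa> x)\<^sup>2 * D GK w x - D GK S x
      + S x * (2 * (\<kappa> x - \<alpha>\<^sup>2) * (w x + (\<kappa> x - \<alpha>\<^sup>2)) + 10 * \<alpha>\<^sup>2 * (\<kappa> x - \<alpha>\<^sup>2) - 4 * \<alpha>\<^sup>2 * (w x + (\<kappa> x - \<alpha>\<^sup>2)))
      + \<kappa> x * (2 * S x * (w x + (\<kappa> x - \<alpha>\<^sup>2)) + 2 * (\<kappa> x - \<alpha>\<^sup>2) * (D GK w x + S x) + 10 * \<alpha>\<^sup>2 * S x - 4 * \<alpha>\<^sup>2 * (D GK w x + S x)) = 0"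
    (is "?d = 0")
  proof -
    have "D GK relation x = ?d"
      unfolding e by (simp add: D_kappa GK_sec df) (simp add: sf power2_eq_square algebra_simps)
    then show ?thesis using z by simp
  qed
  have "((\<kappa> x + 12 * \<alpha>\<^sup>2) * w x + 2 * ((\<kappa> x)\<^sup>2 + 7 * \<alpha>\<^sup>2 * \<kappa> x + 28 * (\<alpha>\<^sup>2)\<^sup>2)) * S x
    + (\<kappa> x)\<^sup>2 * ((6 * \<alpha>\<^sup>2 - \<kappa> x) * (w x)\<^sup>2 - 2 * (\<kappa> x + 2 * \<alpha>\<^sup>2) * (\<kappa> x - \<alpha>\<^sup>2) * w x) = 0"
  proof (rule first_elimination[OF kappa_nonzero[OF x] _ _ D_GK_S[OF x] D_GK_w[OF x] d])
    show "\<kappa> x * m x = (\<kappa> x)\<^sup>2 * w x + S x - \<kappa> x * (2 * (\<kappa> x - \<alpha>\<^sup>2) * (w x + (\<kappa> x - \<alpha>\<^sup>2)) + 10 * \<alpha>\<^sup>2 * (\<kappa> x - \<alpha>\<^sup>2) - 4 * \<alpha>\<^sup>2 * (w x + (\<kappa> x - \<alpha>\<^sup>2)))"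
      using relation_zero[OF x] unfolding relation_def sf by (simp add: power2_eq_square)
    show "\<kappa> x * D GK m x = (\<kappa> x)\<^sup>2 * w x * m x / 2 + S x * m x + \<kappa> x * (w x + (\<kappa> x - \<alpha>\<^sup>2)) * S x"
      using D_GK_m[OF x] unfolding sf(2) .
  qed
  then show ?thesis by (simp only: power2_eq_square mult.assoc)
qed

text \<open>
  A further derivative of \<open>reduced_relation\<close> eliminates \<open>S\<close> and leaves a cubic equation for \<open>w\<close> over the polynomials in
  \<open>\<kappa>\<close>, with leading coefficient \<open>144 a\<^sup>2\<close> at \<open>\<kappa> = 0\<close>.
\<close>
lemma GK_zero: "GK x0 = 0"
proof (rule ccontr)
  assume "GK x0 \<noteq> 0"
  then have x0: "S x0 \<noteq> 0" using ip_zero_iff[of GK x0] by simp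
  define a where "a = \<alpha>\<^sup>2"
  have a: "a \<noteq> 0" using \<alpha>_nonzero by (simp add: a_def)
  \<comment> \<open>The relation is \<open>(b1 w + b0) S + \<kappa>\<^sup>2 (g2 w\<^sup>2 + g1 w) = 0\<close>; \<open>e0\<close>, \<open>- h1\<close> and \<open>- g1 l\<close> are the coefficients in the derivatives of the two brackets, and \<open>q\<close> are those of the resulting cubic.\<close>
  define b1 b0 g2 g1 e0 h1 l :: "real poly" where
    "b1 = [:12 * a, 1:]" "b0 = [:56 * a\<^sup>2, 14 * a, 2:]" "g2 = [:6 * a, -1:]" "g1 = [:4 * a\<^sup>2, -2 * a, -2:]"
    "e0 = [:-48 * a\<^sup>2, -14 * a, 2:]" "h1 = [:48 * a\<^sup>2, 18 * a:]" "l = [:4 * a, 2:]"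
  note defs = this
  define q :: "nat \<Rightarrow> real poly" where
    "q i = (if i = 0 then - (b0 * g1 * l)
      else if i = 1 then b0\<^sup>2 - b1 * g1 * l - b0 * h1 - g1 * e0
      else if i = 2 then 2 * b1 * b0 - b1 * h1 - [:0, 1:] * b0 - g2 * e0 - [:0, 1:] * g1
      else b1\<^sup>2 - b1 * [:0, 1:] - g2 * [:0, 1:])" for i
  have pv: "poly b1 t = t + 12 * a" "poly b0 t = 2 * t\<^sup>2 + 14 * a * t + 56 * a\<^sup>2" "poly g2 t = 6 * a - t"
    "poly g1 t = 4 * a\<^sup>2 - 2 * a * t - 2 * t\<^sup>2" "poly e0 t = 2 * t\<^sup>2 - 14 * a * t - 48 * a\<^sup>2"
    "poly h1 t = 48 * a\<^sup>2 + 18 * a * t" "poly l t = 2 * t + 4 * a" for t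
    by (simp_all add: defs power2_eq_square algebra_simps)
  have qv: "poly (q 0) t = - (poly b0 t * poly g1 t * poly l t)"
    "poly (q (Suc 0)) t = (poly b0 t)\<^sup>2 - poly b1 t * poly g1 t * poly l t - poly b0 t * poly h1 t - poly g1 t * poly e0 t"
    "poly (q (Suc (Suc 0))) t = 2 * poly b1 t * poly b0 t - poly b1 t * poly h1 t - t * poly b0 t - poly g2 t * poly e0 t - t * poly g1 t"
    "poly (q (Suc (Suc (Suc 0)))) t = (poly b1 t)\<^sup>2 - poly b1 t * t - poly g2 t * t" for t
    by (simp_all add: q_def)
  note qv = qv[unfolded pv]
  have sum3: "(\<Sum>i\<le>Suc (Suc (Suc 0)). h i) = h 0 + h (Suc 0) + h (Suc (Suc 0)) + h (Suc (Suc (Suc 0)))"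
    for h :: "nat \<Rightarrow> real" by simp
  let ?P = "\<lambda>x. ((\<kappa> x + 12 * a) * w x + 2 * (\<kappa> x * \<kappa> x + 7 * a * \<kappa> x + 28 * a * a)) * S x
    + \<kappa> x * \<kappa> x * ((6 * a - \<kappa> x) * (w x * w x) - 2 * (\<kappa> x + 2 * a) * (\<kappa> x - a) * w x)"
  have P: "?P x = 0" if "S x \<noteq> 0" for x
    using reduced_relation[OF that] by (simp add: a_def)
  show False
  proof (rule log_transcendental[where S = S and k = \<kappa> and w = w and G = GK and a = a and d = "Suc (Suc (Suc 0))" and q = q and ?x0.0 = x0])
    fix x assume x: "S x \<noteq> 0"
    show "D GK \<kappa> x = S x" by (simp add: D_kappa GK_sec)
    show "\<kappa> x * D GK w x = - (2 * \<kappa> x + 4 * a) * S x" using D_GK_w[OF x] by (simp add: a_def)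
    have z: "D GK ?P x = 0"
      by (rule D_zero_where_nonzero[OF sm_S _ _ P x]) auto
    have d: "((\<kappa> x + 12 * a) * D GK w x + S x * w x + 2 * (2 * \<kappa> x + 7 * a) * S x) * S x
      + ((\<kappa> x + 12 * a) * w x + 2 * ((\<kappa> x)\<^sup>2 + 7 * a * \<kappa> x + 28 * a\<^sup>2)) * D GK S x
      + 2 * \<kappa> x * S x * ((6 * a - \<kappa> x) * (w x)\<^sup>2 - 2 * (\<kappa> x + 2 * a) * (\<kappa> x - a) * w x)
      + (\<kappa> x)\<^sup>2 * ((6 * a - \<kappa> x) * (2 * w x * D GK w x) - S x * (w x)\<^sup>2
          - 2 * ((\<kappa> x + 2 * a) * (\<kappa> x - a) * D GK w x + (2 * \<kappa> x + a) * S x * w x)) = 0"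
      (is "?d = 0")
    proof -
      have "D GK ?P x = ?d"
        by (simp add: D_kappa GK_sec) (simp add: power2_eq_square algebra_simps)
      then show ?thesis using z by simp
    qed
    have r: "((\<kappa> x + 12 * a) * w x + 2 * ((\<kappa> x)\<^sup>2 + 7 * a * \<kappa> x + 28 * a\<^sup>2)) * S x
      + (\<kappa> x)\<^sup>2 * ((6 * a - \<kappa> x) * (w x)\<^sup>2 - 2 * (\<kappa> x + 2 * a) * (\<kappa> x - a) * w x) = 0"
      using P[OF x] by (simp add: power2_eq_square)
    have dw: "\<kappa> x * D GK w x = - (2 * \<kappa> x + 4 * a) * S x" using D_GK_w[OF x] by (simp add: a_def)
    note p1 = second_elimination[OF kappa_nonzero[OF x] x refl refl r D_GK_S[OF x] dw refl refl d refl refl]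
    show "(\<Sum>i\<le>Suc (Suc (Suc 0)). poly (q i) (\<kappa> x) * w x ^ i) = 0"
      by (rule trans[OF _ p1], unfold sum3 qv, simp add: power3_eq_cube)
        (simp add: power2_eq_square algebra_simps)
  next
    show "poly (q (Suc (Suc (Suc 0)))) 0 \<noteq> 0" using a by (simp add: q_def pv)
  qed (use a x0 in auto)
qed

theorem scalar_curvature_soliton: "scalar_curvature A g N x = p x / 2 + 1 / 3 - lam + 4 * \<alpha>\<^sup>2"
proof -
  have "f x = sec x" by (rule f_eq_sec_if_constant[OF GK_zero])
  then have "sec x = - c x / 4" by (simp add: f_def)
  then show ?thesis unfolding scalar_curvature_eq by (simp add: c_def field_simps)
qed

end

theorem theorem3p2:
  fixes A :: "('m::{t2_space,second_countable_topology}, real ^ 3) chart set"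
    and \<phi> :: "'m \<Rightarrow> 'm tvec \<Rightarrow> 'm tvec"
    and \<xi> :: "'m vfield"
    and \<eta> :: "'m \<Rightarrow> 'm tvec \<Rightarrow> real"
    and g :: "'m \<Rightarrow> 'm tvec \<Rightarrow> 'm tvec \<Rightarrow> real"
    and N :: "'m vfield \<Rightarrow> 'm vfield \<Rightarrow> 'm vfield"
    and \<alpha> \<beta> :: real
    and V :: "'m vfield"
    and lam :: real
    and p :: "'m \<Rightarrow> real"
  assumes "trans_sasakian A \<phi> \<xi> \<eta> g N (\<lambda>_. \<alpha>) (\<lambda>_. \<beta>)"
    and "\<alpha> \<noteq> 0"
    and "star_conformal_ricci_soliton A \<phi> g N V lam p"
  shows "\<forall>x. scalar_curvature A g N x =
           (1 - \<beta>\<^sup>2 / \<alpha>\<^sup>2) * (p x / 2 + 1 / 3 - lam + 4 * \<alpha>\<^sup>2)"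
proof -
  have "smooth_manifold A" "riemannian_metric A g" "levi_civita A g N"
    using assms(1) by (simp_all add: trans_sasakian_def almost_contact_metric_def)
  then interpret star_soliton_3 A g N \<phi> \<xi> \<eta> \<alpha> \<beta> V lam p
    by unfold_locales (use assms in simp_all)
  show ?thesis using scalar_curvature_soliton beta_zero by simp
qed

end
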